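(* Let $X=(X(t))_{t\ge0}$, $X(0)=0$, be a real-valued Lévy process without Gaussian component ($\sigma=0$), with arbitrary drift $\gamma\in\mathbb R$ and Lévy measure $\rho$, i.e. $E e^{isX(t)}=e^{t\psi(s)}$ with $\psi(s)=i\gamma s+\int(e^{isx}-1-isx\mathbf 1(|x|\le1))\rho(dx)$. Assume $\rho((0,\infty))>0$, $\rho((-\infty,0))<\infty$, and that for some $a>0$ with $\rho((a,\infty))>0$ the probability measure $\mu_a(\cdot)=\rho(\cdot\cap(a,\infty))/\rho((a,\infty))$ satisfies $$\mu_a((u,\infty))=\exp\Big(-\int_0^u h(v)\,dv\Big)\quad\text{for all }u>u_0,$$ for some $u_0\ge0$ and a positive, continuous, strictly increasing function $h$ with $h(v)\to\infty$ as $v\to\infty$, such that for every $c>0$ there is $v_c$ with $h(v+c)\le\exp\big(c\,h(v)/8\big)$ for all $v\ge v_c$. Then $$\lim_{u\to\infty}\frac{P\big(\sup_{0\le t\le1}X(t)>u\big)}{P(X(1)>u)}=1 .$$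
   Context: A Lévy measure $\rho$ is a Borel measure on $\mathbb R$ with $\int\min\{1,x^2\}\rho(dx)<\infty$. *)

theory Defs
  imports "HOL-Probability.Probability"
begin

definition levy_measure :: "real measure \<Rightarrow> bool" where
  "levy_measure \<rho> \<longleftrightarrow> sets \<rho> = sets borel \<and>
     (\<integral>\<^sup>+ x. ennreal (min 1 (x\<^sup>2)) \<partial>\<rho>) < \<infinity>"

definition levy_exponent :: "real \<Rightarrow> real measure \<Rightarrow> real \<Rightarrow> complex" where
  "levy_exponent \<gamma> \<rho> s =
     \<i> * complex_of_real (\<gamma> * s) +
     (CLINT x|\<rho>. iexp (s * x) - 1 - \<i> * complex_of_real (s * x * indicator {-1..1} x))"

definition levy_process :: "'a measure \<Rightarrow> (real \<Rightarrow> 'a \<Rightarrow> real) \<Rightarrow> bool" where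
  "levy_process M X \<longleftrightarrow>
     prob_space M \<and>
     (\<forall>t\<ge>0. X t \<in> borel_measurable M) \<and>
     (\<forall>\<omega>\<in>space M. X 0 \<omega> = 0) \<and>
     (\<forall>n::nat. \<forall>t::nat \<Rightarrow> real. 0 \<le> t 0 \<and> (\<forall>i<n. t i < t (Suc i)) \<longrightarrow>
        prob_space.indep_vars M (\<lambda>_. borel) (\<lambda>i \<omega>. X (t (Suc i)) \<omega> - X (t i) \<omega>) {..<n}) \<and>
     (\<forall>s\<ge>0. \<forall>t\<ge>0. distr M borel (\<lambda>\<omega>. X (s + t) \<omega> - X s \<omega>) = distr M borel (X t)) \<and>
     (\<forall>\<omega>\<in>space M. \<forall>t\<ge>0. continuous (at_right t) (\<lambda>s. X s \<omega>) \<and>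
        (t > 0 \<longrightarrow> (\<exists>l. ((\<lambda>s. X s \<omega>) \<longlongrightarrow> l) (at_left t))))"

end

theory Submission
  imports Defs "HOL-Real_Asymp.Real_Asymp"
begin

text \<open>
  Let \<open>H\<close> be the integral of \<open>h\<close>, so that jumps above a level \<open>b\<close> have tail \<open>K exp (- H x)\<close> with \<open>H\<close> convex.
  Tilt the law of \<open>X 1\<close> by \<open>exp (\<theta> x)\<close>, with \<open>\<theta>\<close> tuned so that \<open>u\<close> is typical. Under the tilted law the number
  of jumps above \<open>b\<close> is Poisson with a mean \<open>L\<close> that grows faster than any power of \<open>exp \<theta>\<close>. Chernoff's bound
  \<open>P (X 1 > u) \<le> exp (- \<theta> u) E (exp (\<theta> X 1))\<close> is sharp up to a factor \<open>exp (- L powr (3/4))\<close>: a typical tilted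
  configuration misses \<open>u\<close> by an amount that few extra jumps can bridge, each costing at most \<open>\<theta>\<close> per unit of length.

  With \<open>\<epsilon> = exp (- 3 \<theta>)\<close> and \<open>\<delta> = exp (- \<theta>)\<close> three things follow. The exponential moment of \<open>X (1 - \<epsilon>)\<close> is
  smaller than that of \<open>X 1\<close> by a factor of about \<open>exp (- \<epsilon> L)\<close>, so the process almost never exceeds \<open>u\<close> before time
  \<open>1 - \<epsilon>\<close>. During the remaining time it rarely falls by \<open>\<delta>\<close>, since \<open>\<epsilon> / \<delta>\<^sup>2\<close> is small. Finally \<open>X 1\<close> rarely lands in
  \<open>(u - \<delta>, u]\<close>: most jumps lie where \<open>h \<le> exp (\<theta> / 2)\<close>, and lengthening one of them by up to \<open>exp (- \<theta> / 2)\<close>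
  changes probabilities by a bounded factor only. Ottaviani's inequality turns these facts into
  \<open>P (sup X > u) \<le> (1 + o(1)) P (X 1 > u)\<close>.
\<close>

section \<open>Compound Poisson distributions\<close>

text \<open>No path decomposition of the process is used. All statements about jumps concern the
  laws \<open>P t\<close>, which characteristic functions identify as compound Poisson mixtures with
  an independent remainder; paths matter only for the bound on the supremum. The obstacle is that no
  asymptotic formula for the tail of \<open>X 1\<close> is at hand: with
  \<open>L = mom 0 \<theta>\<close>, its size at the level \<open>U \<theta>\<close> is known only
  up to the factor \<open>exp (- (L powr (3 / 4)))\<close>. Errors estimated by Chernoff's bound
  have to beat this loss: too few tilted jumps cost \<open>exp (- L / 16)\<close>, and stopping
  early costs \<open>exp (- (L powr (7 / 8)))\<close>, up to lower order terms. The mass just below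
  the level is too large for that and is compared with the tail directly, by lengthening a jump. The
  growth hypothesis enters with \<open>c = 2\<close>: two units beyond a point where
  \<open>h\<close> equals \<open>2 * \<theta>\<close>, it is still at most
  \<open>exp (\<theta> / 2)\<close>. This leaves room for about \<open>exp (\<theta> / 4)\<close>
  disjoint shifts by multiples of \<open>exp (- \<theta>)\<close>, each at bounded cost.\<close>

lemma real_distribution_convolution:
  assumes "real_distribution \<mu>" "real_distribution \<eta>"
  shows "real_distribution (\<mu> \<star> \<eta>)"
proof -
  interpret \<mu>: real_distribution \<mu> by fact
  interpret \<eta>: real_distribution \<eta> by fact
  interpret P: pair_prob_space \<mu> \<eta> ..
  show ?thesis
    unfolding convolution_def by (intro P.real_distribution_distr) simp
qed

text \<open>Fubini for integrands that split into sums of products. One summand makes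
  \<open>char\<close> multiplicative; two and three summands expand the tilted first and second
  moments of a sum.\<close>

lemma integral_convolution_sum_mult:
  fixes f g :: "'i \<Rightarrow> real \<Rightarrow> 'a::{real_normed_field,banach,second_countable_topology}"
  assumes "real_distribution \<mu>" "real_distribution \<eta>" "finite I"
    and f: "\<And>i. i \<in> I \<Longrightarrow> integrable \<mu> (f i)" and g: "\<And>i. i \<in> I \<Longrightarrow> integrable \<eta> (g i)"
    and k: "k \<in> borel_measurable borel" "\<And>x y. k (x + y) = (\<Sum>i\<in>I. f i x * g i y)"
  shows "integrable (\<mu> \<star> \<eta>) k" "integral\<^sup>L (\<mu> \<star> \<eta>) k = (\<Sum>i\<in>I. integral\<^sup>L \<mu> (f i) * integral\<^sup>L \<eta> (g i))"
proof -
  interpret \<mu>: real_distribution \<mu> by fact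
  interpret \<eta>: real_distribution \<eta> by fact
  interpret P: pair_prob_space \<mu> \<eta> ..
  have m [measurable]: "f i \<in> borel_measurable borel" "g i \<in> borel_measurable borel" if "i \<in> I" for i
    using f[OF that] g[OF that] by (auto dest!: borel_measurable_integrable)
  have i: "integrable (\<mu> \<Otimes>\<^sub>M \<eta>) (\<lambda>p. f i (fst p) * g i (snd p))" if "i \<in> I" for i
    using f[OF that] g[OF that] m[OF that] by (intro P.Fubini_integrable) (auto simp: norm_mult)
  have e: "k (fst p + snd p) = (\<Sum>i\<in>I. f i (fst p) * g i (snd p))" for p
    by (rule k(2))
  have "integrable (\<mu> \<Otimes>\<^sub>M \<eta>) (\<lambda>p. k (fst p + snd p))"
    unfolding e using i by (rule Bochner_Integration.integrable_sum)
  then show "integrable (\<mu> \<star> \<eta>) k"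
    unfolding convolution_def case_prod_beta using k(1) by (subst integrable_distr_eq) auto
  have "integral\<^sup>L (\<mu> \<star> \<eta>) k = (\<integral>p. (\<Sum>i\<in>I. f i (fst p) * g i (snd p)) \<partial>(\<mu> \<Otimes>\<^sub>M \<eta>))"
    unfolding convolution_def case_prod_beta using k(1) by (subst integral_distr) (auto simp: e)
  also have "\<dots> = (\<Sum>i\<in>I. \<integral>p. f i (fst p) * g i (snd p) \<partial>(\<mu> \<Otimes>\<^sub>M \<eta>))"
    using i by (rule Bochner_Integration.integral_sum)
  also have "\<dots> = (\<Sum>i\<in>I. integral\<^sup>L \<mu> (f i) * integral\<^sup>L \<eta> (g i))"
  proof (rule sum.cong[OF refl])
    fix j assume j: "j \<in> I"
    have "(\<integral>p. f j (fst p) * g j (snd p) \<partial>(\<mu> \<Otimes>\<^sub>M \<eta>)) = (\<integral>x. \<integral>y. f j x * g j y \<partial>\<eta> \<partial>\<mu>)"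
      using P.integral_fst'[OF i[OF j]] by simp
    also have "\<dots> = integral\<^sup>L \<mu> (f j) * integral\<^sup>L \<eta> (g j)"
      using f[OF j] g[OF j] by simp
    finally show "(\<integral>p. f j (fst p) * g j (snd p) \<partial>(\<mu> \<Otimes>\<^sub>M \<eta>)) = integral\<^sup>L \<mu> (f j) * integral\<^sup>L \<eta> (g j)" .
  qed
  finally show "integral\<^sup>L (\<mu> \<star> \<eta>) k = (\<Sum>i\<in>I. integral\<^sup>L \<mu> (f i) * integral\<^sup>L \<eta> (g i))" .
qed

lemma char_convolution:
  assumes "real_distribution \<mu>" "real_distribution \<eta>"
  shows "char (\<mu> \<star> \<eta>) s = char \<mu> s * char \<eta> s"
proof -
  interpret \<mu>: real_distribution \<mu> by fact
  interpret \<eta>: real_distribution \<eta> by fact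
  have "integral\<^sup>L (\<mu> \<star> \<eta>) (\<lambda>x. iexp (s * x)) =
      (\<Sum>i\<in>{()}. integral\<^sup>L \<mu> (\<lambda>x. iexp (s * x)) * integral\<^sup>L \<eta> (\<lambda>x. iexp (s * x)))"
    using assms
    by (intro integral_convolution_sum_mult(2))
       (auto intro!: \<mu>.integrable_iexp \<eta>.integrable_iexp simp: distrib_left exp_add[symmetric])
  then show ?thesis
    by (simp add: char_def)
qed

text \<open>Valued in \<open>ennreal\<close>, so that it can be handled before any exponential
  moment is known to be finite.\<close>

definition mgf :: "real measure \<Rightarrow> real \<Rightarrow> ennreal" where
  "mgf \<mu> \<theta> = (\<integral>\<^sup>+x. ennreal (exp (\<theta> * x)) \<partial>\<mu>)"

lemma mgf_convolution:
  assumes "real_distribution \<mu>" "real_distribution \<eta>"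
  shows "mgf (\<mu> \<star> \<eta>) \<theta> = mgf \<mu> \<theta> * mgf \<eta> \<theta>"
proof -
  interpret \<mu>: real_distribution \<mu> by fact
  interpret \<eta>: real_distribution \<eta> by fact
  show ?thesis
    unfolding mgf_def
    by (subst nn_integral_convolution)
       (auto simp: \<mu>.finite_measure_axioms \<eta>.finite_measure_axioms distrib_left exp_add ennreal_mult
          nn_integral_cmult nn_integral_multc)
qed

primrec convpow :: "real measure \<Rightarrow> real measure \<Rightarrow> nat \<Rightarrow> real measure" where
  "convpow \<mu> \<eta> 0 = \<eta>"
| "convpow \<mu> \<eta> (Suc n) = (\<mu> \<star> convpow \<mu> \<eta> n)"

text \<open>Hides one jump in the remainder, so that a shifted Poisson series can again be read as a
  compound Poisson law.\<close>

lemma convpow_shift: "convpow \<mu> (\<mu> \<star> \<eta>) n = convpow \<mu> \<eta> (Suc n)"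
  by (induction n) auto

text \<open>The summand \<open>\<eta>\<close> is the law of an independent remainder.\<close>

definition compound_poisson :: "real \<Rightarrow> real measure \<Rightarrow> real measure \<Rightarrow> real measure" where
  "compound_poisson l \<mu> \<eta> = measure_pmf (poisson_pmf l) \<bind> convpow \<mu> \<eta>"

locale poisson_jumps =
  fixes l :: real and \<mu> \<eta> :: "real measure"
  assumes l_pos: "0 < l" and mu: "real_distribution \<mu>" and eta: "real_distribution \<eta>"
begin

abbreviation pois :: "nat \<Rightarrow> real" where
  "pois n \<equiv> l ^ n / fact n * exp (- l)"

lemma real_distribution_convpow: "real_distribution (convpow \<mu> \<eta> n)"
  by (induction n) (auto intro: real_distribution_convolution mu eta)

lemma convpow_in_space: "convpow \<mu> \<eta> n \<in> space (subprob_algebra borel)"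
proof -
  interpret real_distribution "convpow \<mu> \<eta> n" by (rule real_distribution_convpow)
  show ?thesis
    by (simp add: space_subprob_algebra subprob_space_axioms)
qed

lemma measurable_convpow [measurable]:
  "convpow \<mu> \<eta> \<in> measurable (measure_pmf p) (subprob_algebra borel)"
  by (auto simp: measurable_def convpow_in_space)

lemma real_distribution_compound_poisson: "real_distribution (compound_poisson l \<mu> \<eta>)"
proof -
  have "prob_space (compound_poisson l \<mu> \<eta>)"
    unfolding compound_poisson_def
    using real_distribution_convpow
    by (intro measure_pmf.prob_space_bind[where S=borel]) (auto simp: real_distribution_def convpow_in_space)
  moreover have "sets (compound_poisson l \<mu> \<eta>) = sets borel"
    unfolding compound_poisson_def
    using real_distribution.events_eq_borel[OF real_distribution_convpow] by (intro sets_bind) auto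
  ultimately show ?thesis
    by (simp add: real_distribution_def real_distribution_axioms_def)
qed

lemma nn_integral_compound_poisson:
  assumes "f \<in> borel_measurable borel"
  shows "(\<integral>\<^sup>+x. f x \<partial>compound_poisson l \<mu> \<eta>) = (\<Sum>n. ennreal (pois n) * (\<integral>\<^sup>+x. f x \<partial>convpow \<mu> \<eta> n))"
  unfolding compound_poisson_def using l_pos
  by (simp add: nn_integral_bind[OF assms measurable_convpow] nn_integral_measure_pmf nn_integral_count_space_nat)

lemma measure_compound_poisson:
  assumes "B \<in> sets borel"
  shows "(\<lambda>n. pois n * measure (convpow \<mu> \<eta> n) B) sums measure (compound_poisson l \<mu> \<eta>) B"
proof -
  interpret C: real_distribution "compound_poisson l \<mu> \<eta>" by (rule real_distribution_compound_poisson)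
  interpret Q: real_distribution "convpow \<mu> \<eta> n" for n by (rule real_distribution_convpow)
  have "emeasure (compound_poisson l \<mu> \<eta>) B = (\<Sum>n. ennreal (pois n) * emeasure (convpow \<mu> \<eta> n) B)"
    using nn_integral_compound_poisson[of "indicator B"] assms by simp
  also have "\<dots> = (\<Sum>n. ennreal (pois n * measure (convpow \<mu> \<eta> n) B))"
    using l_pos by (intro suminf_cong) (simp add: Q.emeasure_eq_measure flip: ennreal_mult)
  finally have "(\<lambda>n. ennreal (pois n * measure (convpow \<mu> \<eta> n) B)) sums ennreal (measure (compound_poisson l \<mu> \<eta>) B)"
    by (simp add: C.emeasure_eq_measure sums_iff)
  then show ?thesis
    using l_pos by simp
qed

lemma char_convpow: "char (convpow \<mu> \<eta> n) s = char \<mu> s ^ n * char \<eta> s"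
  by (induction n) (auto simp: char_convolution mu real_distribution_convpow)

lemma mgf_convpow: "mgf (convpow \<mu> \<eta> n) \<theta> = mgf \<mu> \<theta> ^ n * mgf \<eta> \<theta>"
  by (induction n) (auto simp: mgf_convolution mu real_distribution_convpow ac_simps)

lemma char_compound_poisson:
  "char (compound_poisson l \<mu> \<eta>) s = char \<eta> s * exp (of_real l * (char \<mu> s - 1))"
proof -
  interpret Q: real_distribution "convpow \<mu> \<eta> n" for n by (rule real_distribution_convpow)
  interpret C: real_distribution "compound_poisson l \<mu> \<eta>" by (rule real_distribution_compound_poisson)
  \<comment> \<open>The mixture is integrated for the bounded real functions cosine and sine;
    \<open>char\<close> is then reassembled from real and imaginary parts.\<close>
  have Re: "Re (char (convpow \<mu> \<eta> n) s) = (\<integral>x. cos (s * x) \<partial>convpow \<mu> \<eta> n)" for n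
    unfolding char_def by (subst integral_Re[symmetric]) (auto intro!: Q.integrable_iexp simp: Re_exp)
  have Im: "Im (char (convpow \<mu> \<eta> n) s) = (\<integral>x. sin (s * x) \<partial>convpow \<mu> \<eta> n)" for n
    unfolding char_def by (subst integral_Im[symmetric]) (auto intro!: Q.integrable_iexp simp: Im_exp)
  have ReC: "Re (char (compound_poisson l \<mu> \<eta>) s) = (\<integral>x. cos (s * x) \<partial>compound_poisson l \<mu> \<eta>)"
    unfolding char_def by (subst integral_Re[symmetric]) (auto intro!: C.integrable_iexp simp: Re_exp)
  have ImC: "Im (char (compound_poisson l \<mu> \<eta>) s) = (\<integral>x. sin (s * x) \<partial>compound_poisson l \<mu> \<eta>)"
    unfolding char_def by (subst integral_Im[symmetric]) (auto intro!: C.integrable_iexp simp: Im_exp)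
  have i: "integrable (measure_pmf (poisson_pmf l)) (\<lambda>n. char (convpow \<mu> \<eta> n) s)"
    by (rule measure_pmf.integrable_const_bound[where B=1]) (auto simp: Q.cmod_char_le_1)
  have bind: "(\<integral>x. f x \<partial>compound_poisson l \<mu> \<eta>) = (\<integral>n. (\<integral>x. f x \<partial>convpow \<mu> \<eta> n) \<partial>measure_pmf (poisson_pmf l))"
    if "f \<in> borel_measurable borel" "\<And>x. \<bar>f x\<bar> \<le> 1" for f :: "real \<Rightarrow> real"
    unfolding compound_poisson_def using that
    by (intro integral_bind[where K=borel and B=1 and B'=1])
       (auto simp: measure_pmf.finite_measure_axioms Q.emeasure_space_1 convpow_in_space simp del: Q.space_eq_univ)
  have "char (compound_poisson l \<mu> \<eta>) s = (\<integral>n. char (convpow \<mu> \<eta> n) s \<partial>measure_pmf (poisson_pmf l))"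
  proof (rule complex_eqI)
    show "Re (char (compound_poisson l \<mu> \<eta>) s) = Re (\<integral>n. char (convpow \<mu> \<eta> n) s \<partial>measure_pmf (poisson_pmf l))"
      using i by (simp add: ReC bind integral_Re[symmetric] Re del: integral_Re)
    show "Im (char (compound_poisson l \<mu> \<eta>) s) = Im (\<integral>n. char (convpow \<mu> \<eta> n) s \<partial>measure_pmf (poisson_pmf l))"
      using i by (simp add: ImC bind integral_Im[symmetric] Im del: integral_Im)
  qed
  also have "\<dots> = (\<integral>n. of_real (pois n) * (char \<mu> s ^ n * char \<eta> s) \<partial>count_space UNIV)"
    using l_pos unfolding measure_pmf_eq_density
    by (subst integral_density) (auto simp: char_convpow scaleR_conv_of_real simp del: of_real_mult of_real_divide)
  also have "\<dots> = char \<eta> s * exp (of_real l * (char \<mu> s - 1))"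
  proof -
    have n: "(\<lambda>n. norm (of_real (pois n) * (char \<mu> s ^ n * char \<eta> s)))
        = (\<lambda>n. (l * norm (char \<mu> s)) ^ n /\<^sub>R fact n * (exp (- l) * norm (char \<eta> s)))"
      using l_pos by (simp add: norm_mult norm_power norm_divide norm_inverse power_mult_distrib divide_inverse fun_eq_iff)
    have "summable (\<lambda>n. norm (of_real (pois n) * (char \<mu> s ^ n * char \<eta> s)))"
      unfolding n by (intro summable_mult2 summable_exp_generic)
    then have "integrable (count_space UNIV) (\<lambda>n. of_real (pois n) * (char \<mu> s ^ n * char \<eta> s))"
      by (simp add: integrable_count_space_nat_iff)
    then have 1: "(\<lambda>n. of_real (pois n) * (char \<mu> s ^ n * char \<eta> s)) sums
        (\<integral>n. of_real (pois n) * (char \<mu> s ^ n * char \<eta> s) \<partial>count_space UNIV)"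
      by (rule sums_integral_count_space_nat)
    have 2: "(\<lambda>n. of_real (pois n) * (char \<mu> s ^ n * char \<eta> s)) =
        (\<lambda>n. (of_real l * char \<mu> s) ^ n /\<^sub>R fact n * (exp (- of_real l) * char \<eta> s))"
      by (simp add: fun_eq_iff power_mult_distrib scaleR_conv_of_real exp_of_real[symmetric] divide_inverse)
    have 3: "(\<lambda>n. (of_real l * char \<mu> s) ^ n /\<^sub>R fact n * (exp (- of_real l) * char \<eta> s)) sums
        (exp (of_real l * char \<mu> s) * (exp (- of_real l) * char \<eta> s))"
      by (intro sums_mult2 exp_converges)
    have "(\<integral>n. of_real (pois n) * (char \<mu> s ^ n * char \<eta> s) \<partial>count_space UNIV) =
        exp (of_real l * char \<mu> s) * (exp (- of_real l) * char \<eta> s)"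
      using 1 3 unfolding 2 by (rule sums_unique2)
    then show ?thesis
      by (simp add: right_diff_distrib exp_diff exp_minus divide_inverse)
  qed
  finally show ?thesis .
qed

text \<open>The weights \<open>pois n * r ^ n\<close> are, up to the factor
  \<open>exp (l * (r - 1))\<close>, Poisson weights with mean \<open>l * r\<close>, the mean number
  of jumps after tilting.\<close>

lemma mgf_compound_poisson:
  assumes "mgf \<mu> \<theta> = ennreal r" "0 \<le> r"
  shows "mgf (compound_poisson l \<mu> \<eta>) \<theta> = mgf \<eta> \<theta> * ennreal (exp (l * (r - 1)))"
proof -
  have "mgf (compound_poisson l \<mu> \<eta>) \<theta> = (\<Sum>n. ennreal (pois n) * mgf (convpow \<mu> \<eta> n) \<theta>)"
    unfolding mgf_def by (rule nn_integral_compound_poisson) simp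
  also have "\<dots> = (\<Sum>n. mgf \<eta> \<theta> * ennreal (exp (- l) * ((l * r) ^ n /\<^sub>R fact n)))"
    using assms l_pos
    by (intro suminf_cong)
       (simp add: mgf_convpow ennreal_mult[symmetric] ennreal_power power_mult_distrib divide_inverse ac_simps flip: ennreal_mult)
  also have "\<dots> = mgf \<eta> \<theta> * ennreal (exp (- l) * exp (l * r))"
  proof -
    have "(\<lambda>n. exp (- l) * ((l * r) ^ n /\<^sub>R fact n)) sums (exp (- l) * exp (l * r))"
      by (intro sums_mult exp_converges)
    then have "(\<Sum>n. ennreal (exp (- l) * ((l * r) ^ n /\<^sub>R fact n))) = ennreal (exp (- l) * exp (l * r))"
      using assms l_pos by (intro suminf_ennreal_eq) auto
    then show ?thesis
      by simp
  qed
  finally show ?thesis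
    by (simp add: exp_add[symmetric] algebra_simps)
qed

text \<open>The characteristic functions agree, so an additional jump may be placed outside the
  mixture or inside its remainder.\<close>

lemma convolution_compound_poisson: "(\<mu> \<star> compound_poisson l \<mu> \<eta>) = compound_poisson l \<mu> (\<mu> \<star> \<eta>)"
proof (rule Levy_uniqueness)
  interpret C: poisson_jumps l \<mu> "\<mu> \<star> \<eta>"
    by (intro poisson_jumps.intro l_pos mu eta real_distribution_convolution)
  show "real_distribution (compound_poisson l \<mu> (\<mu> \<star> \<eta>))"
    by (rule C.real_distribution_compound_poisson)
  show "real_distribution (\<mu> \<star> compound_poisson l \<mu> \<eta>)"
    by (intro real_distribution_convolution mu real_distribution_compound_poisson)
  show "char (\<mu> \<star> compound_poisson l \<mu> \<eta>) = char (compound_poisson l \<mu> (\<mu> \<star> \<eta>))"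
    by (auto simp: fun_eq_iff char_convolution mu eta real_distribution_compound_poisson
        char_compound_poisson C.char_compound_poisson)
qed

text \<open>The Mecke formula: biasing by the number of jumps amounts to adding one independent jump.\<close>

lemma measure_convolution_compound_poisson:
  assumes "B \<in> sets borel"
  shows "(\<lambda>n. real n * (pois n * measure (convpow \<mu> \<eta> n) B)) sums
    (l * measure (\<mu> \<star> compound_poisson l \<mu> \<eta>) B)"
proof -
  interpret C: poisson_jumps l \<mu> "\<mu> \<star> \<eta>"
    by (intro poisson_jumps.intro l_pos mu eta real_distribution_convolution)
  have "(\<lambda>n. l * (pois n * measure (convpow \<mu> \<eta> (Suc n)) B)) sums
      (l * measure (\<mu> \<star> compound_poisson l \<mu> \<eta>) B)"
    using C.measure_compound_poisson[OF assms]
    by (intro sums_mult) (simp add: convpow_shift convolution_compound_poisson)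
  \<comment> \<open>This is \<open>l * pois n = Suc n * pois (Suc n)\<close>. The term without jumps
    vanishes, so the index can be shifted back.\<close>
  also have "(\<lambda>n. l * (pois n * measure (convpow \<mu> \<eta> (Suc n)) B)) =
      (\<lambda>n. real (Suc n) * (pois (Suc n) * measure (convpow \<mu> \<eta> (Suc n)) B))"
    using fact_Suc by (simp add: fun_eq_iff del: convpow.simps)
  finally show ?thesis
    by (subst (asm) sums_Suc_iff) simp
qed

end

section \<open>Distributions with a given Levy exponent\<close>

lemma levy_integrable:
  fixes f :: "real \<Rightarrow> 'a::{banach,second_countable_topology}"
  assumes "levy_measure \<rho>" "f \<in> borel_measurable borel" "\<And>x. norm (f x) \<le> C * min 1 (x\<^sup>2)"
  shows "integrable \<rho> f"
proof (rule integrableI_bounded)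
  have [measurable_cong]: "sets \<rho> = sets borel"
    using assms(1) by (simp add: levy_measure_def)
  show "f \<in> borel_measurable \<rho>"
    using assms(2) by simp
  have C: "0 \<le> C"
    using order.trans[OF norm_ge_zero assms(3)[of 1]] by simp
  have "(\<integral>\<^sup>+x. norm (f x) \<partial>\<rho>) \<le> (\<integral>\<^sup>+x. ennreal C * ennreal (min 1 (x\<^sup>2)) \<partial>\<rho>)"
    using assms(3) C by (intro nn_integral_mono) (simp add: ennreal_leI flip: ennreal_mult)
  also have "\<dots> = ennreal C * (\<integral>\<^sup>+x. ennreal (min 1 (x\<^sup>2)) \<partial>\<rho>)"
    by (rule nn_integral_cmult) simp
  also have "\<dots> < \<infinity>"
    using assms(1) by (simp add: levy_measure_def ennreal_mult_less_top)
  finally show "(\<integral>\<^sup>+x. norm (f x) \<partial>\<rho>) < \<infinity>" .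
qed

lemma levy_measure_finite:
  assumes "levy_measure \<rho>" "S \<in> sets borel" "0 < c" "\<And>x. x \<in> S \<Longrightarrow> c \<le> \<bar>x\<bar>"
  shows "emeasure \<rho> S < \<infinity>"
proof -
  have "integrable \<rho> (indicator S :: real \<Rightarrow> real)"
  proof (rule levy_integrable[OF assms(1)])
    fix x :: real
    show "norm (indicator S x :: real) \<le> (1 / min 1 (c\<^sup>2)) * min 1 (x\<^sup>2)"
    proof (cases "x \<in> S")
      case True
      then have "c\<^sup>2 \<le> x\<^sup>2"
        using assms(3) assms(4)[of x] by (simp add: abs_le_square_iff[symmetric])
      then show ?thesis
        using True assms(3) by (auto simp: min_def field_simps)
    qed (use assms(3) in auto)
  qed (use assms in auto)
  then show ?thesis
    using assms(1,2) by (simp add: integrable_indicator_iff levy_measure_def)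
qed

lemma levy_integrable_indicator:
  fixes f :: "real \<Rightarrow> 'a::{banach,second_countable_topology}"
  assumes "levy_measure \<rho>" "f \<in> borel_measurable borel" "S \<in> sets borel"
    and "emeasure \<rho> S < \<infinity>" "\<And>x. x \<in> S \<Longrightarrow> norm (f x) \<le> C"
  shows "integrable \<rho> (\<lambda>x. indicator S x *\<^sub>R f x)"
proof (rule Bochner_Integration.integrable_bound)
  show "integrable \<rho> (\<lambda>x. indicator S x * C)"
    using assms by (intro integrable_mult_left) (simp add: integrable_indicator_iff levy_measure_def)
  show "AE x in \<rho>. norm (indicator S x *\<^sub>R f x) \<le> norm (indicator S x * C)"
    using assms(5) by (intro AE_I2) (auto split: split_indicator intro: order.trans[OF _ abs_ge_self])
  show "(\<lambda>x. indicator S x *\<^sub>R f x) \<in> borel_measurable \<rho>"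
    using assms by (simp add: levy_measure_def cong: measurable_cong_sets)
qed

lemma norm_iexp_sub_1: "norm (iexp x - 1) \<le> 2"
  using norm_triangle_ineq4[of "iexp x" 1] by simp

lemma norm_iexp_sub_1': "norm (iexp x - 1 - \<i> * of_real x) \<le> x\<^sup>2"
proof -
  have "2 * norm (iexp x - 1 - \<i> * of_real x) \<le> x\<^sup>2"
    using iexp_approx1[of x 1] by (simp add: algebra_simps numeral_2_eq_2)
  then show ?thesis
    using norm_ge_zero[of "iexp x - 1 - \<i> * of_real x"] by linarith
qed

lemma norm_levy_integrand:
  "norm (iexp (s * x) - 1 - \<i> * complex_of_real (s * x * indicator {-1..1} x)) \<le> (2 + s\<^sup>2) * min 1 (x\<^sup>2)"
proof (cases "\<bar>x\<bar> \<le> 1")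
  case True
  then have "x\<^sup>2 \<le> 1"
    by (simp add: abs_square_le_1)
  moreover have "norm (iexp (s * x) - 1 - \<i> * of_real (s * x)) \<le> s\<^sup>2 * x\<^sup>2"
    using norm_iexp_sub_1'[of "s * x"] by (simp add: power_mult_distrib)
  moreover have "s\<^sup>2 * x\<^sup>2 \<le> (2 + s\<^sup>2) * x\<^sup>2"
    by (intro mult_right_mono) auto
  ultimately show ?thesis
    using True by (simp add: abs_le_iff indicator_def min_def)
next
  case False
  then have "1 \<le> x\<^sup>2"
    by (metis abs_square_le_1 linorder_le_cases)
  then have "min 1 (x\<^sup>2) = 1"
    by simp
  moreover have "indicator {-1..1} x = (0::real)"
    using False by (auto simp: indicator_def)
  moreover have "norm (iexp (s * x) - 1) \<le> 2 + s\<^sup>2"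
    using norm_iexp_sub_1[of "s * x"] by (rule order.trans) simp
  ultimately show ?thesis
    by simp
qed

lemma integrable_levy_integrand:
  assumes "levy_measure \<rho>"
  shows "integrable \<rho> (\<lambda>x. iexp (s * x) - 1 - \<i> * complex_of_real (s * x * indicator {-1..1} x))"
  by (rule levy_integrable[OF assms _ norm_levy_integrand]) measurable

text \<open>Quadratic growth in \<open>s\<close> is the reason why a displacement of size
  \<open>d\<close> within a short time \<open>t\<close> has probability of order
  \<open>t / d\<^sup>2\<close>.\<close>

lemma levy_exponent_bound:
  assumes "levy_measure \<rho>"
  shows "\<exists>C\<ge>0. \<forall>s. norm (levy_exponent \<gamma> \<rho> s) \<le> C * (1 + s\<^sup>2)"
proof -
  have [measurable_cong]: "sets \<rho> = sets borel"
    using assms by (simp add: levy_measure_def)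
  define I where "I = (\<integral>x. min 1 (x\<^sup>2) \<partial>\<rho>)"
  have i: "integrable \<rho> (\<lambda>x::real. min 1 (x\<^sup>2))"
    by (rule levy_integrable[OF assms, where C=1]) auto
  have I: "0 \<le> I"
    unfolding I_def by simp
  have "norm (levy_exponent \<gamma> \<rho> s) \<le> (\<bar>\<gamma>\<bar> + 2 * I) * (1 + s\<^sup>2)" for s
  proof -
    have "norm (CLINT x|\<rho>. iexp (s * x) - 1 - \<i> * complex_of_real (s * x * indicator {-1..1} x))
        \<le> (\<integral>x. (2 + s\<^sup>2) * min 1 (x\<^sup>2) \<partial>\<rho>)"
      by (intro Bochner_Integration.integral_norm_bound[THEN order.trans] integral_mono
          integrable_norm integrable_levy_integrand assms integrable_mult_right i norm_levy_integrand)
    also have "\<dots> = (2 + s\<^sup>2) * I"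
      unfolding I_def by simp
    finally have 1: "norm (CLINT x|\<rho>. iexp (s * x) - 1 - \<i> * complex_of_real (s * x * indicator {-1..1} x))
        \<le> (2 + s\<^sup>2) * I" .
    have 2: "\<bar>s\<bar> \<le> 1 + s\<^sup>2"
      using zero_le_power2[of "\<bar>s\<bar> - 1"] by (simp add: power2_eq_square algebra_simps)
    have "norm (levy_exponent \<gamma> \<rho> s) \<le> \<bar>\<gamma>\<bar> * \<bar>s\<bar> + (2 + s\<^sup>2) * I"
      unfolding levy_exponent_def using 1
      by (intro norm_triangle_ineq[THEN order.trans] add_mono) (auto simp: norm_mult abs_mult)
    also have "\<dots> \<le> \<bar>\<gamma>\<bar> * (1 + s\<^sup>2) + (2 + 2 * s\<^sup>2) * I"
      using 2 I by (intro add_mono mult_left_mono mult_right_mono) auto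
    finally show ?thesis
      by (simp add: algebra_simps)
  qed
  then show ?thesis
    using I by (intro exI[of _ "\<bar>\<gamma>\<bar> + 2 * I"]) auto
qed

lemma levy_measure_restrict:
  assumes "levy_measure \<rho>" "S \<in> sets borel"
  shows "levy_measure (density \<rho> (indicator S))"
proof -
  have [measurable_cong]: "sets \<rho> = sets borel" and [measurable]: "S \<in> sets borel"
    using assms by (simp_all add: levy_measure_def)
  have "(\<integral>\<^sup>+x. ennreal (min 1 (x\<^sup>2)) \<partial>density \<rho> (indicator S)) \<le> (\<integral>\<^sup>+x. ennreal (min 1 (x\<^sup>2)) \<partial>\<rho>)"
    by (subst nn_integral_density) (auto intro!: nn_integral_mono split: split_indicator)
  then show ?thesis
    using assms by (auto simp: levy_measure_def intro: le_less_trans)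
qed

text \<open>Jumps outside \<open>{-1..1}\<close> are not compensated. Taking them out leaves the
  drift parameter as it is and splits off a plain compound Poisson exponent.\<close>

lemma levy_exponent_split:
  assumes \<rho>: "levy_measure \<rho>" and S [measurable]: "S \<in> sets borel" and disj: "S \<inter> {-1..1} = {}"
  shows "levy_exponent \<gamma> \<rho> s =
    levy_exponent \<gamma> (density \<rho> (indicator (- S))) s + (CLINT x:S|\<rho>. iexp (s * x) - 1)"
proof -
  have [measurable_cong]: "sets \<rho> = sets borel"
    using \<rho> by (simp add: levy_measure_def)
  define f where "f x = iexp (s * x) - 1 - \<i> * complex_of_real (s * x * indicator {-1..1} x)" for x
  have f [measurable]: "f \<in> borel_measurable borel"
    unfolding f_def by measurable
  have i: "integrable \<rho> f"
    unfolding f_def by (rule integrable_levy_integrand[OF \<rho>])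
  have "integral\<^sup>L \<rho> f = (CLINT x|\<rho>. indicator (- S) x *\<^sub>R f x) + (CLINT x|\<rho>. indicator S x *\<^sub>R f x)"
    using i by (subst Bochner_Integration.integral_add[symmetric])
      (auto intro!: integrable_mult_indicator Bochner_Integration.integral_cong split: split_indicator)
  also have "(CLINT x|\<rho>. indicator S x *\<^sub>R f x) = (CLINT x:S|\<rho>. iexp (s * x) - 1)"
    unfolding set_lebesgue_integral_def using disj
    by (intro Bochner_Integration.integral_cong) (auto simp: f_def split: split_indicator)
  also have "(CLINT x|\<rho>. indicator (- S) x *\<^sub>R f x) = integral\<^sup>L (density \<rho> (indicator (- S))) f"
    using integral_density[of f \<rho> "indicator (- S)"] by (simp add: ennreal_indicator)
  finally show ?thesis
    unfolding levy_exponent_def f_def by simp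
qed

lemma uniform_measure_real:
  assumes "emeasure M S \<noteq> \<infinity>"  "emeasure M S \<noteq> 0"
  shows "uniform_measure M S = density M (\<lambda>x. ennreal (indicator S x / measure M S))"
proof -
  have "emeasure M S = ennreal (measure M S)" "0 < measure M S"
    using assms by (auto simp: emeasure_eq_ennreal_measure)
       (metis emeasure_eq_ennreal_measure ennreal_0 measure_nonneg order_le_less)
  then show ?thesis
    unfolding uniform_measure_def
    by (auto intro!: arg_cong[where f="density M"] simp: fun_eq_iff divide_ennreal simp flip: ennreal_indicator)
qed

lemma char_uniform_measure:
  assumes \<rho>: "levy_measure \<rho>" and S [measurable]: "S \<in> sets borel"
    and fin: "emeasure \<rho> S \<noteq> \<infinity>" and pos: "emeasure \<rho> S \<noteq> 0"
  shows "real_distribution (uniform_measure \<rho> S)"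
    and "of_real (measure \<rho> S) * (char (uniform_measure \<rho> S) s - 1) = (CLINT x:S|\<rho>. iexp (s * x) - 1)"
proof -
  have [measurable_cong]: "sets \<rho> = sets borel"
    using \<rho> by (simp add: levy_measure_def)
  have m: "0 < measure \<rho> S"
    using pos fin by (metis emeasure_eq_ennreal_measure ennreal_0 infinity_ennreal_def measure_nonneg order_le_less)
  show "real_distribution (uniform_measure \<rho> S)"
    using prob_space_uniform_measure[OF pos fin] \<rho> by (simp add: real_distribution_def real_distribution_axioms_def levy_measure_def)
  have "char (uniform_measure \<rho> S) s = (CLINT x|\<rho>. (indicator S x / measure \<rho> S) *\<^sub>R iexp (s * x))"
    unfolding char_def uniform_measure_real[OF fin pos]
    by (rule integral_density) (auto intro!: AE_I2)
  also have "\<dots> = (CLINT x|\<rho>. (indicator S x *\<^sub>R iexp (s * x)) / of_real (measure \<rho> S))"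
    by (intro Bochner_Integration.integral_cong) (auto split: split_indicator simp: scaleR_conv_of_real)
  finally have 1: "of_real (measure \<rho> S) * char (uniform_measure \<rho> S) s = (CLINT x|\<rho>. indicator S x *\<^sub>R iexp (s * x))"
    using m by simp
  have "integrable \<rho> (\<lambda>x. indicator S x *\<^sub>R iexp (s * x))" "integrable \<rho> (\<lambda>x. indicator S x *\<^sub>R (1::complex))"
    using fin by (auto intro!: levy_integrable_indicator[OF \<rho>, where C=1] simp: top.not_eq_extremum)
  then have "(CLINT x:S|\<rho>. iexp (s * x) - 1) =
      (CLINT x|\<rho>. indicator S x *\<^sub>R iexp (s * x)) - (CLINT x|\<rho>. indicator S x *\<^sub>R 1)"
    unfolding set_lebesgue_integral_def scaleR_diff_right by (rule Bochner_Integration.integral_diff)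
  also have "(CLINT x|\<rho>. indicator S x *\<^sub>R 1) = of_real (measure \<rho> S)"
    using fin by (simp add: top.not_eq_extremum scaleR_conv_of_real)
  finally show "of_real (measure \<rho> S) * (char (uniform_measure \<rho> S) s - 1) = (CLINT x:S|\<rho>. iexp (s * x) - 1)"
    by (simp add: 1 right_diff_distrib)
qed

lemma mgf_uniform_measure:
  assumes \<rho>: "levy_measure \<rho>" and S [measurable]: "S \<in> sets borel"
    and fin: "emeasure \<rho> S \<noteq> \<infinity>" and pos: "emeasure \<rho> S \<noteq> 0"
    and L: "(\<integral>\<^sup>+x. ennreal (exp (\<theta> * x)) * indicator S x \<partial>\<rho>) = ennreal L" "0 \<le> L"
  shows "mgf (uniform_measure \<rho> S) \<theta> = ennreal (L / measure \<rho> S)"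
proof -
  have [measurable_cong]: "sets \<rho> = sets borel"
    using \<rho> by (simp add: levy_measure_def)
  have m: "0 < measure \<rho> S"
    using pos fin by (metis emeasure_eq_ennreal_measure ennreal_0 infinity_ennreal_def measure_nonneg order_le_less)
  have "mgf (uniform_measure \<rho> S) \<theta> = ennreal L / emeasure \<rho> S"
    unfolding mgf_def by (subst nn_integral_uniform_measure) (auto simp: L)
  then show ?thesis
    using m fin L by (simp add: emeasure_eq_ennreal_measure divide_ennreal)
qed

text \<open>The common building block for small jumps cut away from 0 and for jumps beyond 1. A set
  without mass has no normalised law and is treated apart. Exponential moments are recorded because
  tightness and the bound on the remainder rest on them.\<close>

lemma add_jumps:
  assumes \<rho>: "levy_measure \<rho>" and S [measurable]: "S \<in> sets borel"
    and fin: "emeasure \<rho> S \<noteq> \<infinity>" and t: "0 < t" and \<eta>: "real_distribution \<eta>"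
  shows "\<exists>\<eta>'. real_distribution \<eta>' \<and>
    (\<forall>s. char \<eta>' s = char \<eta> s * exp (of_real t * (CLINT x:S|\<rho>. iexp (s * x) - 1))) \<and>
    (\<forall>\<theta> L. 0 \<le> L \<and> (\<integral>\<^sup>+x. ennreal (exp (\<theta> * x)) * indicator S x \<partial>\<rho>) = ennreal L \<longrightarrow>
       mgf \<eta>' \<theta> = mgf \<eta> \<theta> * ennreal (exp (t * (L - measure \<rho> S))))"
proof (cases "emeasure \<rho> S = 0")
  case True
  have [measurable_cong]: "sets \<rho> = sets borel"
    using \<rho> by (simp add: levy_measure_def)
  have ae: "AE x in \<rho>. x \<notin> S"
    using True by (intro AE_I'[of S]) (auto simp: null_sets_def)
  have "(CLINT x:S|\<rho>. iexp (s * x) - 1) = 0" for s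
    unfolding set_lebesgue_integral_def
    using ae by (intro integral_eq_zero_AE) auto
  moreover have "(\<integral>\<^sup>+x. ennreal (exp (\<theta> * x)) * indicator S x \<partial>\<rho>) = 0" for \<theta>
    using ae by (subst nn_integral_0_iff_AE) auto
  moreover have "measure \<rho> S = 0"
    using True by (simp add: measure_def)
  ultimately show ?thesis
    using \<eta> by (intro exI[of _ \<eta>]) auto
next
  case False
  have m: "0 < measure \<rho> S"
    using False fin by (metis emeasure_eq_ennreal_measure ennreal_0 infinity_ennreal_def measure_nonneg order_le_less)
  interpret P: poisson_jumps "t * measure \<rho> S" "uniform_measure \<rho> S" \<eta>
    by (intro poisson_jumps.intro \<eta> mult_pos_pos t m char_uniform_measure[OF \<rho> S fin False])
  show ?thesis
  proof (intro exI[of _ "compound_poisson (t * measure \<rho> S) (uniform_measure \<rho> S) \<eta>"] conjI allI impI)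
    show "real_distribution (compound_poisson (t * measure \<rho> S) (uniform_measure \<rho> S) \<eta>)"
      by (rule P.real_distribution_compound_poisson)
    show "char (compound_poisson (t * measure \<rho> S) (uniform_measure \<rho> S) \<eta>) s =
        char \<eta> s * exp (of_real t * (CLINT x:S|\<rho>. iexp (s * x) - 1))" for s
      unfolding P.char_compound_poisson char_uniform_measure(2)[OF \<rho> S fin False, symmetric]
      by (simp add: mult.assoc)
    show "mgf (compound_poisson (t * measure \<rho> S) (uniform_measure \<rho> S) \<eta>) \<theta> =
        mgf \<eta> \<theta> * ennreal (exp (t * (L - measure \<rho> S)))"
      if "0 \<le> L \<and> (\<integral>\<^sup>+x. ennreal (exp (\<theta> * x)) * indicator S x \<partial>\<rho>) = ennreal L" for \<theta> L
    proof -
      have "t * measure \<rho> S * (L / measure \<rho> S - 1) = t * (L - measure \<rho> S)"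
        using m by (simp add: field_simps)
      with P.mgf_compound_poisson[OF mgf_uniform_measure[OF \<rho> S fin False, of \<theta> L]] that m show ?thesis
        by (simp only:) (simp add: divide_nonneg_pos)
    qed
  qed
qed

text \<open>\<open>1 - exp (- x\<^sup>2 / (2 d\<^sup>2))\<close> is the average of \<open>1 - cos (x z / d)\<close>
  over a standard normal \<open>z\<close>.\<close>

lemma (in real_distribution) tail_le_char:
  assumes "0 < d" and bound: "\<And>s. norm (1 - char M s) \<le> c * (1 + s\<^sup>2)"
  shows "measure M {x. d \<le> \<bar>x\<bar>} \<le> 3 * c * (1 + 1 / d\<^sup>2)"
proof -
  interpret N: real_distribution std_normal_distribution by (rule real_dist_normal_dist)
  interpret P: pair_prob_space M std_normal_distribution ..
  have c0: "0 \<le> c"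
    using order.trans[OF norm_ge_zero bound[of 0]] by simp
  have [measurable]: "std_normal_distribution \<in> space (prob_algebra borel)"
    using N.prob_space_axioms by (simp add: space_prob_algebra)
  have int: "integrable (M \<Otimes>\<^sub>M std_normal_distribution) (\<lambda>(x, z). 1 - iexp (z / d * x))"
  proof (rule P.integrable_const_bound[where B=2])
    have "norm (1 - iexp (z / d * x)) \<le> 2" for x z
      using norm_iexp_sub_1[of "z / d * x"] by (simp only: norm_minus_commute)
    then show "AE p in M \<Otimes>\<^sub>M std_normal_distribution. norm (case p of (x, z) \<Rightarrow> 1 - iexp (z / d * x)) \<le> 2"
      by (intro AE_I2) (simp only: split_beta)
  qed measurable
  have "1 - complex_of_real (exp (- (x\<^sup>2 / d\<^sup>2) / 2)) = (CLINT z|std_normal_distribution. 1 - iexp (z / d * x))" for x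
  proof -
    have "(CLINT z|std_normal_distribution. 1 - iexp (z / d * x)) =
        (CLINT z|std_normal_distribution. 1) - (CLINT z|std_normal_distribution. iexp (x / d * z))"
      using N.integrable_iexp[of "\<lambda>z. complex_of_real (x / d * z)"]
      by (subst Bochner_Integration.integral_diff[symmetric]) (auto simp: mult.commute)
    also have "\<dots> = 1 - char std_normal_distribution (x / d)"
      using N.prob_space by (simp add: char_def del: N.space_eq_univ)
    finally show ?thesis
      by (simp add: char_std_normal_distribution power_divide)
  qed
  then have "(CLINT x|M. complex_of_real (1 - exp (- (x\<^sup>2 / d\<^sup>2) / 2))) =
      (CLINT x|M. CLINT z|std_normal_distribution. 1 - iexp (z / d * x))"
    by simp
  \<comment> \<open>Exchanging the integrals turns the Gaussian average into an average of
    \<open>1 - char\<close> over the frequencies \<open>z / d\<close>, where \<open>bound\<close>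
    applies; the second moment 1 of \<open>z\<close> produces \<open>1 / d\<^sup>2\<close>.\<close>
  also have "\<dots> = (CLINT z|std_normal_distribution. CLINT x|M. 1 - iexp (z / d * x))"
    by (rule P.Fubini_integral[OF int, symmetric])
  also have "\<dots> = (CLINT z|std_normal_distribution. 1 - char M (z / d))"
  proof -
    have "(CLINT x|M. 1 - iexp (z / d * x)) = 1 - char M (z / d)" for z
      unfolding char_def using integrable_iexp[of "\<lambda>x. complex_of_real (z / d * x)"] prob_space
      by (subst Bochner_Integration.integral_diff) (auto simp del: space_eq_univ)
    then show ?thesis
      by simp
  qed
  finally have eq: "(CLINT x|M. complex_of_real (1 - exp (- (x\<^sup>2 / d\<^sup>2) / 2))) =
      (CLINT z|std_normal_distribution. 1 - char M (z / d))" .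
  have m2: "(\<integral>z. z\<^sup>2 \<partial>std_normal_distribution) = 1" "integrable std_normal_distribution (\<lambda>z. z\<^sup>2)"
    using std_normal_distribution_even_moments[of 1] by (auto simp: has_bochner_integral_iff)
  have "(\<integral>x. 1 - exp (- (x\<^sup>2 / d\<^sup>2) / 2) \<partial>M) \<le> norm (CLINT x|M. complex_of_real (1 - exp (- (x\<^sup>2 / d\<^sup>2) / 2)))"
    by (simp del: of_real_diff)
  also have "\<dots> \<le> (\<integral>z. c * (1 + (z / d)\<^sup>2) \<partial>std_normal_distribution)"
    unfolding eq
  proof (intro Bochner_Integration.integral_norm_bound[THEN order.trans] integral_mono bound)
    show "integrable std_normal_distribution (\<lambda>z. norm (1 - char M (z / d)))"
    proof (intro N.integrable_const_bound[where B=2] AE_I2)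
      show "norm (norm (1 - char M (z / d))) \<le> 2" for z
        using norm_triangle_ineq4[of 1 "char M (z / d)"] cmod_char_le_1[of "z / d"] by simp
    qed simp
    show "integrable std_normal_distribution (\<lambda>z. c * (1 + (z / d)\<^sup>2))"
      using m2 by (auto simp: power_divide)
  qed
  also have "\<dots> = c * (1 + 1 / d\<^sup>2)"
    using m2 N.prob_space by (simp add: power_divide del: N.space_eq_univ)
  finally have 1: "(\<integral>x. 1 - exp (- (x\<^sup>2 / d\<^sup>2) / 2) \<partial>M) \<le> c * (1 + 1 / d\<^sup>2)" .
  have "measure M {x. d \<le> \<bar>x\<bar>} = (\<integral>x. indicator {x. d \<le> \<bar>x\<bar>} x \<partial>M)"
    by simp
  also have "\<dots> \<le> (\<integral>x. 3 * (1 - exp (- (x\<^sup>2 / d\<^sup>2) / 2)) \<partial>M)"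
  proof (intro integral_mono)
    show "integrable M (\<lambda>x. 3 * (1 - exp (- (x\<^sup>2 / d\<^sup>2) / 2)))"
      by (intro integrable_mult_right integrable_const_bound[where B=1] AE_I2) auto
    \<comment> \<open>The factor 3 is needed because for \<open>d \<le> \<bar>x\<bar>\<close> the
      bracket is at least \<open>1 - exp (- 1 / 2)\<close>, which is at least
      \<open>1 / 3\<close>.\<close>
    show "indicator {x. d \<le> \<bar>x\<bar>} x \<le> 3 * (1 - exp (- (x\<^sup>2 / d\<^sup>2) / 2))" for x :: real
    proof (cases "d \<le> \<bar>x\<bar>")
      case True
      then have "d\<^sup>2 \<le> x\<^sup>2"
        using assms(1) by (simp add: abs_le_square_iff[symmetric])
      then have "1 / 2 \<le> (x\<^sup>2 / d\<^sup>2) / 2"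
        using assms(1) by (simp add: field_simps)
      then have "exp (- (x\<^sup>2 / d\<^sup>2) / 2) \<le> exp (- (1 / 2))"
        by simp
      also have "exp (- (1 / 2)) \<le> (2 / 3 :: real)"
        using exp_ge_add_one_self[of "1 / 2 :: real"] by (simp add: exp_minus field_simps)
      finally show ?thesis
        using True by simp
    qed simp
  qed (auto simp: less_top[symmetric])
  also have "\<dots> = 3 * (\<integral>x. 1 - exp (- (x\<^sup>2 / d\<^sup>2) / 2) \<partial>M)"
    by (rule integral_mult_right_zero)
  finally show ?thesis
    using 1 by simp
qed

text \<open>On the left half-plane the derivative of \<open>exp\<close> has norm at most 1, so
  \<open>exp\<close> is 1-Lipschitz there.\<close>

lemma norm_1_sub_exp_le:
  fixes w :: complex
  assumes "Re w \<le> 0"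
  shows "norm (1 - exp w) \<le> norm w"
proof -
  have "norm (exp w - exp 0) \<le> 1 * norm (w - 0)"
  proof (rule field_differentiable_bound[of "{z. Re z \<le> 0}"])
    show "(exp has_field_derivative exp z) (at z within {z. Re z \<le> 0})" for z :: complex
      by (auto intro!: derivative_eq_intros)
  qed (use assms convex_halfspace_Re_le in \<open>auto simp: norm_exp_eq_Re\<close>)
  then show ?thesis
    by (simp add: norm_minus_commute)
qed

text \<open>Formulated for every law with this characteristic function, because it serves both the
  process and the remainder left when the jumps above \<open>b\<close> are removed. The constant is
  uniform in \<open>t\<close> and \<open>d\<close>.\<close>

lemma levy_small_time:
  assumes "levy_measure \<rho>"
  shows "\<exists>C\<ge>0. \<forall>t\<ge>0. \<forall>\<mu>. real_distribution \<mu> \<longrightarrow>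
    (\<forall>s. char \<mu> s = exp (of_real t * levy_exponent \<gamma> \<rho> s)) \<longrightarrow>
    (\<forall>d. 0 < d \<longrightarrow> d \<le> 1 \<longrightarrow> measure \<mu> {x. d \<le> \<bar>x\<bar>} \<le> C * t / d\<^sup>2)"
proof -
  obtain C where C: "0 \<le> C" "\<And>s. norm (levy_exponent \<gamma> \<rho> s) \<le> C * (1 + s\<^sup>2)"
    using levy_exponent_bound[OF assms] by blast
  show ?thesis
  proof (intro exI[of _ "6 * C"] conjI allI impI)
    fix t d :: real and \<mu>
    assume t: "0 \<le> t" and \<mu>: "real_distribution \<mu>" and d: "0 < d" "d \<le> 1"
      and ch: "\<forall>s. char \<mu> s = exp (of_real t * levy_exponent \<gamma> \<rho> s)"
    interpret real_distribution \<mu> by fact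
    have "norm (1 - char \<mu> s) \<le> (C * t) * (1 + s\<^sup>2)" for s
    proof -
      \<comment> \<open>A characteristic function has norm at most 1, so \<open>t\<close> times the
        exponent has nonpositive real part.\<close>
      have "norm (exp (of_real t * levy_exponent \<gamma> \<rho> s)) \<le> 1"
        using cmod_char_le_1[of s] ch by simp
      then have "norm (1 - char \<mu> s) \<le> norm (of_real t * levy_exponent \<gamma> \<rho> s)"
        unfolding ch[rule_format] by (intro norm_1_sub_exp_le) (simp add: norm_exp_eq_Re)
      also have "\<dots> \<le> t * (C * (1 + s\<^sup>2))"
        using t C(2)[of s] by (simp add: norm_mult mult_left_mono)
      finally show ?thesis
        by (simp add: ac_simps)
    qed
    from tail_le_char[OF d(1) this] have "measure \<mu> {x. d \<le> \<bar>x\<bar>} \<le> 3 * (C * t) * (1 + 1 / d\<^sup>2)" .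
    also have "\<dots> \<le> 3 * (C * t) * (2 / d\<^sup>2)"
      using d C(1) t by (intro mult_left_mono) (auto simp: field_simps power_le_one power_decreasing)
    finally show "measure \<mu> {x. d \<le> \<bar>x\<bar>} \<le> 6 * C * t / d\<^sup>2"
      by simp
  qed (use C in auto)
qed

section \<open>Exponential moments: Chernoff bounds, tightness and weak limits\<close>

lemma emeasure_tail_le_mgf:
  assumes "real_distribution \<mu>" "0 \<le> \<theta>"
  shows "emeasure \<mu> {y..} \<le> ennreal (exp (- \<theta> * y)) * mgf \<mu> \<theta>"
proof -
  interpret real_distribution \<mu> by fact
  have "emeasure \<mu> {y..} = (\<integral>\<^sup>+x. indicator {y..} x \<partial>\<mu>)"
    by simp
  also have "\<dots> \<le> (\<integral>\<^sup>+x. ennreal (exp (- \<theta> * y)) * ennreal (exp (\<theta> * x)) \<partial>\<mu>)"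
    using assms(2)
    by (intro nn_integral_mono)
       (auto split: split_indicator simp: mult_left_mono simp flip: ennreal_mult exp_add ennreal_1)
  also have "\<dots> = ennreal (exp (- \<theta> * y)) * mgf \<mu> \<theta>"
    unfolding mgf_def by (rule nn_integral_cmult) simp
  finally show ?thesis .
qed

lemma emeasure_lower_tail_le_mgf:
  assumes "real_distribution \<mu>"
  shows "emeasure \<mu> {..-y} \<le> ennreal (exp (- y)) * mgf \<mu> (-1)"
proof -
  interpret real_distribution \<mu> by fact
  have "emeasure \<mu> {..-y} = (\<integral>\<^sup>+x. indicator {..-y} x \<partial>\<mu>)"
    by simp
  also have "\<dots> \<le> (\<integral>\<^sup>+x. ennreal (exp (- y)) * ennreal (exp ((-1) * x)) \<partial>\<mu>)"
    by (intro nn_integral_mono)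
       (auto split: split_indicator simp flip: ennreal_mult exp_add ennreal_1)
  also have "\<dots> = ennreal (exp (- y)) * mgf \<mu> (-1)"
    unfolding mgf_def by (rule nn_integral_cmult) simp
  finally show ?thesis .
qed

text \<open>Chernoff bounds with parameters 1 and -1 control both tails uniformly in
  \<open>n\<close>.\<close>

lemma tight_of_mgf:
  assumes \<mu>: "\<And>n. real_distribution (\<mu> n)"
    and 1: "\<And>n. mgf (\<mu> n) 1 \<le> ennreal B" and 2: "\<And>n. mgf (\<mu> n) (-1) \<le> ennreal B" and B: "0 \<le> B"
  shows "tight \<mu>"
  unfolding tight_def
proof (intro conjI allI impI \<mu>)
  fix e :: real assume e: "0 < e"
  have "((\<lambda>r::real. exp (- r) * B) \<longlongrightarrow> 0) at_top"
    by (rule tendsto_mult_left_zero, rule filterlim_compose[OF exp_at_bot]) (rule filterlim_uminus_at_bot_at_top)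
  then have "\<forall>\<^sub>F r::real in at_top. exp (- r) * B < e / 2"
    using e by (intro order_tendstoD(2)) auto
  then have "\<forall>\<^sub>F r::real in at_top. 0 < r \<and> exp (- r) * B < e / 2"
    by (intro eventually_conj eventually_gt_at_top)
  from eventually_happens'[OF trivial_limit_at_top_linorder this]
  obtain r :: real where r: "0 < r" "exp (- r) * B < e / 2"
    by blast
  show "\<exists>a b. a < b \<and> (\<forall>n. 1 - e < measure (\<mu> n) {a<..b})"
  proof (rule exI[of _ "-r"], rule exI[of _ r], intro conjI allI)
    fix n
    interpret real_distribution "\<mu> n" by fact
    have "ennreal (measure (\<mu> n) {r..}) \<le> ennreal (exp (- r)) * ennreal B"
      using order.trans[OF emeasure_tail_le_mgf[OF \<mu>, of 1 n r] mult_left_mono[OF 1]]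
      by (simp add: emeasure_eq_measure)
    then have a: "measure (\<mu> n) {r..} < e / 2"
      using r B by (simp flip: ennreal_mult)
    have "ennreal (measure (\<mu> n) {..-r}) \<le> ennreal (exp (- r)) * ennreal B"
      using order.trans[OF emeasure_lower_tail_le_mgf[OF \<mu>, of n r] mult_left_mono[OF 2]]
      by (simp add: emeasure_eq_measure)
    then have b: "measure (\<mu> n) {..-r} < e / 2"
      using r B by (simp flip: ennreal_mult)
    have "1 = measure (\<mu> n) ({r..} \<union> {..-r} \<union> {-r<..<r})"
      by (subst prob_space[symmetric]) (auto intro!: arg_cong[where f="measure (\<mu> n)"])
    also have "\<dots> \<le> measure (\<mu> n) {r..} + measure (\<mu> n) {..-r} + measure (\<mu> n) {-r<..<r}"
      by (intro order.trans[OF measure_Un_le] add_right_mono measure_Un_le) auto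
    also have "measure (\<mu> n) {-r<..<r} \<le> measure (\<mu> n) {-r<..r}"
      by (intro finite_measure_mono) auto
    finally show "1 - e < measure (\<mu> n) {-r<..r}"
      using a b by simp
  qed (use r in simp)
qed

text \<open>The exponential is unbounded, so weak convergence is applied to its truncations at
  height \<open>K\<close>, and Fatou's lemma removes the truncation.\<close>

lemma mgf_weak_limit_le:
  assumes \<mu>: "\<And>n. real_distribution (\<mu> n)" and M: "real_distribution M" and w: "weak_conv_m \<mu> M"
    and B: "\<And>n. mgf (\<mu> n) \<theta> \<le> ennreal B" "0 \<le> B"
  shows "mgf M \<theta> \<le> ennreal B"
proof -
  interpret M: real_distribution M by fact
  define f where "f K x = min (exp (\<theta> * x)) (real K)" for K :: nat and x :: real
  have f: "isCont (f K) x" "norm (f K x) \<le> real K" "f K \<in> borel_measurable borel" "0 \<le> f K x" for K x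
    unfolding f_def by (auto intro!: continuous_intros)
  have "(\<integral>\<^sup>+x. ennreal (f K x) \<partial>M) \<le> ennreal B" for K
  proof -
    have "(\<lambda>n. integral\<^sup>L (\<mu> n) (f K)) \<longlonglongrightarrow> integral\<^sup>L M (f K)"
      by (rule weak_conv_imp_integral_bdd_continuous_conv[OF \<mu> M w f(1,2)])
    moreover have "integral\<^sup>L (\<mu> n) (f K) \<le> B" for n
    proof -
      interpret N: real_distribution "\<mu> n" by (rule \<mu>)
      have "ennreal (integral\<^sup>L (\<mu> n) (f K)) = (\<integral>\<^sup>+x. ennreal (f K x) \<partial>\<mu> n)"
        using f by (intro nn_integral_eq_integral[symmetric] N.integrable_const_bound[where B="real K"]) auto
      also have "\<dots> \<le> mgf (\<mu> n) \<theta>"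
        unfolding mgf_def by (intro nn_integral_mono) (auto simp: f_def intro!: ennreal_leI)
      also have "\<dots> \<le> ennreal B"
        by (rule B)
      finally show ?thesis
        using B by simp
    qed
    ultimately have "integral\<^sup>L M (f K) \<le> B"
      by (intro LIMSEQ_le_const2) auto
    then show ?thesis
      using f by (subst nn_integral_eq_integral)
        (auto intro!: M.integrable_const_bound[where B="real K"] ennreal_leI)
  qed
  moreover have "mgf M \<theta> = (\<integral>\<^sup>+x. liminf (\<lambda>K. ennreal (f K x)) \<partial>M)"
    unfolding mgf_def
  proof (intro nn_integral_cong)
    fix x
    have "\<forall>\<^sub>F K in sequentially. f K x = exp (\<theta> * x)"
      using eventually_ge_at_top[of "nat \<lceil>exp (\<theta> * x)\<rceil>"]
      by eventually_elim (auto simp: f_def min_def nat_le_iff ceiling_le_iff)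
    then have "(\<lambda>K. ennreal (f K x)) \<longlonglongrightarrow> ennreal (exp (\<theta> * x))"
      by (intro tendsto_eventually) (auto elim: eventually_mono)
    then show "ennreal (exp (\<theta> * x)) = liminf (\<lambda>K. ennreal (f K x))"
      by (intro lim_imp_Liminf[symmetric]) auto
  qed
  moreover have "(\<integral>\<^sup>+x. liminf (\<lambda>K. ennreal (f K x)) \<partial>M) \<le> liminf (\<lambda>K. \<integral>\<^sup>+x. ennreal (f K x) \<partial>M)"
    using f by (intro nn_integral_liminf) auto
  ultimately show ?thesis
    by (metis (no_types, lifting) Liminf_le order.trans always_eventually sequentially_bot)
qed

section \<open>Laws with a given Levy exponent\<close>

lemma exp_sub_1_sub_bounds:
  fixes y :: real
  shows "0 \<le> exp y - 1 - y" "exp y - 1 - y \<le> y\<^sup>2 * exp \<bar>y\<bar>"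
proof -
  show "0 \<le> exp y - 1 - y"
    using exp_ge_add_one_self[of y] by linarith
  obtain z where z: "\<bar>z\<bar> \<le> \<bar>y\<bar>" "exp y = (\<Sum>m<2. y ^ m / fact m) + exp z / fact 2 * y ^ 2"
    using Maclaurin_exp_le[of y 2] by blast
  have "exp y - 1 - y = exp z / 2 * y\<^sup>2"
    using z(2) by (simp add: numeral_2_eq_2)
  also have "\<dots> \<le> exp \<bar>y\<bar> * y\<^sup>2"
  proof (intro mult_right_mono)
    have "exp z \<le> exp \<bar>y\<bar>"
      using z(1) by simp
    then show "exp z / 2 \<le> exp \<bar>y\<bar>"
      using exp_ge_zero[of z] by linarith
  qed simp
  finally show "exp y - 1 - y \<le> y\<^sup>2 * exp \<bar>y\<bar>"
    by (simp add: mult.commute)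
qed

text \<open>There may be infinitely many small jumps, so those below \<open>1 / Suc m\<close> are
  cut off first. After compensation the exponential moments are bounded uniformly in
  \<open>m\<close>, because \<open>exp y - 1 - y\<close> is quadratically small; this gives
  tightness and a weak limit along a subsequence, to which the moment bound passes.\<close>

lemma small_jumps_distribution:
  assumes \<rho>: "levy_measure \<rho>" and t: "0 < t"
  defines "I \<equiv> \<integral>x. min 1 (x\<^sup>2) \<partial>\<rho>"
  shows "\<exists>Z. real_distribution Z \<and>
    (\<forall>s. char Z s = exp (of_real t * (CLINT x:{-1..1}|\<rho>. iexp (s * x) - 1 - \<i> * of_real (s * x)))) \<and>
    (\<forall>\<theta>. mgf Z \<theta> \<le> ennreal (exp (t * (\<theta>\<^sup>2 * exp \<bar>\<theta>\<bar> * I))))"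
proof -
  have [measurable_cong]: "sets \<rho> = sets borel"
    using \<rho> by (simp add: levy_measure_def)
  define S :: "nat \<Rightarrow> real set" where "S m = {x. 1 / real (Suc m) \<le> \<bar>x\<bar> \<and> \<bar>x\<bar> \<le> 1}" for m
  have S [measurable]: "S m \<in> sets borel" for m
    unfolding S_def by measurable
  have fin: "emeasure \<rho> (S m) < \<infinity>" for m
    by (rule levy_measure_finite[OF \<rho> S, of "1 / real (Suc m)"]) (auto simp: S_def)
  have iI: "integrable \<rho> (\<lambda>x::real. min 1 (x\<^sup>2))"
    by (rule levy_integrable[OF \<rho>, where C=1]) auto
  define g where "g s x = iexp (s * x) - 1 - \<i> * complex_of_real (s * x)" for s x
  define e where "e \<theta> x = exp (\<theta> * x) - 1 - \<theta> * x" for \<theta> x :: real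
  define c where "c m = (\<integral>x. indicator (S m) x *\<^sub>R x \<partial>\<rho>)" for m
  have ic: "integrable \<rho> (\<lambda>x. indicator (S m) x *\<^sub>R x)" for m
    using fin[of m] by (intro levy_integrable_indicator[OF \<rho>, where C=1]) (auto simp: S_def)
  have i1: "integrable \<rho> (\<lambda>x. indicator (S m) x *\<^sub>R (iexp (s * x) - 1))" for m s
    using fin[of m] by (intro levy_integrable_indicator[OF \<rho>, where C=2] norm_iexp_sub_1) auto
  have ie: "integrable \<rho> (\<lambda>x. indicator (S m) x *\<^sub>R exp (\<theta> * x))" for m \<theta>
  proof (rule levy_integrable_indicator[OF \<rho> _ S fin, where C="exp \<bar>\<theta>\<bar>"])
    show "norm (exp (\<theta> * x)) \<le> exp \<bar>\<theta>\<bar>" if "x \<in> S m" for x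
      using that mult_left_mono[of "\<bar>x\<bar>" 1 "\<bar>\<theta>\<bar>"] abs_ge_self[of "\<theta> * x"] by (auto simp: S_def abs_mult)
  qed simp
  have e_le: "indicator (S m) x *\<^sub>R e \<theta> x \<le> \<theta>\<^sup>2 * exp \<bar>\<theta>\<bar> * min 1 (x\<^sup>2)" for m \<theta> x
  proof (cases "x \<in> S m")
    case True
    then have x: "\<bar>x\<bar> \<le> 1" "x\<^sup>2 \<le> 1"
      by (auto simp: S_def abs_square_le_1)
    have "e \<theta> x \<le> (\<theta> * x)\<^sup>2 * exp \<bar>\<theta> * x\<bar>"
      unfolding e_def by (rule exp_sub_1_sub_bounds)
    also have "\<dots> \<le> (\<theta> * x)\<^sup>2 * exp \<bar>\<theta>\<bar>"
      using x mult_left_mono[of "\<bar>x\<bar>" 1 "\<bar>\<theta>\<bar>"] by (intro mult_left_mono) (auto simp: abs_mult)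
    finally show ?thesis
      using True x by (simp add: power_mult_distrib min_def ac_simps)
  qed simp
  have "\<exists>Z. real_distribution Z \<and>
      (\<forall>s. char Z s = exp (of_real t * (CLINT x|\<rho>. indicator (S m) x *\<^sub>R g s x))) \<and>
      (\<forall>\<theta>. mgf Z \<theta> \<le> ennreal (exp (t * (\<theta>\<^sup>2 * exp \<bar>\<theta>\<bar> * I))))" for m
  proof -
    \<comment> \<open>This point mass is the compensator. On its own it may diverge as
      \<open>m\<close> grows; only together with the jumps in \<open>S m\<close> does it give a
      tight sequence.\<close>
    interpret R: real_distribution "return borel (- t * c m)"
      by (simp add: real_distribution_def real_distribution_axioms_def prob_space_return)
    obtain Z where Z: "real_distribution Z"
        "\<And>s. char Z s = char (return borel (- t * c m)) s * exp (of_real t * (CLINT x:S m|\<rho>. iexp (s * x) - 1))"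
        "\<And>\<theta> L. 0 \<le> L \<Longrightarrow> (\<integral>\<^sup>+x. ennreal (exp (\<theta> * x)) * indicator (S m) x \<partial>\<rho>) = ennreal L \<Longrightarrow>
           mgf Z \<theta> = mgf (return borel (- t * c m)) \<theta> * ennreal (exp (t * (L - measure \<rho> (S m))))"
      using add_jumps[OF \<rho> S less_imp_neq[OF fin] t R.real_distribution_axioms, of m] by blast
    have "char Z s = exp (of_real t * (CLINT x|\<rho>. indicator (S m) x *\<^sub>R g s x))" for s
    proof -
      have "(CLINT x|\<rho>. indicator (S m) x *\<^sub>R g s x) =
          (CLINT x|\<rho>. indicator (S m) x *\<^sub>R (iexp (s * x) - 1)) - (CLINT x|\<rho>. \<i> * of_real s * of_real (indicator (S m) x *\<^sub>R x))"
      proof (subst Bochner_Integration.integral_diff[symmetric])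
        show "integrable \<rho> (\<lambda>x. \<i> * of_real s * complex_of_real (indicator (S m) x *\<^sub>R x))"
          by (intro integrable_mult_right integrable_of_real ic)
        show "integrable \<rho> (\<lambda>x. indicator (S m) x *\<^sub>R (iexp (s * x) - 1))"
          by (rule i1)
      qed (auto intro!: Bochner_Integration.integral_cong split: split_indicator simp: g_def)
      also have "(CLINT x|\<rho>. \<i> * of_real s * complex_of_real (indicator (S m) x *\<^sub>R x)) = \<i> * of_real s * of_real (c m)"
        unfolding c_def by (simp only: integral_mult_right_zero integral_complex_of_real)
      finally have *: "(CLINT x|\<rho>. indicator (S m) x *\<^sub>R g s x) =
          (CLINT x:S m|\<rho>. iexp (s * x) - 1) - \<i> * of_real s * of_real (c m)"
        unfolding set_lebesgue_integral_def .
      have "char (return borel (- t * c m)) s = exp (- (of_real t * (\<i> * of_real s * of_real (c m))))"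
        unfolding char_def by (subst integral_return) (auto simp: ac_simps)
      then show ?thesis
        unfolding Z(2) * by (simp add: exp_add[symmetric] algebra_simps)
    qed
    moreover have "mgf Z \<theta> \<le> ennreal (exp (t * (\<theta>\<^sup>2 * exp \<bar>\<theta>\<bar> * I)))" for \<theta>
    proof -
      define L where "L = (\<integral>x. indicator (S m) x *\<^sub>R exp (\<theta> * x) \<partial>\<rho>)"
      have L: "0 \<le> L"
        unfolding L_def by simp
      have "(\<integral>\<^sup>+x. ennreal (exp (\<theta> * x)) * indicator (S m) x \<partial>\<rho>) = (\<integral>\<^sup>+x. ennreal (indicator (S m) x *\<^sub>R exp (\<theta> * x)) \<partial>\<rho>)"
        by (intro nn_integral_cong) (auto split: split_indicator)
      also have "\<dots> = ennreal L"
        unfolding L_def using ie by (intro nn_integral_eq_integral) auto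
      finally have "mgf Z \<theta> = mgf (return borel (- t * c m)) \<theta> * ennreal (exp (t * (L - measure \<rho> (S m))))"
        by (rule Z(3)[OF L])
      also have "mgf (return borel (- t * c m)) \<theta> = ennreal (exp (- \<theta> * t * c m))"
        unfolding mgf_def by (subst nn_integral_return) auto
      also have "ennreal (exp (- \<theta> * t * c m)) * ennreal (exp (t * (L - measure \<rho> (S m)))) =
          ennreal (exp (t * (L - measure \<rho> (S m) - \<theta> * c m)))"
        by (simp add: exp_add[symmetric] algebra_simps flip: ennreal_mult)
      also have "L - measure \<rho> (S m) - \<theta> * c m = (\<integral>x. indicator (S m) x *\<^sub>R e \<theta> x \<partial>\<rho>)"
      proof -
        have i2: "integrable \<rho> (indicator (S m) :: real \<Rightarrow> real)"
          using fin[of m] by (simp add: integrable_indicator_iff)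
        have "(\<integral>x. indicator (S m) x *\<^sub>R e \<theta> x \<partial>\<rho>) =
            (\<integral>x. indicator (S m) x *\<^sub>R exp (\<theta> * x) - indicator (S m) x - \<theta> * (indicator (S m) x *\<^sub>R x) \<partial>\<rho>)"
          unfolding e_def by (intro Bochner_Integration.integral_cong) (auto split: split_indicator)
        also have "\<dots> = L - measure \<rho> (S m) - \<theta> * c m"
          unfolding L_def c_def using ie ic i2
          by (subst Bochner_Integration.integral_diff | simp)+
        finally show ?thesis ..
      qed
      also have "\<dots> \<le> (\<integral>x. \<theta>\<^sup>2 * exp \<bar>\<theta>\<bar> * min 1 (x\<^sup>2) \<partial>\<rho>)"
      proof (intro integral_mono e_le)
        have "norm (indicator (S m) x *\<^sub>R e \<theta> x) \<le> \<theta>\<^sup>2 * exp \<bar>\<theta>\<bar> * min 1 (x\<^sup>2)" for x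
          using e_le[of m x \<theta>] exp_sub_1_sub_bounds(1)[of "\<theta> * x"] by (simp add: e_def)
        then show "integrable \<rho> (\<lambda>x. indicator (S m) x *\<^sub>R e \<theta> x)"
          by (intro levy_integrable[OF \<rho>]) (auto simp: e_def)
      qed (use iI in simp)
      also have "\<dots> = \<theta>\<^sup>2 * exp \<bar>\<theta>\<bar> * I"
        unfolding I_def by simp
      finally show ?thesis
        using t by (auto intro!: ennreal_leI simp: mult_left_mono)
    qed
    ultimately show ?thesis
      using Z(1) by blast
  qed
  then obtain Z where Z: "\<And>m. real_distribution (Z m)"
      "\<And>m s. char (Z m) s = exp (of_real t * (CLINT x|\<rho>. indicator (S m) x *\<^sub>R g s x))"
      "\<And>m \<theta>. mgf (Z m) \<theta> \<le> ennreal (exp (t * (\<theta>\<^sup>2 * exp \<bar>\<theta>\<bar> * I)))"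
    by metis
  have "tight Z"
    using Z(3)[of _ 1] Z(3)[of _ "-1"] by (intro tight_of_mgf[where B="exp (t * (1\<^sup>2 * exp \<bar>1\<bar> * I))"] Z(1)) auto
  from tight_imp_convergent_subsubsequence[OF this strict_mono_id] obtain r M where
    r: "strict_mono r" and M: "real_distribution M" and w: "weak_conv_m (Z \<circ> r) M"
    by auto
  have "char M s = exp (of_real t * (CLINT x:{-1..1}|\<rho>. g s x))" for s
  proof (rule LIMSEQ_unique)
    show "(\<lambda>n. char ((Z \<circ> r) n) s) \<longlonglongrightarrow> char M s"
      by (rule levy_continuity1[OF _ M w]) (simp add: Z)
    \<comment> \<open>The limit is identified by dominated convergence: the compensated integrand is
      at most \<open>s\<^sup>2 * x\<^sup>2\<close>, which is integrable on
      \<open>{-1..1}\<close>.\<close>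
    have "(\<lambda>m. CLINT x|\<rho>. indicator (S m) x *\<^sub>R g s x) \<longlonglongrightarrow> (CLINT x|\<rho>. indicator {-1..1} x *\<^sub>R g s x)"
    proof (rule integral_dominated_convergence[where w="\<lambda>x. s\<^sup>2 * min 1 (x\<^sup>2)"])
      show "integrable \<rho> (\<lambda>x. s\<^sup>2 * min 1 (x\<^sup>2))"
        using iI by simp
      show "AE x in \<rho>. (\<lambda>m. indicator (S m) x *\<^sub>R g s x) \<longlonglongrightarrow> indicator {-1..1} x *\<^sub>R g s x"
      proof (rule AE_I2)
        fix x :: real
        show "(\<lambda>m. indicator (S m) x *\<^sub>R g s x) \<longlonglongrightarrow> indicator {-1..1} x *\<^sub>R g s x"
        proof (cases "x = 0")
          case False
          then obtain N where N: "1 / real (Suc N) < \<bar>x\<bar>"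
            using nat_approx_posE[of "\<bar>x\<bar>"] by auto
          have "indicator (S m) x = (indicator {-1..1} x :: real)" if "N \<le> m" for m
          proof -
            have "1 / real (Suc m) \<le> 1 / real (Suc N)"
              using that by (intro divide_left_mono) auto
            then show ?thesis
              using N by (auto simp: S_def indicator_def)
          qed
          then show ?thesis
            by (intro tendsto_eventually eventually_sequentiallyI[of N]) simp
        qed (simp add: g_def)
      qed
      show "AE x in \<rho>. norm (indicator (S m) x *\<^sub>R g s x) \<le> s\<^sup>2 * min 1 (x\<^sup>2)" for m
      proof (rule AE_I2)
        fix x
        have "norm (g s x) \<le> s\<^sup>2 * x\<^sup>2"
          unfolding g_def using norm_iexp_sub_1'[of "s * x"] by (simp add: power_mult_distrib)
        moreover have "x\<^sup>2 \<le> 1" if "x \<in> S m"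
          using that by (auto simp: S_def abs_square_le_1)
        ultimately show "norm (indicator (S m) x *\<^sub>R g s x) \<le> s\<^sup>2 * min 1 (x\<^sup>2)"
          by (auto split: split_indicator)
      qed
    qed (auto simp: g_def)
    then have "(\<lambda>m. char (Z m) s) \<longlonglongrightarrow> exp (of_real t * (CLINT x|\<rho>. indicator {-1..1} x *\<^sub>R g s x))"
      unfolding Z(2) by (intro tendsto_intros)
    then show "(\<lambda>n. char ((Z \<circ> r) n) s) \<longlonglongrightarrow> exp (of_real t * (CLINT x:{-1..1}|\<rho>. g s x))"
      using LIMSEQ_subseq_LIMSEQ[OF _ r] unfolding set_lebesgue_integral_def by (fastforce simp: comp_def)
  qed
  moreover have "mgf M \<theta> \<le> ennreal (exp (t * (\<theta>\<^sup>2 * exp \<bar>\<theta>\<bar> * I)))" for \<theta>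
    by (rule mgf_weak_limit_le[OF _ M w]) (auto simp: Z)
  ultimately show ?thesis
    using M unfolding g_def by blast
qed

text \<open>Although the process is given, the remainder after removal of some jumps has to be
  constructed as a law. It is the sum of a drift, compensated small jumps and jumps beyond 1. The
  bound on its moments is doubly exponential in \<open>\<theta>\<close>; what counts is that its
  inner exponent stays below \<open>(b + 2) * \<theta>\<close>, the margin in the definition of
  \<open>U\<close>.\<close>

lemma levy_distribution_exists:
  assumes \<rho>: "levy_measure \<rho>" and t: "0 < t"
  shows "\<exists>\<eta>. real_distribution \<eta> \<and> (\<forall>s. char \<eta> s = exp (of_real t * levy_exponent \<gamma> \<rho> s)) \<and>
    (\<forall>b\<ge>1. emeasure \<rho> {b<..} = 0 \<longrightarrow> (\<exists>C. \<forall>\<theta>\<ge>0. mgf \<eta> \<theta> \<le> ennreal (exp (C * exp ((b + 1) * \<theta>)))))"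
proof -
  have [measurable_cong]: "sets \<rho> = sets borel"
    using \<rho> by (simp add: levy_measure_def)
  define S :: "real set" where "S = - {-1..1}"
  have S [measurable]: "S \<in> sets borel"
    unfolding S_def by measurable
  have fin: "emeasure \<rho> S \<noteq> \<infinity>"
  proof -
    have "1 \<le> \<bar>x\<bar>" if "x \<in> S" for x
      using that by (auto simp: S_def)
    then show ?thesis
      using levy_measure_finite[OF \<rho> S, of 1] by auto
  qed
  define I where "I = (\<integral>x. min 1 (x\<^sup>2) \<partial>\<rho>)"
  have I: "0 \<le> I"
    unfolding I_def by simp
  obtain Z where Z: "real_distribution Z"
      "\<And>s. char Z s = exp (of_real t * (CLINT x:{-1..1}|\<rho>. iexp (s * x) - 1 - \<i> * of_real (s * x)))"
      "\<And>\<theta>. mgf Z \<theta> \<le> ennreal (exp (t * (\<theta>\<^sup>2 * exp \<bar>\<theta>\<bar> * I)))"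
    using small_jumps_distribution[OF \<rho> t] unfolding I_def by blast
  have R: "real_distribution (return borel (t * \<gamma>))"
    by (simp add: real_distribution_def real_distribution_axioms_def prob_space_return)
  obtain \<eta> where \<eta>: "real_distribution \<eta>"
      "\<And>s. char \<eta> s = char (return borel (t * \<gamma>) \<star> Z) s * exp (of_real t * (CLINT x:S|\<rho>. iexp (s * x) - 1))"
      "\<And>\<theta> L. 0 \<le> L \<Longrightarrow> (\<integral>\<^sup>+x. ennreal (exp (\<theta> * x)) * indicator S x \<partial>\<rho>) = ennreal L \<Longrightarrow>
         mgf \<eta> \<theta> = mgf (return borel (t * \<gamma>) \<star> Z) \<theta> * ennreal (exp (t * (L - measure \<rho> S)))"
    using add_jumps[OF \<rho> S fin t real_distribution_convolution[OF R Z(1)]] by blast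
  have "char \<eta> s = exp (of_real t * levy_exponent \<gamma> \<rho> s)" for s
  proof -
    have "levy_exponent \<gamma> (density \<rho> (indicator (- S))) s =
        \<i> * of_real (\<gamma> * s) + (CLINT x:{-1..1}|\<rho>. iexp (s * x) - 1 - \<i> * of_real (s * x))"
    proof -
      have "(CLINT x|density \<rho> (indicator (- S)). iexp (s * x) - 1 - \<i> * of_real (s * x * indicator {-1..1} x)) =
          (CLINT x|\<rho>. indicator (- S) x *\<^sub>R (iexp (s * x) - 1 - \<i> * of_real (s * x * indicator {-1..1} x)))"
        using integral_density[of "\<lambda>x. iexp (s * x) - 1 - \<i> * of_real (s * x * indicator {-1..1} x)" \<rho> "indicator (- S)"]
        by (simp add: ennreal_indicator)
      also have "\<dots> = (CLINT x:{-1..1}|\<rho>. iexp (s * x) - 1 - \<i> * of_real (s * x))"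
        unfolding set_lebesgue_integral_def S_def
        by (intro Bochner_Integration.integral_cong) (auto split: split_indicator)
      finally show ?thesis
        unfolding levy_exponent_def by simp
    qed
    then have "levy_exponent \<gamma> \<rho> s = \<i> * of_real (\<gamma> * s) +
        (CLINT x:{-1..1}|\<rho>. iexp (s * x) - 1 - \<i> * of_real (s * x)) + (CLINT x:S|\<rho>. iexp (s * x) - 1)"
      using levy_exponent_split[OF \<rho> S, of \<gamma> s] by (simp add: S_def)
    moreover have "char (return borel (t * \<gamma>)) s = exp (of_real t * (\<i> * of_real (\<gamma> * s)))"
      unfolding char_def by (subst integral_return) (auto simp: ac_simps)
    ultimately show ?thesis
      unfolding \<eta>(2) char_convolution[OF R Z(1)] Z(2) by (simp only: distrib_left exp_add)
  qed
  moreover have "\<exists>C. \<forall>\<theta>\<ge>0. mgf \<eta> \<theta> \<le> ennreal (exp (C * exp ((b + 1) * \<theta>)))"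
    if b: "1 \<le> b" "emeasure \<rho> {b<..} = 0" for b
  proof (intro exI allI impI)
    fix \<theta> :: real assume \<theta>: "0 \<le> \<theta>"
    have "AE x in \<rho>. x \<le> b"
      using b(2) by (intro AE_I'[of "{b<..}"]) (auto simp: null_sets_def)
    then have le: "(\<integral>\<^sup>+x. ennreal (exp (\<theta> * x)) * indicator S x \<partial>\<rho>) \<le> (\<integral>\<^sup>+x. ennreal (exp (b * \<theta>)) * indicator S x \<partial>\<rho>)"
    proof (intro nn_integral_mono_AE, eventually_elim)
      case (elim x)
      then show ?case
        using mult_left_mono[OF elim(2) \<theta>] by (auto split: split_indicator intro!: ennreal_leI simp: mult.commute)
    qed
    also have "\<dots> = ennreal (exp (b * \<theta>) * measure \<rho> S)"
      using fin by (simp add: emeasure_eq_ennreal_measure ennreal_mult nn_integral_cmult_indicator)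
    finally have le': "(\<integral>\<^sup>+x. ennreal (exp (\<theta> * x)) * indicator S x \<partial>\<rho>) \<le> ennreal (exp (b * \<theta>) * measure \<rho> S)" .
    then obtain L where L: "0 \<le> L" "(\<integral>\<^sup>+x. ennreal (exp (\<theta> * x)) * indicator S x \<partial>\<rho>) = ennreal L"
      by (cases "\<integral>\<^sup>+x. ennreal (exp (\<theta> * x)) * indicator S x \<partial>\<rho>" rule: ennreal_cases) (auto simp: top_unique)
    with le' have L3: "L \<le> exp (b * \<theta>) * measure \<rho> S"
      by simp
    have "mgf \<eta> \<theta> = mgf (return borel (t * \<gamma>)) \<theta> * mgf Z \<theta> * ennreal (exp (t * (L - measure \<rho> S)))"
      using \<eta>(3)[OF L(1,2)] by (simp add: mgf_convolution[OF R Z(1)])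
    also have "mgf (return borel (t * \<gamma>)) \<theta> = ennreal (exp (t * (\<gamma> * \<theta>)))"
      unfolding mgf_def by (subst nn_integral_return) (auto simp: ac_simps)
    also have "ennreal (exp (t * (\<gamma> * \<theta>))) * mgf Z \<theta> * ennreal (exp (t * (L - measure \<rho> S))) \<le>
        ennreal (exp (t * (\<gamma> * \<theta>))) * ennreal (exp (t * (\<theta>\<^sup>2 * exp \<bar>\<theta>\<bar> * I))) * ennreal (exp (t * (L - measure \<rho> S)))"
      by (intro mult_mono Z(3)) auto
    also have "\<dots> = ennreal (exp (t * (\<gamma> * \<theta> + \<theta>\<^sup>2 * exp \<theta> * I + (L - measure \<rho> S))))"
      using \<theta> by (simp add: distrib_left exp_add ennreal_mult)
    also have "\<dots> \<le> ennreal (exp (t * (\<bar>\<gamma>\<bar> + 2 * I + measure \<rho> S) * exp ((b + 1) * \<theta>)))"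
    proof -
      \<comment> \<open>As \<open>1 \<le> b\<close>, the one quantity
        \<open>exp ((b + 1) * \<theta>)\<close> dominates the drift, the term
        \<open>\<theta>\<^sup>2 * exp \<theta>\<close> of the small jumps, and the jumps up to
        \<open>b\<close>.\<close>
      have e1: "exp (2 * \<theta>) \<le> exp ((b + 1) * \<theta>)" "exp (b * \<theta>) \<le> exp ((b + 1) * \<theta>)" "exp \<theta> \<le> exp ((b + 1) * \<theta>)"
        using mult_right_mono[OF b(1) \<theta>] \<theta> by (auto simp: algebra_simps)
      have "\<theta> \<le> exp \<theta>"
        using exp_ge_add_one_self[of \<theta>] by linarith
      then have "\<gamma> * \<theta> \<le> \<bar>\<gamma>\<bar> * exp ((b + 1) * \<theta>)"
        using order.trans[OF _ e1(3), of \<theta>] \<theta> by (intro mult_mono) auto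
      moreover have "\<theta>\<^sup>2 * exp \<theta> * I \<le> 2 * I * exp ((b + 1) * \<theta>)"
      proof -
        have "\<theta>\<^sup>2 \<le> 2 * exp \<theta>"
          using exp_lower_Taylor_quadratic[OF \<theta>] \<theta> by simp
        then have "\<theta>\<^sup>2 * exp \<theta> \<le> 2 * exp \<theta> * exp \<theta>"
          by (intro mult_right_mono) auto
        also have "\<dots> = 2 * exp (2 * \<theta>)"
          by (simp add: exp_double power2_eq_square)
        finally have "\<theta>\<^sup>2 * exp \<theta> \<le> 2 * exp ((b + 1) * \<theta>)"
          using e1(1) by linarith
        from mult_right_mono[OF this I] show ?thesis
          by (simp add: ac_simps)
      qed
      moreover have "L - measure \<rho> S \<le> measure \<rho> S * exp ((b + 1) * \<theta>)"
      proof -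
        have "exp (b * \<theta>) * measure \<rho> S \<le> exp ((b + 1) * \<theta>) * measure \<rho> S"
          by (rule mult_right_mono[OF e1(2)]) simp
        then show ?thesis
          using L3 measure_nonneg[of \<rho> S] by (simp only: mult.commute)
      qed
      ultimately have "\<gamma> * \<theta> + \<theta>\<^sup>2 * exp \<theta> * I + (L - measure \<rho> S) \<le> (\<bar>\<gamma>\<bar> + 2 * I + measure \<rho> S) * exp ((b + 1) * \<theta>)"
        by (simp add: distrib_right)
      then show ?thesis
        using t by (auto intro!: ennreal_leI simp: mult.assoc)
    qed
    finally show "mgf \<eta> \<theta> \<le> ennreal (exp (t * (\<bar>\<gamma>\<bar> + 2 * I + measure \<rho> S) * exp ((b + 1) * \<theta>)))" .
  qed
  ultimately show ?thesis
    using \<eta>(1) by blast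
qed

section \<open>Tilted compound Poisson distributions\<close>

lemma real_distribution_return: "real_distribution (return borel c)"
  by (simp add: real_distribution_def real_distribution_axioms_def prob_space_return)

lemma measure_convolution_ge:
  assumes "real_distribution \<mu>" "real_distribution \<eta>"
  shows "measure \<mu> {x<..} * measure \<eta> {y<..} \<le> measure (\<mu> \<star> \<eta>) {x + y<..}"
proof -
  interpret \<mu>: real_distribution \<mu> by fact
  interpret \<eta>: real_distribution \<eta> by fact
  interpret C: real_distribution "\<mu> \<star> \<eta>" by (rule real_distribution_convolution) fact+
  have "ennreal (measure \<mu> {x<..} * measure \<eta> {y<..}) = (\<integral>\<^sup>+a. \<integral>\<^sup>+b. indicator {x<..} a * indicator {y<..} b \<partial>\<eta> \<partial>\<mu>)"
    by (simp add: nn_integral_cmult nn_integral_multc \<mu>.emeasure_eq_measure \<eta>.emeasure_eq_measure ennreal_mult)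
  also have "\<dots> \<le> (\<integral>\<^sup>+a. \<integral>\<^sup>+b. indicator {x + y<..} (a + b) \<partial>\<eta> \<partial>\<mu>)"
    by (intro nn_integral_mono) (auto split: split_indicator)
  also have "\<dots> = (\<integral>\<^sup>+a. indicator {x + y<..} a \<partial>(\<mu> \<star> \<eta>))"
    by (subst nn_integral_convolution) (auto simp: \<mu>.finite_measure_axioms \<eta>.finite_measure_axioms)
  finally show ?thesis
    by (simp add: C.emeasure_eq_measure)
qed

text \<open>Pigeonhole over unit cells: if every inequality failed, each of the \<open>Suc N\<close>
  cells \<open>J i\<close> would carry tilted mass less than \<open>c / Suc N\<close>, and together
  they could not reach \<open>c\<close>. The index \<open>i\<close> records how far below
  \<open>u\<close> the chosen cell lies.\<close>

lemma mgf_window: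
  assumes "real_distribution Q" "0 \<le> \<theta>"
    and c: "ennreal c \<le> (\<integral>\<^sup>+s. ennreal (exp (\<theta> * s)) * indicator {u - real (Suc N)<..u} s \<partial>Q)" "0 \<le> c"
  shows "\<exists>i\<le>N. exp (- \<theta> * (u - real i)) * (c / real (Suc N)) \<le> measure Q {u - real (Suc i)<..}"
proof (rule ccontr)
  interpret real_distribution Q by fact
  define J where "J i = {u - real (Suc i)<..u - real i}" for i :: nat
  have J [measurable]: "J i \<in> sets borel" for i
    unfolding J_def by simp
  assume "\<not> ?thesis"
  then have less: "measure Q {u - real (Suc i)<..} < exp (- \<theta> * (u - real i)) * (c / real (Suc N))" if "i \<le> N" for i
    using that by (metis not_le)
  have J_le: "(\<integral>\<^sup>+s. ennreal (exp (\<theta> * s)) * indicator (J i) s \<partial>Q) \<le> ennreal (exp (\<theta> * (u - real i)) * measure Q {u - real (Suc i)<..})" for i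
  proof -
    have "(\<integral>\<^sup>+s. ennreal (exp (\<theta> * s)) * indicator (J i) s \<partial>Q) \<le> (\<integral>\<^sup>+s. ennreal (exp (\<theta> * (u - real i))) * indicator {u - real (Suc i)<..} s \<partial>Q)"
      using assms(2) by (intro nn_integral_mono) (auto split: split_indicator simp: J_def intro!: ennreal_leI mult_left_mono)
    also have "\<dots> = ennreal (exp (\<theta> * (u - real i)) * measure Q {u - real (Suc i)<..})"
      by (simp add: nn_integral_cmult_indicator emeasure_eq_measure ennreal_mult)
    finally show ?thesis .
  qed
  have cover: "s \<in> (\<Union>i\<le>N. J i)" if "s \<in> {u - real (Suc N)<..u}" for s
  proof -
    define i where "i = nat \<lfloor>u - s\<rfloor>"
    have "real i \<le> u - s" "u - s < real i + 1"
      using that unfolding i_def by (auto simp: of_nat_nat)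
    moreover from this that have "i \<le> N"
      by auto
    ultimately show ?thesis
      by (auto simp: J_def intro!: bexI[of _ i])
  qed
  have "(\<integral>\<^sup>+s. ennreal (exp (\<theta> * s)) * indicator {u - real (Suc N)<..u} s \<partial>Q)
      \<le> (\<integral>\<^sup>+s. (\<Sum>i\<le>N. ennreal (exp (\<theta> * s)) * indicator (J i) s) \<partial>Q)"
  proof (intro nn_integral_mono)
    fix s
    show "ennreal (exp (\<theta> * s)) * indicator {u - real (Suc N)<..u} s \<le> (\<Sum>i\<le>N. ennreal (exp (\<theta> * s)) * indicator (J i) s)"
    proof (cases "s \<in> {u - real (Suc N)<..u}")
      case True
      with cover obtain i where "i \<le> N" "s \<in> J i"
        by blast
      then show ?thesis
        using True member_le_sum[of i "{..N}" "\<lambda>i. ennreal (exp (\<theta> * s)) * indicator (J i) s"] by simp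
    qed simp
  qed
  also have "\<dots> = (\<Sum>i\<le>N. \<integral>\<^sup>+s. ennreal (exp (\<theta> * s)) * indicator (J i) s \<partial>Q)"
    by (rule nn_integral_sum) simp
  also have "\<dots> \<le> (\<Sum>i\<le>N. ennreal (exp (\<theta> * (u - real i)) * measure Q {u - real (Suc i)<..}))"
    by (intro sum_mono J_le)
  also have "\<dots> = ennreal (\<Sum>i\<le>N. exp (\<theta> * (u - real i)) * measure Q {u - real (Suc i)<..})"
    by (rule sum_ennreal) simp
  finally have "c \<le> (\<Sum>i\<le>N. exp (\<theta> * (u - real i)) * measure Q {u - real (Suc i)<..})"
    using c by (auto dest: order.trans simp: sum_nonneg)
  also have "\<dots> < (\<Sum>i\<le>N. exp (\<theta> * (u - real i)) * (exp (- \<theta> * (u - real i)) * (c / real (Suc N))))"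
    using less by (intro sum_strict_mono mult_strict_left_mono) auto
  also have "\<dots> = (\<Sum>i\<le>N. c / real (Suc N))"
    by (intro sum.cong) (auto simp: mult.assoc[symmetric] exp_add[symmetric])
  also have "\<dots> = c"
    by simp
  finally show False
    by simp
qed

section \<open>Counting jumps under the tilted law\<close>

context poisson_jumps
begin

lemma measure_compound_poisson_ge:
  assumes "B \<in> sets borel"
  shows "pois n * measure (convpow \<mu> \<eta> n) B \<le> measure (compound_poisson l \<mu> \<eta>) B"
proof -
  have "(\<Sum>i\<in>{n}. pois i * measure (convpow \<mu> \<eta> i) B) \<le> measure (compound_poisson l \<mu> \<eta>) B"
    using measure_compound_poisson[OF assms] l_pos
    unfolding sums_iff by (metis (no_types, lifting) finite.intros sum_le_suminf measure_nonneg
        mult_nonneg_nonneg divide_nonneg_nonneg zero_le_power less_imp_le fact_ge_zero exp_ge_zero)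
  then show ?thesis
    by simp
qed

lemma measure_convpow_add_ge:
  "measure (convpow \<mu> \<eta> n) {y<..} * measure \<mu> {x<..} ^ k \<le> measure (convpow \<mu> \<eta> (n + k)) {y + real k * x<..}"
proof (induction k)
  case (Suc k)
  have "measure (convpow \<mu> \<eta> n) {y<..} * measure \<mu> {x<..} ^ Suc k =
      measure \<mu> {x<..} * (measure (convpow \<mu> \<eta> n) {y<..} * measure \<mu> {x<..} ^ k)"
    by simp
  also have "\<dots> \<le> measure \<mu> {x<..} * measure (convpow \<mu> \<eta> (n + k)) {y + real k * x<..}"
    by (intro mult_left_mono Suc.IH) simp
  also have "\<dots> \<le> measure (\<mu> \<star> convpow \<mu> \<eta> (n + k)) {x + (y + real k * x)<..}"
    by (rule measure_convolution_ge[OF mu real_distribution_convpow])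
  also have "\<dots> = measure (convpow \<mu> \<eta> (n + Suc k)) {y + real (Suc k) * x<..}"
    by (simp add: algebra_simps)
  finally show ?case .
qed simp

text \<open>Under exponential tilting by \<open>\<theta>\<close> the number of jumps is Poisson with mean \<open>L\<close>.\<close>

lemma jump_count_bounds:
  assumes \<theta>: "0 \<le> \<theta>" and L: "0 < L" "mgf \<mu> \<theta> = ennreal (L / l)"
    and E: "mgf (compound_poisson l \<mu> \<eta>) \<theta> = ennreal E" "0 \<le> E"
    and B: "B \<in> sets borel" "B \<subseteq> {\<beta>..}"
  shows "measure (compound_poisson l \<mu> \<eta>) B \<le>
      2 / L * (l * measure (\<mu> \<star> compound_poisson l \<mu> \<eta>) B) + exp (- \<theta> * \<beta>) * E * exp (- L / 8)"
    and "l * measure (\<mu> \<star> compound_poisson l \<mu> \<eta>) B \<le>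
      4 * L * measure (compound_poisson l \<mu> \<eta>) B + exp (- \<theta> * \<beta>) * E * (2 * L * exp (- L / 8))"
proof -
  define q where "q n = pois n * measure (convpow \<mu> \<eta> n) B" for n
  have q0: "0 \<le> q n" for n
    using l_pos by (simp add: q_def)
  have m: "mgf (compound_poisson l \<mu> \<eta>) \<theta> = mgf \<eta> \<theta> * ennreal (exp (L - l))"
    using mgf_compound_poisson[OF L(2)] L(1) l_pos by (simp add: right_diff_distrib)
  have "mgf \<eta> \<theta> \<noteq> \<infinity>"
    using m E(1) by (auto simp: ennreal_top_mult)
  then obtain e0 where e0: "0 \<le> e0" "mgf \<eta> \<theta> = ennreal e0"
    by (cases "mgf \<eta> \<theta>" rule: ennreal_cases) auto
  have Ee: "E = e0 * exp (L - l)"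
    using m E e0 by (simp flip: ennreal_mult)
  define c where "c = exp (- \<theta> * \<beta>) * e0 * exp (- l)"
  have c0: "0 \<le> c"
    using e0 by (simp add: c_def)
  have c: "c * exp L = exp (- \<theta> * \<beta>) * E"
    by (simp add: c_def Ee exp_diff exp_minus divide_inverse)
  \<comment> \<open>Chernoff's bound for exactly \<open>n\<close> jumps. Since
    \<open>c * exp L = exp (- \<theta> * \<beta>) * E\<close>, the right-hand sides are that
    constant times the Poisson weights with mean \<open>L\<close>.\<close>
  have q_le: "q n \<le> c * (L ^ n / fact n)" for n
  proof -
    interpret Q: real_distribution "convpow \<mu> \<eta> n" by (rule real_distribution_convpow)
    have "emeasure (convpow \<mu> \<eta> n) B \<le> emeasure (convpow \<mu> \<eta> n) {\<beta>..}"
      using B by (intro emeasure_mono) auto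
    also have "\<dots> \<le> ennreal (exp (- \<theta> * \<beta>)) * mgf (convpow \<mu> \<eta> n) \<theta>"
      by (rule emeasure_tail_le_mgf[OF real_distribution_convpow \<theta>])
    also have "\<dots> = ennreal (exp (- \<theta> * \<beta>) * ((L / l) ^ n * e0))"
      using L e0 l_pos by (simp add: mgf_convpow ennreal_power flip: ennreal_mult)
    finally have "measure (convpow \<mu> \<eta> n) B \<le> exp (- \<theta> * \<beta>) * ((L / l) ^ n * e0)"
      using L e0 l_pos by (simp add: Q.emeasure_eq_measure)
    then have "q n \<le> pois n * (exp (- \<theta> * \<beta>) * ((L / l) ^ n * e0))"
      unfolding q_def using l_pos by (intro mult_left_mono) auto
    also have "\<dots> = c * (L ^ n / fact n)"
      using l_pos by (simp add: c_def power_divide)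
    finally show ?thesis .
  qed
  have s1: "q sums measure (compound_poisson l \<mu> \<eta>) B"
    unfolding q_def by (rule measure_compound_poisson[OF B(1)])
  have s2: "(\<lambda>n. real n * q n) sums (l * measure (\<mu> \<star> compound_poisson l \<mu> \<eta>) B)"
    unfolding q_def by (rule measure_convolution_compound_poisson[OF B(1)])
  have e: "(\<lambda>n. x ^ n / fact n) sums exp x" for x :: real
    using exp_converges[of x] by (simp add: divide_inverse mult.commute)

  \<comment> \<open>For \<open>n < L / 2\<close> the factor \<open>2 powr (L / 2) / 2 ^ n\<close>
    exceeds 1 and replaces \<open>L ^ n\<close> by \<open>(L / 2) ^ n\<close>. The saving
    \<open>exp (- L / 8)\<close> comes from \<open>(1 + ln 2) / 2 \<le> 7 / 8\<close>.\<close>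
  have s3: "(\<lambda>n. 2 / L * (real n * q n) + c * 2 powr (L / 2) * ((L / 2) ^ n / fact n)) sums
      (2 / L * (l * measure (\<mu> \<star> compound_poisson l \<mu> \<eta>) B) + c * 2 powr (L / 2) * exp (L / 2))"
    by (intro sums_add sums_mult s2 e)
  have "q n \<le> 2 / L * (real n * q n) + c * 2 powr (L / 2) * ((L / 2) ^ n / fact n)" for n
  proof (cases "L / 2 \<le> real n")
    case True
    then have "1 * q n \<le> (2 / L * real n) * q n"
      using L(1) by (intro mult_right_mono q0) (simp add: field_simps)
    moreover have "0 \<le> c * 2 powr (L / 2) * ((L / 2) ^ n / fact n)"
      using L(1) c0 by simp
    ultimately show ?thesis
      by simp
  next
    case False
    then have "2 ^ n \<le> 2 powr (L / 2)"
      by (simp add: powr_realpow[symmetric])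
    then have "c * (L ^ n / fact n) * 1 \<le> c * (L ^ n / fact n) * (2 powr (L / 2) / 2 ^ n)"
      using c0 L(1) by (intro mult_left_mono) auto
    moreover have "c * (L ^ n / fact n) * (2 powr (L / 2) / 2 ^ n) = c * 2 powr (L / 2) * ((L / 2) ^ n / fact n)"
      by (simp add: power_divide ac_simps)
    moreover have "0 \<le> 2 / L * (real n * q n)"
      using L(1) q0 by simp
    ultimately show ?thesis
      using q_le[of n] by linarith
  qed
  from sums_le[OF this s1 s3] have "measure (compound_poisson l \<mu> \<eta>) B \<le>
      2 / L * (l * measure (\<mu> \<star> compound_poisson l \<mu> \<eta>) B) + c * (2 powr (L / 2) * exp (L / 2))"
    by (simp add: mult.assoc)
  also have "c * (2 powr (L / 2) * exp (L / 2)) \<le> c * (exp L * exp (- L / 8))"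
  proof (intro mult_left_mono c0)
    have "L * ln 2 \<le> L * (25 / 36)"
      using L(1) ln2_le_25_over_36 by (intro mult_left_mono) auto
    then show "2 powr (L / 2) * exp (L / 2) \<le> exp L * exp (- L / 8)"
      using L(1) by (simp add: powr_def flip: exp_add)
  qed
  finally show "measure (compound_poisson l \<mu> \<eta>) B \<le>
      2 / L * (l * measure (\<mu> \<star> compound_poisson l \<mu> \<eta>) B) + exp (- \<theta> * \<beta>) * E * exp (- L / 8)"
    by (simp add: c mult.assoc[symmetric])

  have e': "(\<lambda>n. real n * (x ^ n / fact n)) sums (x * exp x)" for x :: real
  proof -
    have "(\<lambda>n. x * (x ^ n / fact n)) sums (x * exp x)"
      by (intro sums_mult e)
    also have "(\<lambda>n. x * (x ^ n / fact n)) = (\<lambda>n. real (Suc n) * (x ^ Suc n / fact (Suc n)))"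
      by (simp add: fun_eq_iff)
    finally show ?thesis
      by (subst (asm) sums_Suc_iff) simp
  qed
  \<comment> \<open>For \<open>n > 4 * L\<close> the factor \<open>2 ^ n / 2 powr (4 * L)\<close>
    exceeds 1 and replaces \<open>L ^ n\<close> by \<open>(2 * L) ^ n\<close>. The resulting
    exponent \<open>2 * L - 4 * L * ln 2\<close> is negative, hence far below
    \<open>7 * L / 8\<close>.\<close>
  have s4: "(\<lambda>n. 4 * L * q n + c * 2 powr (- (4 * L)) * (real n * ((2 * L) ^ n / fact n))) sums
      (4 * L * measure (compound_poisson l \<mu> \<eta>) B + c * 2 powr (- (4 * L)) * (2 * L * exp (2 * L)))"
    by (intro sums_add sums_mult s1 e')
  have "real n * q n \<le> 4 * L * q n + c * 2 powr (- (4 * L)) * (real n * ((2 * L) ^ n / fact n))" for n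
  proof (cases "real n \<le> 4 * L")
    case True
    then have "real n * q n \<le> 4 * L * q n"
      by (intro mult_right_mono q0)
    moreover have "0 \<le> c * 2 powr (- (4 * L)) * (real n * ((2 * L) ^ n / fact n))"
      using L(1) c0 by simp
    ultimately show ?thesis
      by linarith
  next
    case False
    then have "2 powr (4 * L) \<le> 2 ^ n"
      by (simp add: powr_realpow[symmetric])
    then have "1 \<le> 2 powr (- (4 * L)) * 2 ^ n"
      by (simp add: powr_minus field_simps)
    then have "c * (real n * (L ^ n / fact n)) * 1 \<le> c * (real n * (L ^ n / fact n)) * (2 powr (- (4 * L)) * 2 ^ n)"
      using c0 L(1) by (intro mult_left_mono) auto
    also have "\<dots> = c * 2 powr (- (4 * L)) * (real n * ((2 * L) ^ n / fact n))"
      by (simp add: power_mult_distrib)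
    finally have "c * (real n * (L ^ n / fact n)) \<le> c * 2 powr (- (4 * L)) * (real n * ((2 * L) ^ n / fact n))"
      by simp
    moreover have "real n * q n \<le> real n * (c * (L ^ n / fact n))"
      by (intro mult_left_mono q_le) simp
    moreover have "0 \<le> 4 * L * q n"
      using L(1) q0 by simp
    ultimately show ?thesis
      by (simp only: mult.left_commute[of "real n" c])
  qed
  from sums_le[OF this s2 s4] have "l * measure (\<mu> \<star> compound_poisson l \<mu> \<eta>) B \<le>
      4 * L * measure (compound_poisson l \<mu> \<eta>) B + c * (2 * L * (2 powr (- (4 * L)) * exp (2 * L)))"
    by (simp add: ac_simps)
  also have "c * (2 * L * (2 powr (- (4 * L)) * exp (2 * L))) \<le> c * (2 * L * (exp L * exp (- L / 8)))"
  proof (intro mult_left_mono c0)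
    have "L * (2 / 3) \<le> L * ln 2"
      using L(1) ln2_ge_two_thirds by (intro mult_left_mono) auto
    then show "2 powr (- (4 * L)) * exp (2 * L) \<le> exp L * exp (- L / 8)"
      using L(1) by (simp add: powr_def flip: exp_add)
  qed (use L(1) in simp)
  finally show "l * measure (\<mu> \<star> compound_poisson l \<mu> \<eta>) B \<le>
      4 * L * measure (compound_poisson l \<mu> \<eta>) B + exp (- \<theta> * \<beta>) * E * (2 * L * exp (- L / 8))"
    unfolding c[symmetric] by (simp only: ac_simps)
qed

end

text \<open>In unnormalised form: under the law tilted by \<open>exp (\<theta> * x)\<close>, the sum
  of \<open>n\<close> independent jumps has mean \<open>n * xb\<close> and variance
  \<open>n * v\<close>. Keeping the weight inside the integrals avoids a separate tilted measure;
  the total mass is \<open>a0 ^ n\<close>.\<close>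

lemma tilted_moments_convpow:
  fixes \<theta> a0 xb v :: real
  assumes mu: "real_distribution \<mu>"
    and i: "integrable \<mu> (\<lambda>x. exp (\<theta> * x))" "integrable \<mu> (\<lambda>x. (x - xb) * exp (\<theta> * x))"
      "integrable \<mu> (\<lambda>x. (x - xb)\<^sup>2 * exp (\<theta> * x))"
    and a0: "(\<integral>x. exp (\<theta> * x) \<partial>\<mu>) = a0" and mean: "(\<integral>x. (x - xb) * exp (\<theta> * x) \<partial>\<mu>) = 0"
    and var: "(\<integral>x. (x - xb)\<^sup>2 * exp (\<theta> * x) \<partial>\<mu>) = v * a0"
  defines "T \<equiv> convpow \<mu> (return borel 0)"
  shows "integrable (T n) (\<lambda>x. exp (\<theta> * x)) \<and> integrable (T n) (\<lambda>x. (x - n * xb) * exp (\<theta> * x)) \<and>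
    integrable (T n) (\<lambda>x. (x - n * xb)\<^sup>2 * exp (\<theta> * x)) \<and> (\<integral>x. exp (\<theta> * x) \<partial>T n) = a0 ^ n \<and>
    (\<integral>x. (x - n * xb) * exp (\<theta> * x) \<partial>T n) = 0 \<and> (\<integral>x. (x - n * xb)\<^sup>2 * exp (\<theta> * x) \<partial>T n) = n * v * a0 ^ n"
proof (induction n)
  case 0
  have *: "integrable (return borel 0) f" if "f \<in> borel_measurable borel" for f :: "real \<Rightarrow> real"
  proof (rule integrableI_bounded)
    have "(\<integral>\<^sup>+x. norm (f x) \<partial>return borel 0) = norm (f 0)"
      using that by (subst nn_integral_return) auto
    then show "(\<integral>\<^sup>+x. norm (f x) \<partial>return borel 0) < \<infinity>"
      by simp
  qed (use that in simp)
  show ?case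
    by (auto simp: T_def integral_return intro!: *)
next
  case (Suc n)
  have T: "real_distribution (T n)"
    unfolding T_def by (induction n) (auto intro!: real_distribution_convolution mu real_distribution_return)
  have TS: "T (Suc n) = (\<mu> \<star> T n)"
    by (simp add: T_def)
  define f0 f1 f2 g0 g1 g2 where "f0 x = exp (\<theta> * x)" and "f1 x = (x - xb) * exp (\<theta> * x)"
    and "f2 x = (x - xb)\<^sup>2 * exp (\<theta> * x)" and "g0 x = exp (\<theta> * x)" and "g1 x = (x - n * xb) * exp (\<theta> * x)"
    and "g2 x = (x - n * xb)\<^sup>2 * exp (\<theta> * x)" for x
  have fi: "integrable \<mu> f0" "integrable \<mu> f1" "integrable \<mu> f2"
    using i unfolding f0_def f1_def f2_def by auto
  have fe: "integral\<^sup>L \<mu> f0 = a0" "integral\<^sup>L \<mu> f1 = 0" "integral\<^sup>L \<mu> f2 = v * a0"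
    using a0 mean var unfolding f0_def f1_def f2_def by auto
  have gi: "integrable (T n) g0" "integrable (T n) g1" "integrable (T n) g2"
    and ge: "integral\<^sup>L (T n) g0 = a0 ^ n" "integral\<^sup>L (T n) g1 = 0" "integral\<^sup>L (T n) g2 = n * v * a0 ^ n"
    using Suc.IH unfolding g0_def g1_def g2_def by auto
  have 0: "integrable (T (Suc n)) (\<lambda>x. exp (\<theta> * x))" "(\<integral>x. exp (\<theta> * x) \<partial>T (Suc n)) = a0 ^ Suc n"
    using integral_convolution_sum_mult[OF mu T, of "{()}" "\<lambda>_. f0" "\<lambda>_. g0" "\<lambda>x. exp (\<theta> * x)"] fi gi
    by (auto simp: TS fe ge f0_def g0_def distrib_left exp_add)
  have 1: "integrable (T (Suc n)) (\<lambda>x. (x - Suc n * xb) * exp (\<theta> * x))" "(\<integral>x. (x - Suc n * xb) * exp (\<theta> * x) \<partial>T (Suc n)) = 0"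
  proof -
    have k: "(x + y - Suc n * xb) * exp (\<theta> * (x + y)) =
        (\<Sum>i\<in>UNIV. (if i then f1 else f0) x * (if i then g0 else g1) y)" for x y
      by (simp add: UNIV_bool f0_def f1_def g0_def g1_def distrib_left exp_add algebra_simps)
    from integral_convolution_sum_mult[OF mu T, of UNIV "\<lambda>i. if i then f1 else f0" "\<lambda>i. if i then g0 else g1", OF _ _ _ _ k]
    show "integrable (T (Suc n)) (\<lambda>x. (x - Suc n * xb) * exp (\<theta> * x))" "(\<integral>x. (x - Suc n * xb) * exp (\<theta> * x) \<partial>T (Suc n)) = 0"
      using fi gi by (auto simp: TS fe ge UNIV_bool)
  qed
  have 2: "integrable (T (Suc n)) (\<lambda>x. (x - Suc n * xb)\<^sup>2 * exp (\<theta> * x))"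
    "(\<integral>x. (x - Suc n * xb)\<^sup>2 * exp (\<theta> * x) \<partial>T (Suc n)) = Suc n * v * a0 ^ Suc n"
  proof -
    \<comment> \<open>The three terms of the binomial expansion. The middle one integrates to 0
      because the factors are centred.\<close>
    define F where "F = (\<lambda>i::nat. if i = 0 then f2 else if i = 1 then (\<lambda>x. 2 * f1 x) else f0)"
    define G where "G = (\<lambda>i::nat. if i = 0 then g0 else if i = 1 then g1 else g2)"
    have sq: "(x + y - Suc n * xb)\<^sup>2 = (x - xb)\<^sup>2 + 2 * (x - xb) * (y - n * xb) + (y - n * xb)\<^sup>2" for x y :: real
      by (simp add: power2_eq_square algebra_simps)
    have k: "(x + y - Suc n * xb)\<^sup>2 * exp (\<theta> * (x + y)) = (\<Sum>i\<in>{0,1,2}. F i x * G i y)" for x y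
      unfolding sq by (simp add: F_def G_def f0_def f1_def f2_def g0_def g1_def g2_def distrib_left exp_add algebra_simps)
    from integral_convolution_sum_mult[OF mu T, of "{0,1,2}" F G, OF _ _ _ _ k]
    show "integrable (T (Suc n)) (\<lambda>x. (x - Suc n * xb)\<^sup>2 * exp (\<theta> * x))"
      "(\<integral>x. (x - Suc n * xb)\<^sup>2 * exp (\<theta> * x) \<partial>T (Suc n)) = Suc n * v * a0 ^ Suc n"
      using fi gi by (auto simp: TS F_def G_def fe ge algebra_simps)
  qed
  show ?case
    using 0 1 2 by blast
qed

section \<open>The maximum of a process with independent increments\<close>

text \<open>Condition on the first time the walk exceeds \<open>u\<close>.\<close>

lemma (in prob_space) ottaviani:
  fixes S :: "nat \<Rightarrow> 'a \<Rightarrow> real"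
  assumes ind: "indep_vars (\<lambda>_. borel) (\<lambda>i \<omega>. S (Suc i) \<omega> - S i \<omega>) {..<n}"
    and S0: "\<And>\<omega>. \<omega> \<in> space M \<Longrightarrow> S 0 \<omega> = 0"
    and meas [measurable]: "\<And>k. S k \<in> borel_measurable M"
    and p: "\<And>k. m \<le> k \<Longrightarrow> k \<le> n \<Longrightarrow> p \<le> prob {\<omega>\<in>space M. - c \<le> S n \<omega> - S k \<omega>}"
  shows "p * prob {\<omega>\<in>space M. \<exists>k. m \<le> k \<and> k \<le> n \<and> u < S k \<omega>} \<le> prob {\<omega>\<in>space M. u - c < S n \<omega>}"
proof -
  define D where "D i \<omega> = S (Suc i) \<omega> - S i \<omega>" for i \<omega>
  \<comment> \<open>\<open>A k\<close> says that \<open>k\<close> is the first index from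
    \<open>m\<close> on at which the walk exceeds \<open>u\<close>. It depends on the first
    \<open>k\<close> increments only and \<open>B k\<close> on the others, so the two are
    independent.\<close>
  define A where "A k = {\<omega>\<in>space M. u < S k \<omega> \<and> (\<forall>j. m \<le> j \<and> j < k \<longrightarrow> S j \<omega> \<le> u)}" for k
  define B where "B k = {\<omega>\<in>space M. - c \<le> S n \<omega> - S k \<omega>}" for k
  have [measurable]: "A k \<in> sets M" "B k \<in> sets M" for k
    unfolding A_def B_def by measurable
  have S_eq: "S k \<omega> = (\<Sum>i<k. D i \<omega>)" if "\<omega> \<in> space M" for k \<omega>
    using S0[OF that] by (induction k) (simp_all add: D_def)
  have AB: "prob (A k \<inter> B k) = prob (A k) * prob (B k)" if k: "k \<le> n" for k
  proof -
    let ?D = "\<lambda>K \<omega>. restrict (\<lambda>i. D i \<omega>) K"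
    define K where "K b = (if b then {..<k} else {k..<n})" for b
    have "indep_vars (\<lambda>b. PiM (K b) (\<lambda>_. borel)) (\<lambda>b \<omega>. ?D (K b) \<omega>) UNIV"
      using ind k unfolding D_def K_def by (intro indep_vars_restrict) (auto simp: disjoint_family_on_def)
    then have iv: "indep_var (PiM {..<k} (\<lambda>_. borel)) (?D {..<k}) (PiM {k..<n} (\<lambda>_. borel)) (?D {k..<n})"
      unfolding indep_var_def K_def
      by (rule iffD1[OF indep_vars_cong, rotated -1]) (auto split: bool.split)
    define XA where "XA = {x \<in> space (PiM {..<k} (\<lambda>_. borel :: real measure)).
        u < (\<Sum>i<k. x i) \<and> (\<forall>j<k. m \<le> j \<longrightarrow> (\<Sum>i<j. x i) \<le> u)}"
    define XB where "XB = {x \<in> space (PiM {k..<n} (\<lambda>_. borel :: real measure)). - c \<le> (\<Sum>i\<in>{k..<n}. x i)}"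
    have sA: "XA \<in> sets (PiM {..<k} (\<lambda>_. borel))"
    proof -
      have *: "(\<lambda>x. \<Sum>i<j. x i) \<in> borel_measurable (PiM {..<k} (\<lambda>_. borel :: real measure))" if "j \<le> k" for j
        using that by (intro borel_measurable_sum measurable_component_singleton) auto
      have 1: "{x \<in> space (PiM {..<k} (\<lambda>_. borel :: real measure)). u < (\<Sum>i<k. x i)} \<in> sets (PiM {..<k} (\<lambda>_. borel))"
        using *[of k] by measurable
      have 2: "{x \<in> space (PiM {..<k} (\<lambda>_. borel :: real measure)). m \<le> j \<longrightarrow> (\<Sum>i<j. x i) \<le> u} \<in> sets (PiM {..<k} (\<lambda>_. borel))"
        if "j \<in> {..<k}" for j
      proof -
        have "(\<lambda>x. \<Sum>i<j. x i) \<in> borel_measurable (PiM {..<k} (\<lambda>_. borel :: real measure))"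
          using * that by simp
        then have "{x \<in> space (PiM {..<k} (\<lambda>_. borel :: real measure)). (\<Sum>i<j. x i) \<le> u} \<in> sets (PiM {..<k} (\<lambda>_. borel))"
          by (rule borel_measurable_le) simp
        then show ?thesis
          by (cases "m \<le> j") auto
      qed
      have "XA = {x \<in> space (PiM {..<k} (\<lambda>_. borel :: real measure)). u < (\<Sum>i<k. x i) \<and>
          (\<forall>j\<in>{..<k}. m \<le> j \<longrightarrow> (\<Sum>i<j. x i) \<le> u)}"
        by (auto simp: XA_def)
      also have "\<dots> \<in> sets (PiM {..<k} (\<lambda>_. borel))"
        by (intro sets.sets_Collect_conj 1 sets.sets_Collect_finite_All 2) auto
      finally show ?thesis .
    qed
    have sB: "XB \<in> sets (PiM {k..<n} (\<lambda>_. borel))"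
    proof -
      have "(\<lambda>x. \<Sum>i\<in>{k..<n}. x i) \<in> borel_measurable (PiM {k..<n} (\<lambda>_. borel :: real measure))"
        by (intro borel_measurable_sum measurable_component_singleton) auto
      then show ?thesis
        unfolding XB_def by measurable
    qed
    have eA: "?D {..<k} -` XA \<inter> space M = A k"
      unfolding XA_def A_def by (auto simp: S_eq space_PiM PiE_def)
    have eB: "?D {k..<n} -` XB \<inter> space M = B k"
    proof -
      have "S n \<omega> - S k \<omega> = (\<Sum>i\<in>{k..<n}. D i \<omega>)" if "\<omega> \<in> space M" for \<omega>
        using k that by (simp add: S_eq sum_diff[symmetric] lessThan_minus_lessThan)
      then show ?thesis
        unfolding XB_def B_def by (auto simp: space_PiM PiE_def)
    qed
    have "A k \<inter> B k = (\<lambda>\<omega>. (?D {..<k} \<omega>, ?D {k..<n} \<omega>)) -` (XA \<times> XB) \<inter> space M"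
      using eA eB by auto
    then show ?thesis
      using indep_varD[OF iv sA sB] by (simp only: eA eB)
  qed
  have disj: "disjoint_family_on A {m..n}"
    unfolding disjoint_family_on_def A_def by (auto; metis leD linorder_neqE_nat)
  have "{\<omega>\<in>space M. \<exists>k. m \<le> k \<and> k \<le> n \<and> u < S k \<omega>} = (\<Union>k\<in>{m..n}. A k)"
  proof (safe)
    fix \<omega> k assume *: "\<omega> \<in> space M" "m \<le> k" "k \<le> n" "u < S k \<omega>"
    define k0 where "k0 = (LEAST k. m \<le> k \<and> u < S k \<omega>)"
    have "m \<le> k0 \<and> u < S k0 \<omega>"
      unfolding k0_def by (rule LeastI[of _ k]) (use * in auto)
    moreover have "k0 \<le> k"
      unfolding k0_def by (rule Least_le) (use * in auto)
    moreover have "S j \<omega> \<le> u" if "m \<le> j" "j < k0" for j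
      using not_less_Least[of j "\<lambda>k. m \<le> k \<and> u < S k \<omega>"] that unfolding k0_def by auto
    ultimately show "\<omega> \<in> (\<Union>k\<in>{m..n}. A k)"
      using * by (auto simp: A_def)
  qed (auto simp: A_def)
  then have "p * prob {\<omega>\<in>space M. \<exists>k. m \<le> k \<and> k \<le> n \<and> u < S k \<omega>} = (\<Sum>k\<in>{m..n}. prob (A k) * p)"
    using disj by (simp add: sum_distrib_left mult.commute finite_measure_finite_Union[of "{m..n}" A] image_subset_iff)
  also have "\<dots> \<le> (\<Sum>k\<in>{m..n}. prob (A k \<inter> B k))"
  proof (intro sum_mono)
    fix k assume "k \<in> {m..n}"
    then show "prob (A k) * p \<le> prob (A k \<inter> B k)"
      using p[of k] by (simp add: AB mult_left_mono flip: B_def)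
  qed
  also have "\<dots> = prob (\<Union>k\<in>{m..n}. A k \<inter> B k)"
    using disj by (intro finite_measure_finite_Union[symmetric]) (auto simp: disjoint_family_on_def)
  also have "\<dots> \<le> prob {\<omega>\<in>space M. u - c < S n \<omega>}"
    by (intro finite_measure_mono) (auto simp: A_def B_def)
  finally show ?thesis .
qed

text \<open>One-sided limits bound \<open>f\<close> near each point, and finitely many
  neighbourhoods cover the compact interval. This is what makes the real-valued \<open>SUP\<close>
  of a path a true supremum.\<close>

lemma cadlag_bdd_above:
  fixes f :: "real \<Rightarrow> real"
  assumes r: "\<And>t. 0 \<le> t \<Longrightarrow> continuous (at_right t) f"
    and l: "\<And>t. 0 < t \<Longrightarrow> \<exists>l. (f \<longlongrightarrow> l) (at_left t)"
  shows "bdd_above (f ` {0..1})"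
proof -
  have loc: "\<exists>U. open U \<and> t \<in> U \<and> bdd_above (f ` (U \<inter> {0..1}))" if t: "t \<in> {0..1}" for t
  proof -
    have "\<forall>\<^sub>F s in at_right t. f s < f t + 1"
      using r[of t] t by (intro order_tendstoD(2)[of f "f t"]) (auto simp: continuous_within)
    then obtain b where b: "t < b" "\<And>s. t < s \<Longrightarrow> s < b \<Longrightarrow> f s < f t + 1"
      unfolding eventually_at_right_field by auto
    obtain a c where a: "a < t" "\<And>s. a < s \<Longrightarrow> s < t \<Longrightarrow> 0 \<le> s \<Longrightarrow> f s < c"
    proof (cases "t = 0")
      case True
      then show ?thesis
        using that[of "-1" 0] by auto
    next
      case False
      then obtain l where "(f \<longlongrightarrow> l) (at_left t)"
        using assms(2)[of t] t by auto
      then have "\<forall>\<^sub>F s in at_left t. f s < l + 1"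
        by (intro order_tendstoD(2)) auto
      then show ?thesis
        using that unfolding eventually_at_left_field by blast
    qed
    have "f s \<le> max (f t + 1) c" if "s \<in> {a<..<b} \<inter> {0..1}" for s
      using that a(2)[of s] b(2)[of s] by (cases s t rule: linorder_cases) auto
    then show ?thesis
      using a(1) b(1) by (intro exI[of _ "{a<..<b}"]) (auto intro!: bdd_aboveI[of _ "max (f t + 1) c"])
  qed
  then obtain U where U: "\<And>t. t \<in> {0..1} \<Longrightarrow> open (U t)" "\<And>t. t \<in> {0..1} \<Longrightarrow> t \<in> U t"
      "\<And>t. t \<in> {0..1} \<Longrightarrow> bdd_above (f ` (U t \<inter> {0..1}))"
    by metis
  have "compact {0..1::real}"
    by simp
  then obtain C where C: "C \<subseteq> {0..1}" "finite C" "{0..1} \<subseteq> (\<Union>t\<in>C. U t)"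
    by (rule compactE_image[of _ "{0..1}" U]) (use U in auto)
  have "bdd_above (\<Union>t\<in>C. f ` (U t \<inter> {0..1}))"
    using C U by (subst bdd_above_UN) auto
  then show ?thesis
    by (rule bdd_above_mono) (use C in blast)
qed

text \<open>By right continuity an excess over \<open>u\<close> is seen on some dyadic grid of
  \<open>{s..T}\<close>. The grid events increase, so measurability and Ottaviani's inequality pass
  to their union.\<close>

lemma levy_process_sup_le:
  assumes levy: "levy_process M X" and s: "0 \<le> s" "s < T"
    and p: "\<And>r. 0 \<le> r \<Longrightarrow> r \<le> T - s \<Longrightarrow> p \<le> measure (distr M borel (X r)) {- c..}"
  shows "{\<omega>\<in>space M. \<exists>t\<in>{s..T}. u < X t \<omega>} \<in> sets M"
    and "p * measure M {\<omega>\<in>space M. \<exists>t\<in>{s..T}. u < X t \<omega>} \<le> measure M {\<omega>\<in>space M. u - c < X T \<omega>}"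
proof -
  interpret prob_space M
    using levy by (simp add: levy_process_def)
  have X: "X t \<in> borel_measurable M" if "0 \<le> t" for t
    using levy that by (simp add: levy_process_def)
  have X0: "X 0 \<omega> = 0" if "\<omega> \<in> space M" for \<omega>
    using levy that by (simp add: levy_process_def)
  \<comment> \<open>The walk has to start at time 0, so index 0 is time 0 and the grid of
    \<open>{s..T}\<close> begins at index 1. This is why \<open>ottaviani\<close> has a starting
    index \<open>m\<close>.\<close>
  define g where "g N k = (if k = 0 then 0 else s + (T - s) * real (k - 1) / 2 ^ N)" for N k :: nat
  define E where "E N = {\<omega>\<in>space M. \<exists>k\<le>2 ^ N. u < X (s + (T - s) * real k / 2 ^ N) \<omega>}" for N :: nat
  have E_meas [measurable]: "E N \<in> sets M" for N
  proof -
    have "E N = (\<Union>k\<in>{..2 ^ N}. {\<omega>\<in>space M. u < X (s + (T - s) * real k / 2 ^ N) \<omega>})"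
      by (auto simp: E_def)
    also have "\<dots> \<in> sets M"
    proof (intro sets.finite_UN)
      fix k
      have [measurable]: "X (s + (T - s) * real k / 2 ^ N) \<in> borel_measurable M"
        using s by (intro X add_nonneg_nonneg divide_nonneg_nonneg mult_nonneg_nonneg) auto
      show "{\<omega>\<in>space M. u < X (s + (T - s) * real k / 2 ^ N) \<omega>} \<in> sets M"
        by measurable
    qed simp
    finally show ?thesis .
  qed
  have incr: "E N \<subseteq> E (Suc N)" for N
  proof
    fix \<omega> assume "\<omega> \<in> E N"
    then obtain k where k: "\<omega> \<in> space M" "k \<le> 2 ^ N" "u < X (s + (T - s) * real k / 2 ^ N) \<omega>"
      by (auto simp: E_def)
    moreover have "(T - s) * real (2 * k) / 2 ^ Suc N = (T - s) * real k / 2 ^ N"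
      by simp
    ultimately show "\<omega> \<in> E (Suc N)"
      unfolding E_def by (intro CollectI conjI exI[of _ "2 * k"]) (simp_all only: power_Suc mult_le_mono2)
  qed
  have E_eq: "{\<omega>\<in>space M. \<exists>t\<in>{s..T}. u < X t \<omega>} = (\<Union>N. E N)"
  proof (intro set_eqI iffI)
    fix \<omega> assume "\<omega> \<in> {\<omega>\<in>space M. \<exists>t\<in>{s..T}. u < X t \<omega>}"
    then obtain t where \<omega>: "\<omega> \<in> space M" and t: "s \<le> t" "t \<le> T" "u < X t \<omega>"
      by auto
    show "\<omega> \<in> (\<Union>N. E N)"
    proof (cases "t = T")
      case True
      then have "\<omega> \<in> E 0"
        using \<omega> t by (auto simp: E_def intro!: exI[of _ 1])
      then show ?thesis
        by auto
    next
      case False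
      have "continuous (at_right t) (\<lambda>s. X s \<omega>)"
        using levy \<omega> s t by (auto simp: levy_process_def)
      then have "\<forall>\<^sub>F r in at_right t. u < X r \<omega>"
        using t by (intro order_tendstoD(1)[of _ "X t \<omega>"]) (auto simp: continuous_within)
      then obtain b where b: "t < b" "\<And>r. t < r \<Longrightarrow> r < b \<Longrightarrow> u < X r \<omega>"
        unfolding eventually_at_right_field by auto
      define b' where "b' = min b T"
      have b': "t < b'" "b' \<le> T" "b' \<le> b"
        using b t False by (auto simp: b'_def)
      obtain N :: nat where N: "(T - s) / (b' - t) < 2 ^ N"
        using real_arch_pow[of 2 "(T - s) / (b' - t)"] by auto
      define d where "d = (T - s) / 2 ^ N"
      have d: "0 < d" "d < b' - t"
        using N s b' by (auto simp: d_def field_simps)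
      \<comment> \<open>The first grid point strictly to the right of \<open>t\<close>. It lies
        within \<open>d\<close> of \<open>t\<close>, hence before \<open>b'\<close>, where the path
        is still above \<open>u\<close>.\<close>
      define k where "k = nat (\<lfloor>(t - s) / d\<rfloor> + 1)"
      have fl: "of_int \<lfloor>(t - s) / d\<rfloor> \<le> (t - s) / d" "(t - s) / d < of_int \<lfloor>(t - s) / d\<rfloor> + 1"
        by linarith+
      have "0 \<le> \<lfloor>(t - s) / d\<rfloor>"
        using t d by simp
      then have kr: "real k = of_int \<lfloor>(t - s) / d\<rfloor> + 1"
        unfolding k_def by simp
      have k1: "t < s + d * real k"
        using mult_strict_left_mono[OF fl(2) d(1)] d unfolding kr by (simp add: distrib_left)
      have k2: "s + d * real k \<le> t + d"
        using mult_left_mono[OF fl(1) less_imp_le[OF d(1)]] d unfolding kr by (simp add: distrib_left)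
      have "d * real k < d * 2 ^ N"
        using k2 d b' by (simp add: d_def)
      then have "real k < real (2 ^ N)"
        using d by simp
      then have k3: "k \<le> 2 ^ N"
        by linarith
      have "u < X (s + d * real k) \<omega>"
        using k1 k2 d b' by (intro b(2)) auto
      moreover have "s + d * real k = s + (T - s) * real k / 2 ^ N"
        by (simp add: d_def)
      ultimately have "\<omega> \<in> E N"
        unfolding E_def using \<omega> k3 by auto
      then show ?thesis
        by auto
    qed
  next
    fix \<omega> assume "\<omega> \<in> (\<Union>N. E N)"
    then obtain N k where k: "\<omega> \<in> space M" "k \<le> 2 ^ N" "u < X (s + (T - s) * real k / 2 ^ N) \<omega>"
      by (auto simp: E_def)
    have "real k \<le> real (2 ^ N)"
      using k(2) by (rule of_nat_mono)
    then have "(T - s) * real k / 2 ^ N \<le> T - s"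
      using s mult_left_mono[of "real k / 2 ^ N" 1 "T - s"] by simp
    then show "\<omega> \<in> {\<omega>\<in>space M. \<exists>t\<in>{s..T}. u < X t \<omega>}"
      using k s by (intro CollectI conjI bexI[of _ "s + (T - s) * real k / 2 ^ N"]) auto
  qed
  show "{\<omega>\<in>space M. \<exists>t\<in>{s..T}. u < X t \<omega>} \<in> sets M"
    unfolding E_eq by measurable
  have E_le: "p * prob (E N) \<le> prob {\<omega>\<in>space M. u - c < X T \<omega>}" for N
  proof -
    have main: "p * prob {\<omega>\<in>space M. \<exists>k. m \<le> k \<and> k \<le> n \<and> u < X (h k) \<omega>} \<le> prob {\<omega>\<in>space M. u - c < X T \<omega>}"
      if h: "h 0 = 0" "\<And>i. h i < h (Suc i)" "h m = s" "h n = T" for h :: "nat \<Rightarrow> real" and m n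
      unfolding h(4)[symmetric]
    proof (rule ottaviani)
      have mono: "h i \<le> h j" if "i \<le> j" for i j
        by (rule lift_Suc_mono_le[of h, OF less_imp_le[OF h(2)] that])
      show "indep_vars (\<lambda>_. borel) (\<lambda>i \<omega>. X (h (Suc i)) \<omega> - X (h i) \<omega>) {..<n}"
        using levy h by (auto simp: levy_process_def)
      show "X (h 0) \<omega> = 0" if "\<omega> \<in> space M" for \<omega>
        using X0[OF that] h by simp
      show "X (h k) \<in> borel_measurable M" for k
        using mono[of 0 k] h by (intro X) simp
      show "p \<le> prob {\<omega>\<in>space M. - c \<le> X (h n) \<omega> - X (h k) \<omega>}" if k: "m \<le> k" "k \<le> n" for k
      proof -
        have hk: "s \<le> h k" "h k \<le> T"
          using mono[of m k] mono[of k n] k h by auto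
        have [measurable]: "X (h k) \<in> borel_measurable M" "X T \<in> borel_measurable M" "X (T - h k) \<in> borel_measurable M"
          using s hk by (auto intro!: X)
        have "distr M borel (\<lambda>\<omega>. X (h k + (T - h k)) \<omega> - X (h k) \<omega>) = distr M borel (X (T - h k))"
          using levy hk s unfolding levy_process_def by (metis diff_ge_0_iff_ge order_trans)
        then have d: "distr M borel (\<lambda>\<omega>. X T \<omega> - X (h k) \<omega>) = distr M borel (X (T - h k))"
          by simp
        have "p \<le> measure (distr M borel (X (T - h k))) {- c..}"
          using hk by (intro p) auto
        also have "\<dots> = measure (distr M borel (\<lambda>\<omega>. X T \<omega> - X (h k) \<omega>)) {- c..}"
          by (simp only: d)
        also have "\<dots> = prob {\<omega>\<in>space M. - c \<le> X (h n) \<omega> - X (h k) \<omega>}"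
          by (subst measure_distr) (auto intro!: arg_cong[where f=prob] simp: h)
        finally show ?thesis .
      qed
    qed
    show ?thesis
    \<comment> \<open>For \<open>s = 0\<close> the times \<open>g N 0\<close> and
      \<open>g N 1\<close> would coincide, while the increments require strictly increasing times;
      the grid itself is then used.\<close>
    proof (cases "s = 0")
      case False
      define n where "n = Suc (2 ^ N)"
      have "{\<omega>\<in>space M. \<exists>k. 1 \<le> k \<and> k \<le> n \<and> u < X (g N k) \<omega>} = E N"
      proof (intro set_eqI iffI)
        fix \<omega> assume "\<omega> \<in> E N"
        then obtain k where "\<omega> \<in> space M" "k \<le> 2 ^ N" "u < X (s + (T - s) * real k / 2 ^ N) \<omega>"
          by (auto simp: E_def)
        then show "\<omega> \<in> {\<omega>\<in>space M. \<exists>k. 1 \<le> k \<and> k \<le> n \<and> u < X (g N k) \<omega>}"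
          by (auto simp: g_def n_def intro!: exI[of _ "Suc k"])
      next
        fix \<omega> assume "\<omega> \<in> {\<omega>\<in>space M. \<exists>k. 1 \<le> k \<and> k \<le> n \<and> u < X (g N k) \<omega>}"
        then obtain k where "\<omega> \<in> space M" "1 \<le> k" "k \<le> n" "u < X (g N k) \<omega>"
          by auto
        then show "\<omega> \<in> E N"
          by (auto simp: g_def n_def E_def intro!: exI[of _ "k - 1"] split: if_splits)
      qed
      moreover have "g N i < g N (Suc i)" for i
        using s False by (cases i) (auto simp: g_def field_simps)
      moreover have "g N 0 = 0" "g N 1 = s" "g N n = T"
        using s by (auto simp: g_def n_def)
      ultimately show ?thesis
        using main[of "g N" 1 n] by simp
    next
      case True
      define h where "h k = T * real k / 2 ^ N" for k :: nat
      have "h 0 = s" "\<And>i. h i < h (Suc i)" "h (2 ^ N) = T"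
        using s True by (auto simp: h_def field_simps)
      moreover have "{\<omega>\<in>space M. \<exists>k. 0 \<le> k \<and> k \<le> 2 ^ N \<and> u < X (h k) \<omega>} = E N"
        using True by (auto simp: E_def h_def)
      ultimately show ?thesis
        using main[of h 0 "2 ^ N"] True by simp
    qed
  qed
  have "(\<lambda>N. p * prob (E N)) \<longlonglongrightarrow> p * prob (\<Union>N. E N)"
    by (intro tendsto_mult_left finite_Lim_measure_incseq) (auto intro!: incseq_SucI incr)
  then show "p * prob {\<omega>\<in>space M. \<exists>t\<in>{s..T}. u < X t \<omega>} \<le> prob {\<omega>\<in>space M. u - c < X T \<omega>}"
    unfolding E_eq by (rule LIMSEQ_le_const2) (use E_le in auto)
qed

section \<open>Superexponential jump tails\<close>

text \<open>Here \<open>h\<close> is monotone on the whole line, which makes \<open>H\<close> convex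
  everywhere; the theorem supplies this by a constant extension to the left of 0. The assumption
  \<open>h_growth\<close> is the growth hypothesis for \<open>c = 2\<close>, with
  \<open>2 / 8 = 1 / 4\<close>.\<close>

locale superexponential_tail =
  fixes \<rho> :: "real measure" and h H :: "real \<Rightarrow> real" and b K :: real
  assumes levy: "levy_measure \<rho>" and b_ge: "1 \<le> b" and K_pos: "0 < K"
    and tail: "\<And>x. b \<le> x \<Longrightarrow> measure \<rho> {x<..} = K * exp (- H x)"
    and h_pos: "\<And>x. 0 < h x" and h_cont: "continuous_on UNIV h" and h_mono: "mono h"
    and h_lim: "filterlim h at_top at_top"
    and h_growth: "\<forall>\<^sub>F v in at_top. h (v + 2) \<le> exp (h v / 4)"
    and H_deriv: "\<And>x. (H has_real_derivative h x) (at x)" and H_0: "H 0 = 0"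
begin

section \<open>Convexity of \<open>H\<close> and the density of the large jumps\<close>

lemma sets_rho [simp, measurable_cong]: "sets \<rho> = sets borel"
  using levy by (simp add: levy_measure_def)

lemma h_measurable [measurable]: "h \<in> borel_measurable borel"
  using h_cont by (rule borel_measurable_continuous_onI)

lemma H_cont: "continuous_on UNIV H"
  using H_deriv by (meson DERIV_isCont continuous_at_imp_continuous_on)

lemma H_measurable [measurable]: "H \<in> borel_measurable borel"
  using H_cont by (rule borel_measurable_continuous_onI)

text \<open>Convexity in tangent form, from the mean value theorem and monotonicity of
  \<open>h\<close>. The later estimates on \<open>H\<close> rest on it.\<close>

lemma H_tangent: "H x + h x * (y - x) \<le> H y"
proof (cases x y rule: linorder_cases)
  case less
  from MVT2[OF less H_deriv] obtain z where z: "x < z" "z < y" "H y - H x = (y - x) * h z"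
    by auto
  have "(y - x) * h x \<le> (y - x) * h z"
    using less z h_mono by (intro mult_left_mono) (auto simp: mono_def)
  then have "h x * (y - x) \<le> H y - H x"
    unfolding z(3) by (simp only: mult.commute)
  then show ?thesis
    by simp
next
  case greater
  from MVT2[OF greater H_deriv] obtain z where z: "y < z" "z < x" "H x - H y = (x - y) * h z"
    by auto
  have "(x - y) * h z \<le> (x - y) * h x"
    using greater z h_mono by (intro mult_left_mono) (auto simp: mono_def)
  then have "H x - H y \<le> - (h x * (y - x))"
    unfolding z(3) by (simp add: algebra_simps)
  then show ?thesis
    by simp
qed simp

text \<open>A tangent at a point where the slope is at least \<open>c + 1\<close> already outgrows
  \<open>c * x\<close>.\<close>

lemma H_superlinear: "filterlim (\<lambda>x. H x - c * x) at_top at_top"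
proof -
  have "\<forall>\<^sub>F x in at_top. c + 1 \<le> h x"
    using h_lim by (simp add: filterlim_at_top)
  then obtain x0 where x0: "c + 1 \<le> h x0"
    using eventually_happens'[OF trivial_limit_at_top_linorder] by blast
  define d where "d = H x0 - h x0 * x0"
  have "filterlim (\<lambda>x. d + x) at_top at_top"
    by (intro filterlim_tendsto_add_at_top[OF tendsto_const] filterlim_ident)
  then show ?thesis
  proof (rule filterlim_at_top_mono)
    show "\<forall>\<^sub>F x in at_top. d + x \<le> H x - c * x"
      using eventually_ge_at_top[of 0]
    proof eventually_elim
      case (elim x)
      have "(c + 1) * x \<le> h x0 * x"
        using x0 elim by (intro mult_right_mono)
      then show ?case
        using H_tangent[of x0 x] by (simp add: d_def algebra_simps)
    qed
  qed
qed

text \<open>The integrand is the exact derivative of \<open>- exp (\<theta> * x - H x)\<close>,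
  which tends to 0 because \<open>H\<close> is superlinear; the condition on \<open>\<theta>\<close>
  makes it nonnegative.\<close>

lemma nn_integral_tilted_hazard:
  assumes "\<theta> \<le> h c"
  shows "(\<integral>\<^sup>+x. ennreal ((h x - \<theta>) * exp (\<theta> * x - H x)) * indicator {c..} x \<partial>lborel) = ennreal (exp (\<theta> * c - H c))"
proof -
  have "(\<integral>\<^sup>+x. ennreal ((h x - \<theta>) * exp (\<theta> * x - H x)) * indicator {c..} x \<partial>lborel) = ennreal (0 - (- exp (\<theta> * c - H c)))"
  proof (rule nn_integral_FTC_atLeast)
    show "((\<lambda>x. - exp (\<theta> * x - H x)) has_real_derivative (h x - \<theta>) * exp (\<theta> * x - H x)) (at x)" for x
      by (auto intro!: derivative_eq_intros H_deriv simp: algebra_simps)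
    show "0 \<le> (h x - \<theta>) * exp (\<theta> * x - H x)" if "c \<le> x" for x
      using assms monoD[OF h_mono that] by simp
    have "filterlim (\<lambda>x. - (H x - \<theta> * x)) at_bot at_top"
      using H_superlinear[of \<theta>] by (simp add: filterlim_uminus_at_top)
    from filterlim_compose[OF exp_at_bot this]
    show "((\<lambda>x. - exp (\<theta> * x - H x)) \<longlongrightarrow> 0) at_top"
      using tendsto_minus by fastforce
  qed simp
  then show ?thesis
    by simp
qed

lemma emeasure_tail: "b \<le> x \<Longrightarrow> emeasure \<rho> {x<..} = ennreal (K * exp (- H x))"
proof -
  assume x: "b \<le> x"
  have "emeasure \<rho> {x<..} < \<infinity>"
    using x b_ge by (intro levy_measure_finite[OF levy, of _ 1]) auto
  then show ?thesis
    using tail[OF x] by (simp add: emeasure_eq_ennreal_measure)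
qed

text \<open>Minus the derivative of the tail \<open>K * exp (- H x)\<close>.\<close>

definition dens :: "real \<Rightarrow> real" where
  "dens x = K * h x * exp (- H x)"

lemma dens_measurable [measurable]: "dens \<in> borel_measurable borel"
  unfolding dens_def by measurable

lemma dens_pos: "0 < dens x"
  using K_pos h_pos by (simp add: dens_def)

lemma density_rho:
  "density \<rho> (indicator {b<..}) = density lborel (\<lambda>x. ennreal (dens x) * indicator {b<..} x)"
proof (rule measure_eqI_lessThan)
  have 1: "emeasure (density \<rho> (indicator {b<..})) {x<..} = ennreal (K * exp (- H (max b x)))" for x
  proof -
    have "emeasure (density \<rho> (indicator {b<..})) {x<..} = emeasure \<rho> {max b x<..}"
      by (subst emeasure_density) (auto simp: simp flip: nn_integral_indicator intro!: nn_integral_cong split: split_indicator)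
    then show ?thesis
      by (simp add: emeasure_tail)
  qed
  then show "emeasure (density \<rho> (indicator {b<..})) {x<..} < \<infinity>" for x
    by simp
  show "emeasure (density \<rho> (indicator {b<..})) {x<..} = emeasure (density lborel (\<lambda>x. ennreal (dens x) * indicator {b<..} x)) {x<..}" for x
  proof -
    have "emeasure (density lborel (\<lambda>x. ennreal (dens x) * indicator {b<..} x)) {x<..} =
        (\<integral>\<^sup>+y. ennreal (dens y) * indicator {b<..} y * indicator {x<..} y \<partial>lborel)"
      by (subst emeasure_density) auto
    also have "\<dots> = (\<integral>\<^sup>+y. ennreal K * (ennreal ((h y - 0) * exp (0 * y - H y)) * indicator {max b x..} y) \<partial>lborel)"
    proof (intro nn_integral_cong_AE)
      have "AE y in lborel. y \<noteq> max b x"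
        by (rule AE_lborel_singleton)
      then show "AE y in lborel. ennreal (dens y) * indicator {b<..} y * indicator {x<..} y =
          ennreal K * (ennreal ((h y - 0) * exp (0 * y - H y)) * indicator {max b x..} y)"
        by eventually_elim (use K_pos h_pos less_imp_le in \<open>auto split: split_indicator simp: dens_def mult.assoc ennreal_mult' max_def\<close>)
    qed
    also have "\<dots> = ennreal K * ennreal (exp (0 * max b x - H (max b x)))"
      using h_pos by (subst nn_integral_cmult) (auto simp: nn_integral_tilted_hazard[of 0, simplified] less_imp_le)
    also have "\<dots> = ennreal (K * exp (- H (max b x)))"
      using K_pos by (simp add: ennreal_mult')
    finally show ?thesis
      by (simp add: 1)
  qed
qed auto

lemma nn_integral_rho:
  assumes [measurable]: "f \<in> borel_measurable borel" "S \<in> sets borel" and S: "S \<subseteq> {b<..}"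
  shows "(\<integral>\<^sup>+x. f x * indicator S x \<partial>\<rho>) = (\<integral>\<^sup>+x. f x * ennreal (dens x) * indicator S x \<partial>lborel)"
proof -
  have "(\<integral>\<^sup>+x. f x * indicator S x \<partial>\<rho>) = (\<integral>\<^sup>+x. indicator {b<..} x * (f x * indicator S x) \<partial>\<rho>)"
    using S by (intro nn_integral_cong) (auto split: split_indicator)
  also have "\<dots> = (\<integral>\<^sup>+x. f x * indicator S x \<partial>density \<rho> (indicator {b<..}))"
    by (subst nn_integral_density) auto
  also have "\<dots> = (\<integral>\<^sup>+x. (ennreal (dens x) * indicator {b<..} x) * (f x * indicator S x) \<partial>lborel)"
    unfolding density_rho by (subst nn_integral_density) auto
  also have "\<dots> = (\<integral>\<^sup>+x. f x * ennreal (dens x) * indicator S x \<partial>lborel)"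
    using S by (intro nn_integral_cong) (auto split: split_indicator simp: ac_simps)
  finally show ?thesis .
qed

text \<open>Where \<open>\<theta>' \<le> h x\<close>, one has \<open>h x \<le> \<theta>' /
  (\<theta>' - \<theta>) * (h x - \<theta>)\<close>. The tilted density is thus dominated by a
  multiple of the integrand in \<open>nn_integral_tilted_hazard\<close>, which integrates
  exactly.\<close>

lemma tilted_tail_le:
  assumes c: "b \<le> c" and \<theta>: "\<theta> < \<theta>'" "0 \<le> \<theta>" "\<theta>' \<le> h c"
  shows "(\<integral>\<^sup>+x. ennreal (exp (\<theta> * x)) * indicator {c<..} x \<partial>\<rho>) \<le> ennreal (K * exp (\<theta> * c - H c) * (\<theta>' / (\<theta>' - \<theta>)))"
proof -
  define r where "r = \<theta>' / (\<theta>' - \<theta>)"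
  have r: "0 < r"
    using \<theta> by (simp add: r_def)
  have "(\<integral>\<^sup>+x. ennreal (exp (\<theta> * x)) * indicator {c<..} x \<partial>\<rho>) =
      (\<integral>\<^sup>+x. ennreal (exp (\<theta> * x)) * ennreal (dens x) * indicator {c<..} x \<partial>lborel)"
    using c by (intro nn_integral_rho) auto
  also have "\<dots> \<le> (\<integral>\<^sup>+x. ennreal (K * r) * (ennreal ((h x - \<theta>) * exp (\<theta> * x - H x)) * indicator {c..} x) \<partial>lborel)"
  proof (intro nn_integral_mono)
    fix x
    show "ennreal (exp (\<theta> * x)) * ennreal (dens x) * indicator {c<..} x \<le>
        ennreal (K * r) * (ennreal ((h x - \<theta>) * exp (\<theta> * x - H x)) * indicator {c..} x)"
    proof (cases "c < x")
      case True
      then have hx: "\<theta>' \<le> h x"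
        using \<theta> monoD[OF h_mono, of c x] by auto
      have "\<theta> * \<theta>' \<le> \<theta> * h x"
        using hx \<theta> by (intro mult_left_mono)
      then have "h x * (\<theta>' - \<theta>) \<le> \<theta>' * (h x - \<theta>)"
        by (simp add: algebra_simps)
      then have "h x \<le> r * (h x - \<theta>)"
        using \<theta> by (simp add: r_def field_simps)
      then have "exp (\<theta> * x) * dens x \<le> K * r * ((h x - \<theta>) * exp (\<theta> * x - H x))"
        using K_pos mult_left_mono[of "h x" "r * (h x - \<theta>)" "K * exp (\<theta> * x - H x)"]
        by (simp add: dens_def exp_diff exp_minus divide_inverse ac_simps)
      then show ?thesis
        using True dens_pos[of x] r K_pos hx \<theta> by (auto simp: ennreal_leI less_imp_le simp flip: ennreal_mult)
    qed simp
  qed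
  also have "\<dots> = ennreal (K * r) * ennreal (exp (\<theta> * c - H c))"
    using \<theta> by (subst nn_integral_cmult) (auto simp: nn_integral_tilted_hazard)
  also have "\<dots> = ennreal (K * exp (\<theta> * c - H c) * (\<theta>' / (\<theta>' - \<theta>)))"
    unfolding r_def[symmetric] using K_pos r by (simp add: ac_simps flip: ennreal_mult)
  finally show ?thesis .
qed

text \<open>The power is absorbed by tilting one unit further,
  \<open>x ^ j \<le> fact j * exp x\<close>, and beyond the point where \<open>h\<close> reaches
  \<open>\<theta> + 2\<close> the tail bound applies.\<close>

lemma integrable_tilted:
  fixes j :: nat
  assumes "0 \<le> \<theta>"
  shows "integrable \<rho> (\<lambda>x. indicator {b<..} x *\<^sub>R (x ^ j * exp (\<theta> * x)))"
proof (rule Bochner_Integration.integrable_bound)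
  have "\<forall>\<^sub>F x in at_top. \<theta> + 2 \<le> h x \<and> b \<le> x"
    using h_lim unfolding filterlim_at_top by (intro eventually_conj eventually_ge_at_top) blast
  then obtain c where c: "\<theta> + 2 \<le> h c" "b \<le> c"
    using eventually_happens'[OF trivial_limit_at_top_linorder] by blast
  show "integrable \<rho> (\<lambda>x. fact j * (indicator {b<..} x *\<^sub>R exp ((\<theta> + 1) * x)))"
  proof (rule integrable_mult_right, rule integrableI_bounded)
    have "(\<integral>\<^sup>+x. norm (indicator {b<..} x *\<^sub>R exp ((\<theta> + 1) * x)) \<partial>\<rho>) \<le>
        (\<integral>\<^sup>+x. ennreal (exp ((\<theta> + 1) * c)) * indicator {b<..} x + ennreal (exp ((\<theta> + 1) * x)) * indicator {c<..} x \<partial>\<rho>)"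
      using assms by (intro nn_integral_mono) (auto split: split_indicator simp: ennreal_leI mult_left_mono)
    also have "\<dots> = ennreal (exp ((\<theta> + 1) * c)) * emeasure \<rho> {b<..} + (\<integral>\<^sup>+x. ennreal (exp ((\<theta> + 1) * x)) * indicator {c<..} x \<partial>\<rho>)"
      by (subst nn_integral_add) (auto simp: nn_integral_cmult_indicator)
    also have "\<dots> \<le> ennreal (exp ((\<theta> + 1) * c)) * ennreal (K * exp (- H b)) + ennreal (K * exp ((\<theta> + 1) * c - H c) * ((\<theta> + 2) / ((\<theta> + 2) - (\<theta> + 1))))"
      using assms c by (intro add_mono tilted_tail_le) (auto simp: emeasure_tail)
    also have "\<dots> < \<infinity>"
      by (simp add: ennreal_mult_less_top)
    finally show "(\<integral>\<^sup>+x. norm (indicator {b<..} x *\<^sub>R exp ((\<theta> + 1) * x)) \<partial>\<rho>) < \<infinity>" .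
  qed simp
  show "AE x in \<rho>. norm (indicator {b<..} x *\<^sub>R (x ^ j * exp (\<theta> * x))) \<le> norm (fact j * (indicator {b<..} x *\<^sub>R exp ((\<theta> + 1) * x)))"
  proof (rule AE_I2)
    fix x
    show "norm (indicator {b<..} x *\<^sub>R (x ^ j * exp (\<theta> * x))) \<le> norm (fact j * (indicator {b<..} x *\<^sub>R exp ((\<theta> + 1) * x)) :: real)"
    proof (cases "b < x")
      case True
      then have x: "0 \<le> x"
        using b_ge by simp
      have "(\<Sum>i\<in>{j}. x ^ i /\<^sub>R fact i) \<le> exp x"
        using x unfolding exp_def by (intro sum_le_suminf summable_exp_generic) auto
      then have "x ^ j \<le> fact j * exp x"
        by (simp add: field_simps)
      then have "x ^ j * exp (\<theta> * x) \<le> (fact j * exp x) * exp (\<theta> * x)"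
        by (rule mult_right_mono) simp
      also have "\<dots> = fact j * exp ((\<theta> + 1) * x)"
        by (simp add: distrib_right exp_add)
      finally show ?thesis
        using True x by simp
    qed simp
  qed
qed simp

text \<open>Under the tilted law the jumps above \<open>b\<close> are Poissonian with intensity
  \<open>exp (\<theta> * x) \<rho>(dx)\<close>. So \<open>mom 0\<close> is the mean number of jumps,
  while \<open>mom 1\<close> and \<open>mom 2\<close> are the mean and the variance of their
  sum.\<close>

definition mom :: "nat \<Rightarrow> real \<Rightarrow> real" where
  "mom j \<theta> = (\<integral>x. indicator {b<..} x *\<^sub>R (x ^ j * exp (\<theta> * x)) \<partial>\<rho>)"

lemma mom_0_nn_integral:
  assumes "0 \<le> \<theta>"
  shows "(\<integral>\<^sup>+x. ennreal (exp (\<theta> * x)) * indicator {b<..} x \<partial>\<rho>) = ennreal (mom 0 \<theta>)"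
proof -
  have "(\<integral>\<^sup>+x. ennreal (exp (\<theta> * x)) * indicator {b<..} x \<partial>\<rho>) = (\<integral>\<^sup>+x. ennreal (indicator {b<..} x *\<^sub>R (x ^ 0 * exp (\<theta> * x))) \<partial>\<rho>)"
    by (intro nn_integral_cong) (auto split: split_indicator)
  also have "\<dots> = ennreal (mom 0 \<theta>)"
    unfolding mom_def using integrable_tilted[OF assms, of 0] by (intro nn_integral_eq_integral) auto
  finally show ?thesis .
qed

lemma mom_nonneg: "0 \<le> mom j \<theta>"
  unfolding mom_def using b_ge by (intro integral_nonneg_AE AE_I2) (auto split: split_indicator)

text \<open>Dominated convergence along sequences. It makes \<open>U\<close> continuous, so that
  every large level is of the form \<open>U \<theta>\<close>.\<close>

lemma mom_cont: "continuous_on {0..} (mom j)"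
proof (unfold continuous_on_sequentially, intro allI ballI impI, elim conjE)
  fix \<theta> and s :: "nat \<Rightarrow> real"
  assume \<theta>: "\<theta> \<in> {0..}" and s: "\<forall>n. s n \<in> {0..}" "s \<longlonglongrightarrow> \<theta>"
  have "Bseq s"
    using s(2) by (intro convergent_imp_Bseq convergentI)
  then obtain B where B: "\<And>n. norm (s n) \<le> B" "0 < B"
    by (metis BseqE)
  show "(mom j \<circ> s) \<longlonglongrightarrow> mom j \<theta>"
    unfolding mom_def comp_def
  proof (rule integral_dominated_convergence[where w="\<lambda>x. indicator {b<..} x *\<^sub>R (x ^ j * exp (B * x))"])
    show "AE x in \<rho>. norm (indicator {b<..} x *\<^sub>R (x ^ j * exp (s n * x))) \<le> indicator {b<..} x *\<^sub>R (x ^ j * exp (B * x))" for n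
      using B(1)[of n] b_ge
      by (intro AE_I2) (auto split: split_indicator simp: abs_mult intro!: mult_left_mono mult_right_mono)
    show "AE x in \<rho>. (\<lambda>n. indicator {b<..} x *\<^sub>R (x ^ j * exp (s n * x))) \<longlonglongrightarrow> indicator {b<..} x *\<^sub>R (x ^ j * exp (\<theta> * x))"
      by (intro AE_I2 tendsto_intros s)
  qed (use B integrable_tilted in auto)
qed

lemma mom_0_ge:
  assumes "0 \<le> \<theta>" "b \<le> x"
  shows "K * exp (\<theta> * x - H x) \<le> mom 0 \<theta>"
proof -
  have "ennreal (K * exp (\<theta> * x - H x)) = ennreal (exp (\<theta> * x)) * emeasure \<rho> {x<..}"
    using assms(2) K_pos by (simp add: emeasure_tail exp_diff exp_minus divide_inverse ac_simps flip: ennreal_mult)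
  also have "\<dots> = (\<integral>\<^sup>+y. ennreal (exp (\<theta> * x)) * indicator {x<..} y \<partial>\<rho>)"
    by (simp add: nn_integral_cmult_indicator)
  also have "\<dots> \<le> (\<integral>\<^sup>+y. ennreal (exp (\<theta> * y)) * indicator {b<..} y \<partial>\<rho>)"
    using assms by (intro nn_integral_mono) (auto split: split_indicator simp: ennreal_leI mult_left_mono)
  finally show ?thesis
    using assms(1) mom_nonneg by (simp add: mom_0_nn_integral)
qed

text \<open>Jumps beyond \<open>c + 1\<close> contribute at least a constant times
  \<open>exp ((c + 1) * \<theta>)\<close>, and the surplus \<open>exp \<theta>\<close> absorbs the
  constant.\<close>

lemma mom_0_superexponential: "\<forall>\<^sub>F \<theta> in at_top. exp (c * \<theta>) \<le> mom 0 \<theta>"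
proof -
  define x where "x = max b (c + 1)"
  have "\<forall>\<^sub>F \<theta> in at_top. 0 \<le> \<theta> + ln (K * exp (- H x))"
    using eventually_ge_at_top[of "- ln (K * exp (- H x))"] by eventually_elim simp
  then show ?thesis
    using eventually_ge_at_top[of 0]
  proof eventually_elim
    case (elim \<theta>)
    have "(c + 1) * \<theta> \<le> x * \<theta>"
      using elim by (intro mult_right_mono) (auto simp: x_def)
    then have "c * \<theta> \<le> x * \<theta> + ln (K * exp (- H x))"
      using elim by (simp add: algebra_simps)
    then have "exp (c * \<theta>) \<le> exp (x * \<theta> + ln (K * exp (- H x)))"
      by simp
    also have "\<dots> = K * exp (\<theta> * x - H x)"
      using K_pos by (simp add: exp_add exp_diff exp_minus divide_inverse ac_simps)
    also have "\<dots> \<le> mom 0 \<theta>"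
      using elim by (intro mom_0_ge) (auto simp: x_def)
    finally show ?case .
  qed
qed

text \<open>The witness lies one unit beyond the point where \<open>h\<close> equals \<open>2 \<theta>\<close>.\<close>

lemma upper_jump_bound:
  "\<forall>\<^sub>F \<theta> in at_top. \<exists>V\<ge>b. h (V + 1) \<le> exp (\<theta> / 2) \<and>
    (\<integral>\<^sup>+x. ennreal (exp (\<theta> * x)) * indicator {V<..} x \<partial>\<rho>) \<le> ennreal (mom 0 \<theta> / 2)"
proof -
  from h_growth obtain v where v: "\<And>x. v \<le> x \<Longrightarrow> h (x + 2) \<le> exp (h x / 4)"
    by (auto simp: eventually_at_top_linorder)
  define w where "w = max v b"
  have "\<forall>\<^sub>F \<theta> in at_top. h w \<le> 2 * \<theta> \<and> (4::real) \<le> exp (\<theta> / 2) \<and> 0 < \<theta>"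
    by (intro eventually_conj eventually_gt_at_top) real_asymp+
  then show ?thesis
  proof eventually_elim
    case (elim \<theta>)
    have "\<forall>\<^sub>F x in at_top. 2 * \<theta> \<le> h x \<and> w \<le> x"
      using h_lim unfolding filterlim_at_top by (intro eventually_conj eventually_ge_at_top) blast
    then obtain y where y: "2 * \<theta> \<le> h y" "w \<le> y"
      using eventually_happens'[OF trivial_limit_at_top_linorder] by blast
    from IVT'[of h w "2 * \<theta>" y] obtain V where V: "w \<le> V" "h V = 2 * \<theta>"
      using elim y h_cont by (auto intro: continuous_on_subset)
    have bV: "b \<le> V" "v \<le> V"
      using V by (auto simp: w_def)
    \<comment> \<open>The witness will be \<open>V + 1\<close>, so \<open>h\<close> is needed at
      \<open>V + 2\<close>; the growth condition bounds it by \<open>exp (h V / 4)\<close>, where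
      \<open>h V = 2 * \<theta>\<close>.\<close>
    have "h (V + 1 + 1) \<le> exp (\<theta> / 2)"
      using v[OF bV(2)] V by (simp add: algebra_simps)
    moreover have "(\<integral>\<^sup>+x. ennreal (exp (\<theta> * x)) * indicator {V + 1<..} x \<partial>\<rho>) \<le> ennreal (mom 0 \<theta> / 2)"
    proof -
      have hV: "2 * \<theta> \<le> h (V + 1)" "2 * \<theta> \<le> h (V + 1 / 2)"
        using V monoD[OF h_mono, of V "V + 1"] monoD[OF h_mono, of V "V + 1 / 2"] by auto
      have "(\<integral>\<^sup>+x. ennreal (exp (\<theta> * x)) * indicator {V + 1<..} x \<partial>\<rho>) \<le>
          ennreal (K * exp (\<theta> * (V + 1) - H (V + 1)) * (2 * \<theta> / (2 * \<theta> - \<theta>)))"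
        using elim hV bV by (intro tilted_tail_le) auto
      also have "K * exp (\<theta> * (V + 1) - H (V + 1)) * (2 * \<theta> / (2 * \<theta> - \<theta>)) = 2 * (K * exp (\<theta> * (V + 1) - H (V + 1)))"
        using elim by simp
      \<comment> \<open>From \<open>V + 1 / 2\<close> to \<open>V + 1\<close> the function
        \<open>\<theta> * x - H x\<close> falls with slope at most \<open>- \<theta>\<close>, hence
        by \<open>\<theta> / 2\<close>. The gain \<open>exp (- (\<theta> / 2)) \<le> 1 / 4\<close>
        turns the factor 2 into \<open>1 / 2\<close>.\<close>
      also have "\<dots> \<le> mom 0 \<theta> / 2"
      proof -
        have "2 * \<theta> * (1 / 2) \<le> h (V + 1 / 2) * (1 / 2)"
          using hV by (intro mult_right_mono) auto
        then have "\<theta> * (V + 1) - H (V + 1) \<le> - (\<theta> / 2) + (\<theta> * (V + 1 / 2) - H (V + 1 / 2))"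
          using H_tangent[of "V + 1 / 2" "V + 1"] by (simp add: algebra_simps)
        then have "exp (\<theta> * (V + 1) - H (V + 1)) \<le> exp (- (\<theta> / 2) + (\<theta> * (V + 1 / 2) - H (V + 1 / 2)))"
          by simp
        also have "\<dots> = exp (- (\<theta> / 2)) * exp (\<theta> * (V + 1 / 2) - H (V + 1 / 2))"
          by (rule exp_add)
        also have "\<dots> \<le> 1 / 4 * exp (\<theta> * (V + 1 / 2) - H (V + 1 / 2))"
          using elim by (intro mult_right_mono) (auto simp: exp_minus field_simps)
        finally have "K * exp (\<theta> * (V + 1) - H (V + 1)) \<le> K * (1 / 4 * exp (\<theta> * (V + 1 / 2) - H (V + 1 / 2)))"
          using K_pos by (intro mult_left_mono) auto
        moreover have "K * exp (\<theta> * (V + 1 / 2) - H (V + 1 / 2)) \<le> mom 0 \<theta>"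
          using elim bV by (intro mom_0_ge) auto
        ultimately show ?thesis
          by simp
      qed
      finally show ?thesis
        by (simp add: ennreal_leI)
    qed
    ultimately show ?case
      using bV by (intro exI[of _ "V + 1"]) auto
  qed
qed

text \<open>\<open>W\<close> is the point where \<open>H W = \<theta> W\<close>: up to \<open>W\<close>, a jump costs at most \<open>\<theta>\<close> per unit of length, and
  \<open>W\<close> bounds the typical size of a jump under the tilted measure.\<close>

lemma second_moment_bound:
  "\<exists>C>0. \<forall>\<^sub>F \<theta> in at_top. \<exists>W\<ge>b + 1. (\<forall>x\<in>{0..W}. H x \<le> \<theta> * x) \<and> W \<le> C * mom 0 \<theta> \<and>
    mom 2 \<theta> \<le> C * W\<^sup>2 * mom 0 \<theta>"
proof -
  define C1 where "C1 = (b + 1) / (K * h b)"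
  have C1: "0 < C1"
    using b_ge K_pos h_pos by (simp add: C1_def)
  define C where "C = max C1 (1 + 384 * K * C1)"
  have "\<forall>\<^sub>F \<theta> in at_top. H (b + 1) \<le> \<theta> * (b + 1) \<and> H 1 \<le> \<theta> / 2 \<and> 1 \<le> \<theta>"
    using b_ge by (intro eventually_conj eventually_ge_at_top) real_asymp+
  then have "\<forall>\<^sub>F \<theta> in at_top. \<exists>W\<ge>b + 1. (\<forall>x\<in>{0..W}. H x \<le> \<theta> * x) \<and> W \<le> C * mom 0 \<theta> \<and>
    mom 2 \<theta> \<le> C * W\<^sup>2 * mom 0 \<theta>"
  proof eventually_elim
    case (elim \<theta>)
    have "\<forall>\<^sub>F x in at_top. 0 \<le> H x - \<theta> * x \<and> b + 1 \<le> x"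
      using H_superlinear[of \<theta>] unfolding filterlim_at_top by (intro eventually_conj eventually_ge_at_top) blast
    then obtain y where y: "0 \<le> H y - \<theta> * y" "b + 1 \<le> y"
      using eventually_happens'[OF trivial_limit_at_top_linorder] by blast
    have "continuous_on {b + 1..y} (\<lambda>x. H x - \<theta> * x)"
      by (intro continuous_intros continuous_on_subset[OF H_cont]) auto
    from IVT'[of "\<lambda>x. H x - \<theta> * x" "b + 1" 0 y, OF _ _ _ this] obtain W where W: "b + 1 \<le> W" "H W = \<theta> * W"
      using elim y by auto
    have W2: "2 \<le> W"
      using W b_ge by simp
    \<comment> \<open>A convex function lies below its chord; the one from 0 to \<open>W\<close> has
      slope \<open>\<theta>\<close> because \<open>H 0 = 0\<close>.\<close>
    have Hx: "H x \<le> \<theta> * x" if x: "0 \<le> x" "x \<le> W" for x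
    proof -
      have "H x + h x * (0 - x) \<le> 0" "H x + h x * (W - x) \<le> \<theta> * W"
        using H_tangent[of x 0] H_tangent[of x W] W H_0 by auto
      then have "(H x + h x * (0 - x)) * (W - x) + (H x + h x * (W - x)) * x \<le> 0 * (W - x) + \<theta> * W * x"
        using x by (intro add_mono mult_right_mono) auto
      then have "W * H x \<le> W * (\<theta> * x)"
        by (simp add: algebra_simps)
      then show ?thesis
        using W2 by simp
    qed
    \<comment> \<open>Up to \<open>W\<close> one has
      \<open>exp (\<theta> * x - H x) \<ge> 1\<close>, so the tilted density on
      \<open>{b<..W}\<close> is at least \<open>K * h b\<close>.\<close>
    have L: "W \<le> C1 * mom 0 \<theta>"
    proof -
      have "ennreal (K * h b * (W - b)) = (\<integral>\<^sup>+x. ennreal (K * h b) * indicator {b<..W} x \<partial>lborel)"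
        using W K_pos h_pos[of b] by (simp add: nn_integral_cmult_indicator flip: ennreal_mult)
      also have "\<dots> \<le> (\<integral>\<^sup>+x. ennreal (exp (\<theta> * x)) * ennreal (dens x) * indicator {b<..} x \<partial>lborel)"
      proof (intro nn_integral_mono)
        fix x
        show "ennreal (K * h b) * indicator {b<..W} x \<le> ennreal (exp (\<theta> * x)) * ennreal (dens x) * indicator {b<..} x"
        proof (cases "x \<in> {b<..W}")
          case True
          then have "1 * h b \<le> exp (\<theta> * x - H x) * h x"
            using Hx[of x] b_ge monoD[OF h_mono, of b x] h_pos[of b] by (intro mult_mono) auto
          then have "K * h b \<le> exp (\<theta> * x) * dens x"
            using K_pos by (simp add: dens_def exp_diff exp_minus divide_inverse ac_simps)
          then show ?thesis
            using True dens_pos[of x] by (simp add: ennreal_leI flip: ennreal_mult)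
        qed simp
      qed
      also have "\<dots> = ennreal (mom 0 \<theta>)"
        using elim by (subst nn_integral_rho[symmetric]) (auto simp: mom_0_nn_integral)
      finally have 1: "K * h b * (W - b) \<le> mom 0 \<theta>"
        using mom_nonneg by simp
      have "W \<le> (b + 1) * (W - b)"
        using W b_ge mult_left_mono[of 1 "W - b" b] by (simp add: algebra_simps)
      also have "\<dots> = C1 * (K * h b * (W - b))"
        using K_pos h_pos[of b] by (simp add: C1_def)
      also have "\<dots> \<le> C1 * mom 0 \<theta>"
        using 1 C1 by (intro mult_left_mono) auto
      finally show ?thesis .
    qed
    have M2: "mom 2 \<theta> \<le> (1 + 384 * K * C1) * W\<^sup>2 * mom 0 \<theta>"
    proof -
      \<comment> \<open>Beyond \<open>W\<close>, the factor \<open>x\<^sup>2\<close> is absorbed by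
        raising the tilt to \<open>\<theta>\<^sub>1\<close>. The tail bound then asks for a slope
        \<open>\<theta>\<^sub>2 > \<theta>\<^sub>1\<close> not exceeding \<open>h W\<close>, which
        the tangent at \<open>W\<close>, compared with \<open>H 1\<close>, provides. Both increments
        are of relative size \<open>1 / W\<close>, so the ratio in the tail bound is of order
        \<open>W\<close>.\<close>
      define \<theta>\<^sub>1 where "\<theta>\<^sub>1 = \<theta> + 1 / (4 * W)"
      define \<theta>\<^sub>2 where "\<theta>\<^sub>2 = \<theta> + \<theta> / (2 * W)"
      have "h W * (W - 1) \<ge> \<theta> * W - H 1"
        using H_tangent[of W 1] W by (simp add: algebra_simps)
      then have "\<theta> * W - \<theta> / 2 \<le> h W * (W - 1)"
        using elim by linarith
      moreover have "\<theta>\<^sub>2 * (W - 1) \<le> \<theta> * W - \<theta> / 2"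
        using elim W2 by (simp add: \<theta>\<^sub>2_def field_simps)
      ultimately have "\<theta>\<^sub>2 * (W - 1) \<le> h W * (W - 1)"
        by linarith
      then have hW: "\<theta>\<^sub>2 \<le> h W"
        using W2 by simp
      have "1 * 2 \<le> \<theta> * (2::real)"
        using elim by (intro mult_right_mono) auto
      then have \<theta>12: "\<theta>\<^sub>1 < \<theta>\<^sub>2" "0 \<le> \<theta>\<^sub>1"
        using elim W2 by (auto simp: \<theta>\<^sub>1_def \<theta>\<^sub>2_def field_simps)
      have r: "\<theta>\<^sub>2 / (\<theta>\<^sub>2 - \<theta>\<^sub>1) \<le> 6 * W"
      proof -
        have "\<theta>\<^sub>2 - \<theta>\<^sub>1 = (2 * \<theta> - 1) / (4 * W)"
          using W2 by (simp add: \<theta>\<^sub>1_def \<theta>\<^sub>2_def field_simps)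
        moreover have "\<theta>\<^sub>2 \<le> \<theta> * (5 / 4)"
          using W2 elim by (simp add: \<theta>\<^sub>2_def field_simps)
        moreover have "6 * W * ((2 * \<theta> - 1) / (4 * W)) = 3 * \<theta> - 3 / 2"
          using W2 by (simp add: field_simps)
        ultimately have "\<theta>\<^sub>2 \<le> 6 * W * (\<theta>\<^sub>2 - \<theta>\<^sub>1)"
          using elim by simp
        then show ?thesis
          using \<theta>12 by (simp add: field_simps)
      qed
      have "ennreal (mom 2 \<theta>) = (\<integral>\<^sup>+x. ennreal (indicator {b<..} x *\<^sub>R (x ^ 2 * exp (\<theta> * x))) \<partial>\<rho>)"
        unfolding mom_def using integrable_tilted[of \<theta> 2] elim b_ge
        by (intro nn_integral_eq_integral[symmetric]) auto
      also have "\<dots> \<le> (\<integral>\<^sup>+x. ennreal (W\<^sup>2) * (ennreal (exp (\<theta> * x)) * indicator {b<..} x) +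
          ennreal (64 * W\<^sup>2 * exp (- (1 / 4))) * (ennreal (exp (\<theta>\<^sub>1 * x)) * indicator {W<..} x) \<partial>\<rho>)"
      proof (intro nn_integral_mono)
        fix x
        show "ennreal (indicator {b<..} x *\<^sub>R (x ^ 2 * exp (\<theta> * x))) \<le> ennreal (W\<^sup>2) * (ennreal (exp (\<theta> * x)) * indicator {b<..} x) +
          ennreal (64 * W\<^sup>2 * exp (- (1 / 4))) * (ennreal (exp (\<theta>\<^sub>1 * x)) * indicator {W<..} x)"
        proof (cases "b < x")
          case True
          show ?thesis
          proof (cases "x \<le> W")
            case xW: True
            then have "x\<^sup>2 * exp (\<theta> * x) \<le> W\<^sup>2 * exp (\<theta> * x)"
              using True b_ge by (intro mult_right_mono power_mono) auto
            then show ?thesis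
              using True xW by (simp add: ennreal_leI flip: ennreal_mult)
          next
            case xW: False
            define s where "s = (x - W) / W"
            have s: "0 \<le> s" "x = W * (1 + s)"
              using xW W2 by (auto simp: s_def field_simps)
            \<comment> \<open>Squaring gives \<open>64 * exp (s / 4)\<close>, and
              \<open>s / 4\<close> is exactly what the step from \<open>\<theta>\<close> to
              \<open>\<theta>\<^sub>1\<close> pays for. The constant 384 is this 64 times the 6 of
              the ratio bound.\<close>
            have "1 + s \<le> 8 * exp (s / 8)"
              using exp_ge_add_one_self[of "s / 8"] s by linarith
            then have "(1 + s)\<^sup>2 \<le> (8 * exp (s / 8))\<^sup>2"
              using s by (intro power_mono) auto
            also have "\<dots> = 64 * exp (s / 4)"
              by (simp add: power_mult_distrib flip: exp_double)
            finally have "W\<^sup>2 * (1 + s)\<^sup>2 * exp (\<theta> * x) \<le> W\<^sup>2 * (64 * exp (s / 4)) * exp (\<theta> * x)"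
              by (intro mult_left_mono mult_right_mono) auto
            also have "\<dots> = 64 * W\<^sup>2 * (exp (s / 4) * exp (\<theta> * x))"
              by simp
            also have "exp (s / 4) * exp (\<theta> * x) = exp (- (1 / 4)) * exp (\<theta>\<^sub>1 * x)"
            proof -
              have "s / 4 + \<theta> * x = - (1 / 4) + \<theta>\<^sub>1 * x"
                using W2 by (simp add: s_def \<theta>\<^sub>1_def field_simps)
              then show ?thesis
                by (simp only: flip: exp_add)
            qed
            finally have "x\<^sup>2 * exp (\<theta> * x) \<le> 64 * W\<^sup>2 * exp (- (1 / 4)) * exp (\<theta>\<^sub>1 * x)"
              using s by (simp add: power_mult_distrib)
            then have "x\<^sup>2 * exp (\<theta> * x) \<le> W\<^sup>2 * exp (\<theta> * x) + 64 * W\<^sup>2 * exp (- (1 / 4)) * exp (\<theta>\<^sub>1 * x)"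
              by (rule add_increasing[rotated]) simp
            then show ?thesis
              using True xW by (simp add: ennreal_leI flip: ennreal_mult ennreal_plus)
          qed
        qed simp
      qed
      also have "\<dots> = ennreal (W\<^sup>2) * ennreal (mom 0 \<theta>) +
          ennreal (64 * W\<^sup>2 * exp (- (1 / 4))) * (\<integral>\<^sup>+x. ennreal (exp (\<theta>\<^sub>1 * x)) * indicator {W<..} x \<partial>\<rho>)"
        using elim by (subst nn_integral_add) (auto simp: nn_integral_cmult mom_0_nn_integral)
      also have "\<dots> \<le> ennreal (W\<^sup>2) * ennreal (mom 0 \<theta>) +
          ennreal (64 * W\<^sup>2 * exp (- (1 / 4))) * ennreal (K * exp (\<theta>\<^sub>1 * W - H W) * (\<theta>\<^sub>2 / (\<theta>\<^sub>2 - \<theta>\<^sub>1)))"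
        using W \<theta>12 hW by (intro add_mono mult_left_mono tilted_tail_le) auto
      also have "\<dots> = ennreal (W\<^sup>2 * mom 0 \<theta> + 64 * W\<^sup>2 * exp (- (1 / 4)) * (K * exp (\<theta>\<^sub>1 * W - H W) * (\<theta>\<^sub>2 / (\<theta>\<^sub>2 - \<theta>\<^sub>1))))"
        using mom_nonneg[of 0 \<theta>] K_pos \<theta>12 by (simp flip: ennreal_mult ennreal_plus)
      finally have "mom 2 \<theta> \<le> W\<^sup>2 * mom 0 \<theta> + 64 * W\<^sup>2 * exp (- (1 / 4)) * (K * exp (\<theta>\<^sub>1 * W - H W) * (\<theta>\<^sub>2 / (\<theta>\<^sub>2 - \<theta>\<^sub>1)))"
        using mom_nonneg[of 0 \<theta>] K_pos \<theta>12 by (subst (asm) ennreal_le_iff) auto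
      also have "\<theta>\<^sub>1 * W - H W = 1 / 4"
        using W W2 by (simp add: \<theta>\<^sub>1_def field_simps)
      also have "64 * W\<^sup>2 * exp (- (1 / 4)) * (K * exp (1 / 4) * (\<theta>\<^sub>2 / (\<theta>\<^sub>2 - \<theta>\<^sub>1))) = 64 * W\<^sup>2 * K * (\<theta>\<^sub>2 / (\<theta>\<^sub>2 - \<theta>\<^sub>1))"
        by (simp add: exp_minus)
      also have "\<dots> \<le> 64 * W\<^sup>2 * K * (6 * W)"
        using r K_pos by (intro mult_left_mono) auto
      also have "\<dots> = 384 * K * W\<^sup>2 * W"
        by simp
      also have "\<dots> \<le> 384 * K * W\<^sup>2 * (C1 * mom 0 \<theta>)"
        using L K_pos by (intro mult_left_mono) auto
      finally show ?thesis
        by (simp add: algebra_simps)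
    qed
    show ?case
    proof (intro exI[of _ W] conjI ballI)
      show "W \<le> C * mom 0 \<theta>"
        by (rule order.trans[OF L mult_right_mono]) (auto simp: C_def mom_nonneg)
      show "mom 2 \<theta> \<le> C * W\<^sup>2 * mom 0 \<theta>"
        by (rule order.trans[OF M2], intro mult_right_mono) (auto simp: C_def mom_nonneg)
    qed (use W Hx in auto)
  qed
  moreover have "0 < C"
    using C1 by (simp add: C_def)
  ultimately show ?thesis
    by blast
qed

end

section \<open>Levy processes with superexponential jumps\<close>

lemma integral_uniform_measure:
  fixes f :: "real \<Rightarrow> real"
  assumes [measurable_cong, simp]: "sets \<rho> = sets borel" and [measurable]: "S \<in> sets borel" "f \<in> borel_measurable borel"
    and fin: "emeasure \<rho> S \<noteq> \<infinity>" and pos: "emeasure \<rho> S \<noteq> 0"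
    and i: "integrable \<rho> (\<lambda>x. indicator S x *\<^sub>R f x)"
  shows "integrable (uniform_measure \<rho> S) f"
    and "integral\<^sup>L (uniform_measure \<rho> S) f = (\<integral>x. indicator S x *\<^sub>R f x \<partial>\<rho>) / measure \<rho> S"
proof -
  have e: "(\<lambda>x. (indicator S x / measure \<rho> S) *\<^sub>R f x) = (\<lambda>x. (indicator S x *\<^sub>R f x) / measure \<rho> S)"
    by (auto simp: fun_eq_iff)
  show "integrable (uniform_measure \<rho> S) f"
    unfolding uniform_measure_real[OF fin pos] using i
    by (subst integrable_density) (auto simp: e intro!: AE_I2 simp del: real_scaleR_def)
  show "integral\<^sup>L (uniform_measure \<rho> S) f = (\<integral>x. indicator S x *\<^sub>R f x \<partial>\<rho>) / measure \<rho> S"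
    unfolding uniform_measure_real[OF fin pos] using i
    by (subst integral_density) (auto simp: e intro!: AE_I2 simp del: real_scaleR_def)
qed

text \<open>The upper half of Stirling's formula with a crude prefactor; the induction step is the
  inequality \<open>exp 1 \<le> (Suc n / n) ^ Suc n\<close>.\<close>

lemma fact_le_exp:
  assumes "1 \<le> n"
  shows "fact n \<le> exp 1 * real n * (real n / exp 1) ^ n"
  using assms
proof (induction n rule: dec_induct)
  case (step n)
  have n: "0 < real n"
    using step by simp
  have "ln (real n / real (Suc n)) \<le> real n / real (Suc n) - 1"
    using n by (intro ln_le_minus_one) auto
  also have "\<dots> = - (1 / real (Suc n))"
    by (simp add: field_simps)
  finally have "1 / real (Suc n) \<le> ln (real (Suc n) / real n)"
    using n by (simp add: ln_div)
  then have "1 \<le> real (Suc n) * ln (real (Suc n) / real n)"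
    by (simp add: field_simps)
  then have "exp 1 \<le> exp (real (Suc n) * ln (real (Suc n) / real n))"
    by simp
  also have "\<dots> = (real (Suc n) / real n) ^ Suc n"
    using n by (subst exp_of_nat_mult) simp
  finally have "exp 1 * real n ^ Suc n \<le> real (Suc n) ^ Suc n"
    using n by (simp add: power_divide field_simps del: of_nat_Suc)
  then have 1: "exp 1 * (exp 1 * real n ^ Suc n / exp 1 ^ Suc n) \<le> exp 1 * (real (Suc n) ^ Suc n / exp 1 ^ Suc n)"
    by (intro mult_left_mono divide_right_mono) auto
  have "fact (Suc n) = real (Suc n) * fact n"
    by simp
  also have "\<dots> \<le> real (Suc n) * (exp 1 * real n * (real n / exp 1) ^ n)"
    by (intro mult_left_mono step.IH) simp
  also have "exp 1 * real n * (real n / exp 1) ^ n = exp 1 * (exp 1 * real n ^ Suc n / exp 1 ^ Suc n)"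
    by (simp add: power_divide)
  also have "real (Suc n) * \<dots> \<le> real (Suc n) * (exp 1 * (real (Suc n) ^ Suc n / exp 1 ^ Suc n))"
    using 1 by (rule mult_left_mono) simp
  also have "\<dots> = exp 1 * real (Suc n) * (real (Suc n) / exp 1) ^ Suc n"
    by (simp only: power_divide ac_simps)
  finally show ?case .
qed simp

lemma real_distribution_atLeast_half:
  assumes "real_distribution \<eta>"
  shows "\<exists>c\<ge>0. 1 / 2 \<le> measure \<eta> {- c..}"
proof -
  interpret real_distribution \<eta> by fact
  have "(\<lambda>n. measure \<eta> {- real n..}) \<longlonglongrightarrow> measure \<eta> (\<Union>n. {- real n..})"
    by (intro finite_Lim_measure_incseq) (auto simp: incseq_def)
  also have "(\<Union>n. {- real n..}) = UNIV"
    by (auto simp: minus_le_iff intro: real_arch_simple)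
  also have "measure \<eta> UNIV = 1"
    using prob_space by simp
  finally have "\<forall>\<^sub>F n in sequentially. 1 / 2 < measure \<eta> {- real n..}"
    by (intro order_tendstoD(1)) auto
  then obtain n where "1 / 2 < measure \<eta> {- real n..}"
    using eventually_happens'[OF sequentially_bot] by blast
  then show ?thesis
    by (intro exI[of _ "real n"]) auto
qed

lemma mgf_ge:
  assumes "real_distribution \<eta>" "p \<le> measure \<eta> {- c..}" "0 \<le> \<theta>"
  shows "ennreal (exp (- \<theta> * c) * p) \<le> mgf \<eta> \<theta>"
proof -
  interpret real_distribution \<eta> by fact
  have "ennreal (exp (- \<theta> * c) * p) \<le> ennreal (exp (- \<theta> * c)) * emeasure \<eta> {- c..}"
    using assms(2) by (simp add: emeasure_eq_measure ennreal_leI flip: ennreal_mult)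
  also have "\<dots> = (\<integral>\<^sup>+x. ennreal (exp (- \<theta> * c)) * indicator {- c..} x \<partial>\<eta>)"
    by (simp add: nn_integral_cmult_indicator)
  also have "\<dots> \<le> mgf \<eta> \<theta>"
    unfolding mgf_def using assms(3)
  proof (intro nn_integral_mono)
    fix x
    show "ennreal (exp (- \<theta> * c)) * indicator {- c..} x \<le> ennreal (exp (\<theta> * x))"
      using mult_left_mono[of "- c" x \<theta>] assms(3) by (auto split: split_indicator intro!: ennreal_leI)
  qed
  finally show ?thesis .
qed

locale superexponential_levy = superexponential_tail \<rho> h H b K
  for \<rho> :: "real measure" and h H :: "real \<Rightarrow> real" and b K :: real +
  fixes M :: "'a measure" and X :: "real \<Rightarrow> 'a \<Rightarrow> real" and \<gamma> :: real
  assumes process: "levy_process M X"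
    and chf: "\<And>t s. 0 \<le> t \<Longrightarrow> char (distr M borel (X t)) s = exp (complex_of_real t * levy_exponent \<gamma> \<rho> s)"
begin

section \<open>The laws of the process and their decompositions\<close>

definition P :: "real \<Rightarrow> real measure" where
  "P t = distr M borel (X t)"

lemma P: "0 \<le> t \<Longrightarrow> real_distribution (P t)"
proof -
  assume "0 \<le> t"
  interpret prob_space M
    using process by (simp add: levy_process_def)
  show ?thesis
    unfolding P_def using process \<open>0 \<le> t\<close>
    by (intro real_distribution_distr) (simp add: levy_process_def)
qed

lemma P_add: "0 \<le> s \<Longrightarrow> 0 \<le> t \<Longrightarrow> P (s + t) = (P s \<star> P t)"
  by (rule Levy_uniqueness)
     (auto intro!: P real_distribution_convolution
        simp: fun_eq_iff char_convolution P P_def[symmetric] chf[folded P_def] distrib_right exp_add)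

lemma emeasure_S_finite: "S \<in> sets borel \<Longrightarrow> S \<subseteq> {b<..} \<Longrightarrow> emeasure \<rho> S \<noteq> \<infinity>"
  using levy_measure_finite[OF levy, of S 1] b_ge by (fastforce simp: less_top[symmetric])

text \<open>Applied both to all jumps above \<open>b\<close> and to those in \<open>{b<..V}\<close>.
  In the second case the larger jumps belong to the remainder, which is why its moment bound is
  claimed only for \<open>S = {b<..}\<close>.\<close>

lemma decomposition:
  assumes S: "S \<in> sets borel" "S \<subseteq> {b<..}" "0 < measure \<rho> S" and t: "0 < t"
  shows "\<exists>\<eta>. real_distribution \<eta> \<and>
    (\<forall>s. char \<eta> s = exp (of_real t * levy_exponent \<gamma> (density \<rho> (indicator (- S))) s)) \<and>
    poisson_jumps (t * measure \<rho> S) (uniform_measure \<rho> S) \<eta> \<and>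
    P t = compound_poisson (t * measure \<rho> S) (uniform_measure \<rho> S) \<eta> \<and>
    (S = {b<..} \<longrightarrow> (\<exists>C. \<forall>\<theta>\<ge>0. mgf \<eta> \<theta> \<le> ennreal (exp (C * exp ((b + 1) * \<theta>)))))"
proof -
  have fin: "emeasure \<rho> S \<noteq> \<infinity>"
    by (rule emeasure_S_finite[OF S(1,2)])
  have pos: "emeasure \<rho> S \<noteq> 0"
    using S(3) by (auto simp: measure_def)
  have "- S \<in> sets borel"
    using S(1) by simp
  from levy_distribution_exists[OF levy_measure_restrict[OF levy this] t, of \<gamma>]
  obtain \<eta> where \<eta>: "real_distribution \<eta>"
      "\<And>s. char \<eta> s = exp (of_real t * levy_exponent \<gamma> (density \<rho> (indicator (- S))) s)"
      "\<And>b. 1 \<le> b \<Longrightarrow> emeasure (density \<rho> (indicator (- S))) {b<..} = 0 \<Longrightarrow>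
        \<exists>C. \<forall>\<theta>\<ge>0. mgf \<eta> \<theta> \<le> ennreal (exp (C * exp ((b + 1) * \<theta>)))"
    by blast
  have J: "poisson_jumps (t * measure \<rho> S) (uniform_measure \<rho> S) \<eta>"
    by (intro poisson_jumps.intro mult_pos_pos t S(3) \<eta>(1) char_uniform_measure[OF levy S(1) fin pos])
  interpret J: poisson_jumps "t * measure \<rho> S" "uniform_measure \<rho> S" \<eta>
    by (rule J)
  have "P t = compound_poisson (t * measure \<rho> S) (uniform_measure \<rho> S) \<eta>"
  proof (rule Levy_uniqueness)
    show "char (P t) = char (compound_poisson (t * measure \<rho> S) (uniform_measure \<rho> S) \<eta>)"
    proof
      fix s
      have "S \<inter> {-1..1} = {}"
        using S(2) b_ge by fastforce
      from levy_exponent_split[OF levy S(1) this, of \<gamma> s]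
      have "char (P t) s = exp (of_real t * levy_exponent \<gamma> (density \<rho> (indicator (- S))) s +
          of_real (t * measure \<rho> S) * (char (uniform_measure \<rho> S) s - 1))"
        using t by (simp add: P_def chf distrib_left mult.assoc char_uniform_measure(2)[OF levy S(1) fin pos])
      then show "char (P t) s = char (compound_poisson (t * measure \<rho> S) (uniform_measure \<rho> S) \<eta>) s"
        by (simp only: J.char_compound_poisson \<eta>(2) exp_add)
    qed
  qed (use t in \<open>auto intro!: P J.real_distribution_compound_poisson\<close>)
  moreover have "emeasure (density \<rho> (indicator (- S))) {b<..} = 0" if "S = {b<..}"
    using that by (subst emeasure_density) (auto intro!: nn_integral_0_iff_AE[THEN iffD2] AE_I2 split: split_indicator)
  ultimately show ?thesis
    using \<eta> J b_ge by blast
qed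

definition lam :: real where
  "lam = measure \<rho> {b<..}"

lemma lam_pos: "0 < lam"
  using tail[of b] K_pos by (simp add: lam_def)

lemma mgf_jump:
  assumes "0 \<le> \<theta>"
  shows "mgf (uniform_measure \<rho> {b<..}) \<theta> = ennreal (mom 0 \<theta> / lam)"
  unfolding lam_def using assms lam_pos mom_nonneg
  by (intro mgf_uniform_measure levy mom_0_nn_integral emeasure_S_finite) (auto simp: lam_def measure_def)

lemma mgf_P_finite: "0 \<le> \<theta> \<Longrightarrow> mgf (P 1) \<theta> \<noteq> \<infinity>"
proof -
  assume \<theta>: "0 \<le> \<theta>"
  obtain \<eta> C where \<eta>: "poisson_jumps (1 * lam) (uniform_measure \<rho> {b<..}) \<eta>"
      "P 1 = compound_poisson (1 * lam) (uniform_measure \<rho> {b<..}) \<eta>"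
      "\<And>\<theta>. 0 \<le> \<theta> \<Longrightarrow> mgf \<eta> \<theta> \<le> ennreal (exp (C * exp ((b + 1) * \<theta>)))"
    using decomposition[of "{b<..}" 1] lam_pos unfolding lam_def by auto
  have "mgf (P 1) \<theta> = mgf \<eta> \<theta> * ennreal (exp (1 * lam * (mom 0 \<theta> / lam - 1)))"
    unfolding \<eta>(2) using mom_nonneg lam_pos
    by (intro poisson_jumps.mgf_compound_poisson[OF \<eta>(1)] mgf_jump \<theta>) auto
  moreover have "mgf \<eta> \<theta> \<noteq> \<infinity>"
    using \<eta>(3)[OF \<theta>] by (auto simp: top_unique)
  ultimately show ?thesis
    by (simp add: ennreal_mult_eq_top_iff)
qed

definition E :: "real \<Rightarrow> real" where
  "E \<theta> = enn2real (mgf (P 1) \<theta>)"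

lemma mgf_P: "0 \<le> \<theta> \<Longrightarrow> mgf (P 1) \<theta> = ennreal (E \<theta>)"
  using mgf_P_finite unfolding E_def by (simp add: less_top)

lemma E_nonneg: "0 \<le> E \<theta>"
  by (simp add: E_def)

lemma small_time: "\<exists>C\<ge>0. \<forall>t\<ge>0. \<forall>d. 0 < d \<longrightarrow> d \<le> 1 \<longrightarrow> 1 - C * t / d\<^sup>2 \<le> measure (P t) {- d<..}"
proof -
  obtain C where C: "0 \<le> C" "\<And>t \<mu> d. 0 \<le> t \<Longrightarrow> real_distribution \<mu> \<Longrightarrow>
      (\<forall>s. char \<mu> s = exp (of_real t * levy_exponent \<gamma> \<rho> s)) \<Longrightarrow> 0 < d \<Longrightarrow> d \<le> 1 \<Longrightarrow> measure \<mu> {x. d \<le> \<bar>x\<bar>} \<le> C * t / d\<^sup>2"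
    using levy_small_time[OF levy, of \<gamma>] by blast
  have "1 - C * t / d\<^sup>2 \<le> measure (P t) {- d<..}" if "0 \<le> t" "0 < d" "d \<le> 1" for t d
  proof -
    interpret real_distribution "P t" using that by (intro P)
    have "measure (P t) (UNIV - {- d<..}) \<le> measure (P t) {x. d \<le> \<bar>x\<bar>}"
      by (intro finite_measure_mono) auto
    also have "\<dots> \<le> C * t / d\<^sup>2"
      using that P chf by (intro C(2)) (auto simp: P_def)
    finally show ?thesis
      using prob_compl[of "{- d<..}"] by simp
  qed
  then show ?thesis
    using C(1) by blast
qed

text \<open>\<open>small_time\<close> is informative only up to some time \<open>1 / q\<close>. A
  time \<open>r\<close> up to 1 is split into \<open>q\<close> equal steps, each ending above
  \<open>-1\<close> with probability at least \<open>1 / 2\<close>. Ottaviani's inequality needs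
  this uniformly in \<open>r\<close>.\<close>

lemma lower_bound_unit_interval: "\<exists>c p. 0 < p \<and> (\<forall>r\<in>{0..1}. p \<le> measure (P r) {- c..})"
proof -
  obtain C where C: "0 \<le> C" "\<And>t d. 0 \<le> t \<Longrightarrow> 0 < d \<Longrightarrow> d \<le> 1 \<Longrightarrow> 1 - C * t / d\<^sup>2 \<le> measure (P t) {- d<..}"
    using small_time by blast
  obtain q :: nat where q: "2 * C < real q" "0 < q"
    using reals_Archimedean2[of "max (2 * C) 1"] by (metis max_less_iff_conj of_nat_0_less_iff less_trans zero_less_one)
  have half: "1 / 2 \<le> measure (P s) {- 1<..}" if "0 \<le> s" "s \<le> 1 / real q" for s
  proof -
    have "C * s \<le> C * (1 / real q)"
      using that C(1) by (intro mult_left_mono)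
    also have "\<dots> \<le> 1 / 2"
      using q by (simp add: field_simps)
    finally show ?thesis
      using C(2)[of s 1] that by simp
  qed
  \<comment> \<open>The additional \<open>- 1\<close> lets the induction start: at
    \<open>n = 0\<close> the short-time estimate is used with \<open>d = 1\<close>.\<close>
  have step: "(1 / 2) ^ n \<le> measure (P (real n * s)) {- real n - 1<..}" if s: "0 \<le> s" "s \<le> 1 / real q" for s n
  proof (induction n)
    case 0
    interpret real_distribution "P 0" by (rule P) simp
    have "1 \<le> measure (P 0) {- 1<..}"
      using C(2)[of 0 1] by simp
    then show ?case
      by simp
  next
    case (Suc n)
    have "(1 / 2) ^ Suc n = 1 / 2 * (1 / 2) ^ n"
      by simp
    also have "\<dots> \<le> measure (P s) {- 1<..} * measure (P (real n * s)) {- real n - 1<..}"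
      by (intro mult_mono half s Suc.IH) auto
    also have "\<dots> \<le> measure (P s \<star> P (real n * s)) {- 1 + (- real n - 1)<..}"
      using s by (intro measure_convolution_ge P) auto
    also have "(P s \<star> P (real n * s)) = P (real (Suc n) * s)"
      using s by (subst P_add[symmetric]) (auto simp: algebra_simps)
    finally show ?case
      by (simp add: algebra_simps)
  qed
  have "(1 / 2) ^ q \<le> measure (P r) {- (real q + 1)..}" if r: "r \<in> {0..1}" for r
  proof -
    interpret real_distribution "P r" using r by (intro P) auto
    have "(1 / 2) ^ q \<le> measure (P (real q * (r / real q))) {- real q - 1<..}"
      using r q by (intro step) (auto simp: field_simps)
    also have "real q * (r / real q) = r"
      using q by simp
    also have "measure (P r) {- real q - 1<..} \<le> measure (P r) {- (real q + 1)..}"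
      by (intro finite_measure_mono) auto
    finally show ?thesis .
  qed
  then show ?thesis
    by (intro exI[of _ "real q + 1"] exI[of _ "(1 / 2) ^ q"]) auto
qed

text \<open>A lower bound is wanted because this moment will stand in a denominator. The jumps above
  \<open>b\<close> contribute the exponential of \<open>e * (mom 0 \<theta> - lam)\<close> exactly,
  and for small \<open>e\<close> the remainder exceeds \<open>-1\<close> with probability at least
  \<open>1 / 2\<close>.\<close>

lemma mgf_small_time:
  "\<exists>e0>0. \<forall>e \<theta>. 0 < e \<longrightarrow> e \<le> e0 \<longrightarrow> 0 \<le> \<theta> \<longrightarrow>
    ennreal (exp (- \<theta>) / 2 * exp (e * (mom 0 \<theta> - lam))) \<le> mgf (P e) \<theta>"
proof -
  let ?\<rho> = "density \<rho> (indicator (- {b<..}))"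
  have "levy_measure ?\<rho>"
    by (rule levy_measure_restrict[OF levy]) simp
  then obtain C where C: "0 \<le> C" "\<And>t \<mu> d. 0 \<le> t \<Longrightarrow> real_distribution \<mu> \<Longrightarrow>
      (\<forall>s. char \<mu> s = exp (of_real t * levy_exponent \<gamma> ?\<rho> s)) \<Longrightarrow> 0 < d \<Longrightarrow> d \<le> 1 \<Longrightarrow> measure \<mu> {x. d \<le> \<bar>x\<bar>} \<le> C * t / d\<^sup>2"
    using levy_small_time[of ?\<rho> \<gamma>] by blast
  define e0 where "e0 = 1 / (2 * C + 1)"
  have "ennreal (exp (- \<theta>) / 2 * exp (e * (mom 0 \<theta> - lam))) \<le> mgf (P e) \<theta>" if e: "0 < e" "e \<le> e0" and \<theta>: "0 \<le> \<theta>" for e \<theta>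
  proof -
    obtain \<eta> where \<eta>: "real_distribution \<eta>" "\<forall>s. char \<eta> s = exp (of_real e * levy_exponent \<gamma> ?\<rho> s)"
        "poisson_jumps (e * lam) (uniform_measure \<rho> {b<..}) \<eta>"
        "P e = compound_poisson (e * lam) (uniform_measure \<rho> {b<..}) \<eta>"
      using decomposition[of "{b<..}" e] lam_pos e unfolding lam_def by auto
    interpret \<eta>: real_distribution \<eta> by fact
    have "measure \<eta> (UNIV - {- 1..}) \<le> measure \<eta> {x. 1 \<le> \<bar>x\<bar>}"
      by (intro \<eta>.finite_measure_mono) auto
    also have "\<dots> \<le> C * e / 1\<^sup>2"
      using e by (intro C(2) \<eta>(1,2)) auto
    also have "\<dots> \<le> C * e0"
      using e C(1) by (simp add: mult_left_mono)
    also have "\<dots> \<le> 1 / 2"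
      using C(1) by (simp add: e0_def field_simps)
    finally have "1 / 2 \<le> measure \<eta> {- 1..}"
      using \<eta>.prob_compl[of "{- 1..}"] by simp
    from mgf_ge[OF \<eta>(1) this \<theta>] have 1: "ennreal (exp (- \<theta>) / 2) \<le> mgf \<eta> \<theta>"
      by simp
    have "e * lam * (mom 0 \<theta> / lam - 1) = e * (mom 0 \<theta> - lam)"
      using lam_pos by (simp add: field_simps)
    then have "mgf (P e) \<theta> = mgf \<eta> \<theta> * ennreal (exp (e * (mom 0 \<theta> - lam)))"
      unfolding \<eta>(4) using mom_nonneg lam_pos
      by (subst poisson_jumps.mgf_compound_poisson[OF \<eta>(3) mgf_jump[OF \<theta>]]) (auto simp only: divide_nonneg_pos)
    moreover have "ennreal (exp (- \<theta>) / 2 * exp (e * (mom 0 \<theta> - lam))) =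
        ennreal (exp (- \<theta>) / 2) * ennreal (exp (e * (mom 0 \<theta> - lam)))"
      by (rule ennreal_mult') simp
    ultimately show ?thesis
      using mult_right_mono[OF 1, of "ennreal (exp (e * (mom 0 \<theta> - lam)))"] by simp
  qed
  moreover have "0 < e0"
    using C(1) by (simp add: e0_def)
  ultimately show ?thesis
    by blast
qed

end

text \<open>Chebyshev's inequality under the tilted law: integrate
  \<open>1 - (s - n * xb)\<^sup>2 / z\<^sup>2\<close>, which is at most the indicator of the
  interval, against the weight \<open>exp (\<theta> * s)\<close>.\<close>

lemma tilted_chebyshev:
  fixes \<theta> a0 xb v :: real
  assumes mu: "real_distribution \<mu>"
    and i: "integrable \<mu> (\<lambda>x. exp (\<theta> * x))" "integrable \<mu> (\<lambda>x. (x - xb) * exp (\<theta> * x))"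
      "integrable \<mu> (\<lambda>x. (x - xb)\<^sup>2 * exp (\<theta> * x))"
    and a0: "(\<integral>x. exp (\<theta> * x) \<partial>\<mu>) = a0" and mean: "(\<integral>x. (x - xb) * exp (\<theta> * x) \<partial>\<mu>) = 0"
    and var: "(\<integral>x. (x - xb)\<^sup>2 * exp (\<theta> * x) \<partial>\<mu>) = v * a0" and z: "0 < z"
  defines "T \<equiv> convpow \<mu> (return borel 0)"
  shows "ennreal (a0 ^ n * (1 - n * v / z\<^sup>2)) \<le> (\<integral>\<^sup>+s. ennreal (exp (\<theta> * s)) * indicator {n * xb - z..n * xb + z} s \<partial>T n)"
proof -
  let ?c = "real n * xb"
  have T: "integrable (T n) (\<lambda>x. exp (\<theta> * x))" "integrable (T n) (\<lambda>x. (x - ?c)\<^sup>2 * exp (\<theta> * x))"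
    "(\<integral>x. exp (\<theta> * x) \<partial>T n) = a0 ^ n" "(\<integral>x. (x - ?c)\<^sup>2 * exp (\<theta> * x) \<partial>T n) = n * v * a0 ^ n"
    using tilted_moments_convpow[OF mu i a0 mean var, of n] unfolding T_def by blast+
  have [measurable_cong]: "sets (T n) = sets borel"
    by (cases n) (auto simp: T_def)
  have iI: "integrable (T n) (\<lambda>s. indicator {?c - z..?c + z} s *\<^sub>R exp (\<theta> * s))"
    by (rule integrable_mult_indicator[OF _ T(1)]) simp
  have "a0 ^ n * (1 - n * v / z\<^sup>2) = (\<integral>x. exp (\<theta> * x) - (1 / z\<^sup>2) * ((x - ?c)\<^sup>2 * exp (\<theta> * x)) \<partial>T n)"
    using T by (subst Bochner_Integration.integral_diff) (auto simp: algebra_simps)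
  also have "\<dots> \<le> (\<integral>s. indicator {?c - z..?c + z} s *\<^sub>R exp (\<theta> * s) \<partial>T n)"
  proof (intro integral_mono iI)
    show "integrable (T n) (\<lambda>x. exp (\<theta> * x) - (1 / z\<^sup>2) * ((x - ?c)\<^sup>2 * exp (\<theta> * x)))"
      using T by (intro Bochner_Integration.integrable_diff integrable_mult_right)
    fix s
    show "exp (\<theta> * s) - (1 / z\<^sup>2) * ((s - ?c)\<^sup>2 * exp (\<theta> * s)) \<le> indicator {?c - z..?c + z} s *\<^sub>R exp (\<theta> * s)"
    proof (cases "s \<in> {?c - z..?c + z}")
      case False
      then have "z \<le> \<bar>s - ?c\<bar>"
        by auto
      then have "z\<^sup>2 \<le> (s - ?c)\<^sup>2"
        using z by (simp add: abs_le_square_iff[symmetric])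
      then have "1 \<le> (1 / z\<^sup>2) * (s - ?c)\<^sup>2"
        using z by (simp add: field_simps)
      from mult_right_mono[OF this, of "exp (\<theta> * s)"] show ?thesis
        using False by (simp add: mult.assoc)
    qed simp
  qed
  finally have "ennreal (a0 ^ n * (1 - n * v / z\<^sup>2)) \<le> ennreal (\<integral>s. indicator {?c - z..?c + z} s *\<^sub>R exp (\<theta> * s) \<partial>T n)"
    by (rule ennreal_leI)
  also have "\<dots> = (\<integral>\<^sup>+s. ennreal (indicator {?c - z..?c + z} s *\<^sub>R exp (\<theta> * s)) \<partial>T n)"
    by (rule nn_integral_eq_integral[symmetric, OF iI]) simp
  also have "\<dots> = (\<integral>\<^sup>+s. ennreal (exp (\<theta> * s)) * indicator {?c - z..?c + z} s \<partial>T n)"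
    by (intro nn_integral_cong) (auto split: split_indicator)
  finally show ?thesis .
qed

text \<open>Separates the sum of the jumps, to which Chebyshev's inequality applies, from the
  remainder.\<close>

lemma (in poisson_jumps) convpow_eq_convolution:
  "convpow \<mu> \<eta> n = (convpow \<mu> (return borel 0) n \<star> \<eta>)"
proof -
  interpret R: poisson_jumps l \<mu> "return borel 0"
    by (intro poisson_jumps.intro l_pos mu real_distribution_return)
  have "char (return borel 0) s = 1" for s
    unfolding char_def by (subst integral_return) auto
  then show ?thesis
    by (intro Levy_uniqueness)
       (auto simp: fun_eq_iff char_convpow R.char_convpow char_convolution[OF R.real_distribution_convpow eta]
         intro: real_distribution_convpow real_distribution_convolution R.real_distribution_convpow eta)
qed

text \<open>The exponential weight is multiplicative, so under tilting the summands remain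
  independent and their masses multiply.\<close>

lemma tilted_mass_convolution:
  assumes T: "real_distribution T" and \<eta>: "real_distribution \<eta>"
    and p: "ennreal p \<le> (\<integral>\<^sup>+s. ennreal (exp (\<theta> * s)) * indicator {x1..x2} s \<partial>T)" "0 \<le> p"
    and q: "ennreal q \<le> (\<integral>\<^sup>+s. ennreal (exp (\<theta> * s)) * indicator {y1..y2} s \<partial>\<eta>)" "0 \<le> q"
    and B: "B \<in> sets borel" "{x1 + y1..x2 + y2} \<subseteq> B"
  shows "ennreal (p * q) \<le> (\<integral>\<^sup>+s. ennreal (exp (\<theta> * s)) * indicator B s \<partial>(T \<star> \<eta>))"
proof -
  interpret T: real_distribution T by fact
  interpret \<eta>: real_distribution \<eta> by fact
  note [measurable] = B(1)
  have "ennreal (p * q) \<le> (\<integral>\<^sup>+s. ennreal (exp (\<theta> * s)) * indicator {x1..x2} s \<partial>T) * (\<integral>\<^sup>+s. ennreal (exp (\<theta> * s)) * indicator {y1..y2} s \<partial>\<eta>)"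
    using p q by (simp add: ennreal_mult mult_mono)
  also have "\<dots> = (\<integral>\<^sup>+x. \<integral>\<^sup>+y. (ennreal (exp (\<theta> * x)) * indicator {x1..x2} x) * (ennreal (exp (\<theta> * y)) * indicator {y1..y2} y) \<partial>\<eta> \<partial>T)"
    by (simp add: nn_integral_cmult nn_integral_multc)
  also have "\<dots> \<le> (\<integral>\<^sup>+x. \<integral>\<^sup>+y. ennreal (exp (\<theta> * (x + y))) * indicator B (x + y) \<partial>\<eta> \<partial>T)"
  proof (intro nn_integral_mono)
    fix x y
    have "x + y \<in> B" if "x \<in> {x1..x2}" "y \<in> {y1..y2}"
      using that B(2) by (force intro: add_mono)
    then show "(ennreal (exp (\<theta> * x)) * indicator {x1..x2} x) * (ennreal (exp (\<theta> * y)) * indicator {y1..y2} y) \<le>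
        ennreal (exp (\<theta> * (x + y))) * indicator B (x + y)"
      by (auto split: split_indicator simp: distrib_left exp_add ennreal_mult)
  qed
  also have "\<dots> = (\<integral>\<^sup>+s. ennreal (exp (\<theta> * s)) * indicator B s \<partial>(T \<star> \<eta>))"
    by (subst nn_integral_convolution) (auto simp: T.finite_measure_axioms \<eta>.finite_measure_axioms)
  finally show ?thesis .
qed

text \<open>Above \<open>R\<close> the weight is at most \<open>exp (- R)\<close> times the weight
  for \<open>\<theta> + 1\<close>; below \<open>- R\<close> it is at most
  \<open>exp (- \<theta> * R)\<close>. Hypothesis \<open>R\<close> says that both losses together
  leave half of the mass.\<close>

lemma tilted_center_mass:
  assumes \<eta>: "real_distribution \<eta>" and \<theta>: "0 \<le> \<theta>"
    and e: "mgf \<eta> \<theta> = ennreal e" "0 \<le> e" and g: "mgf \<eta> (\<theta> + 1) \<le> ennreal g" "0 \<le> g"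
    and R: "exp (- R) * g + exp (- \<theta> * R) \<le> e / 2"
  shows "ennreal (e / 2) \<le> (\<integral>\<^sup>+y. ennreal (exp (\<theta> * y)) * indicator {- R..R} y \<partial>\<eta>)"
proof -
  interpret \<eta>: real_distribution \<eta> by fact
  let ?A = "\<integral>\<^sup>+y. ennreal (exp (\<theta> * y)) * indicator {- R..R} y \<partial>\<eta>"
  have "ennreal e \<le> (\<integral>\<^sup>+y. ennreal (exp (\<theta> * y)) * indicator {- R..R} y +
      (ennreal (exp (- R)) * ennreal (exp ((\<theta> + 1) * y)) + ennreal (exp (- \<theta> * R))) \<partial>\<eta>)"
    unfolding e(1)[symmetric] mgf_def
  proof (intro nn_integral_mono)
    fix y
    consider "y \<in> {- R..R}" | "R < y" | "y < - R"
      by fastforce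
    then show "ennreal (exp (\<theta> * y)) \<le> ennreal (exp (\<theta> * y)) * indicator {- R..R} y +
      (ennreal (exp (- R)) * ennreal (exp ((\<theta> + 1) * y)) + ennreal (exp (- \<theta> * R)))"
    proof cases
      case 2
      then have "exp (\<theta> * y) \<le> exp (- R) * exp ((\<theta> + 1) * y)"
        by (simp add: algebra_simps flip: exp_add)
      then have "ennreal (exp (\<theta> * y)) \<le> ennreal (exp (- R)) * ennreal (exp ((\<theta> + 1) * y))"
        by (simp add: ennreal_leI flip: ennreal_mult)
      then show ?thesis
        by (intro add_increasing add_increasing2) auto
    next
      case 3
      then have "ennreal (exp (\<theta> * y)) \<le> ennreal (exp (- \<theta> * R))"
        using mult_left_mono[of y "- R" \<theta>] \<theta> by (intro ennreal_leI) auto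
      then show ?thesis
        by (intro add_increasing) auto
    qed simp
  qed
  also have "\<dots> = ?A + (ennreal (exp (- R)) * mgf \<eta> (\<theta> + 1) + ennreal (exp (- \<theta> * R)))"
    by (simp add: nn_integral_add nn_integral_cmult mgf_def \<eta>.emeasure_space_1[simplified])
  also have "\<dots> \<le> ?A + (ennreal (exp (- R)) * ennreal g + ennreal (exp (- \<theta> * R)))"
    by (intro add_mono mult_left_mono g order.refl) auto
  also have "\<dots> = ?A + ennreal (exp (- R) * g + exp (- \<theta> * R))"
    using g by (simp flip: ennreal_mult ennreal_plus)
  also have "\<dots> \<le> ?A + ennreal (e / 2)"
    using R by (intro add_left_mono ennreal_leI)
  finally have *: "ennreal e \<le> ?A + ennreal (e / 2)" .
  show ?thesis
  proof (cases ?A rule: ennreal_cases)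
    case (real r)
    with * show ?thesis
      using e(2) by (simp flip: ennreal_plus)
  qed simp
qed

section \<open>The lower bound for the tail of \<open>X 1\<close>\<close>

context superexponential_levy
begin

text \<open>By Chebyshev's inequality \<open>n\<close> tilted jumps and the remainder land in \<open>[u - 2 A, u]\<close>. The pigeonhole principle
  selects a unit window there, and \<open>q\<close> further jumps of length at most \<open>W\<close> bridge the gap to \<open>u\<close>.\<close>

lemma tail_lower_bound_at:
  fixes \<theta> R W A L u :: real and N q n :: nat and \<eta> :: "real measure"
  defines "A \<equiv> 3 * sqrt (mom 2 \<theta>) + R" and "L \<equiv> mom 0 \<theta>"
  defines "u \<equiv> mom 1 \<theta> + A" and "N \<equiv> nat \<lceil>2 * A\<rceil>" and "q \<equiv> nat \<lceil>(2 * A + 2) / W\<rceil>" and "n \<equiv> nat \<lfloor>L\<rfloor>"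
  assumes \<theta>: "0 \<le> \<theta>" and L: "1 \<le> L" and R0: "0 \<le> R"
    and J: "poisson_jumps lam (uniform_measure \<rho> {b<..}) \<eta>"
    and PJ: "P 1 = compound_poisson lam (uniform_measure \<rho> {b<..}) \<eta>"
    and e: "mgf \<eta> \<theta> = ennreal e" "0 \<le> e"
    and R: "ennreal (e / 2) \<le> (\<integral>\<^sup>+y. ennreal (exp (\<theta> * y)) * indicator {- R..R} y \<partial>\<eta>)"
    and W: "b \<le> W" "\<And>x. 0 \<le> x \<Longrightarrow> x \<le> W \<Longrightarrow> H x \<le> \<theta> * x"
  shows "exp (- \<theta> * u) * E \<theta> * (K ^ q * exp (- \<theta> * (1 + real q * b)) / (exp 2 * L * (real n + real q) ^ q * (4 * (real N + 1))))
    \<le> measure (P 1) {u<..}"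
proof -
  interpret J: poisson_jumps lam "uniform_measure \<rho> {b<..}" \<eta> by (rule J)
  let ?\<mu> = "uniform_measure \<rho> {b<..}"
  let ?m = "mom 1 \<theta>" and ?M2 = "mom 2 \<theta>"
  have fin: "emeasure \<rho> {b<..} \<noteq> \<infinity>"
    by (rule emeasure_S_finite) auto
  have pos: "emeasure \<rho> {b<..} \<noteq> 0"
    using lam_pos by (auto simp: lam_def measure_def)
  note I = integral_uniform_measure[OF sets_rho _ _ fin pos]
  \<comment> \<open>Mean and variance of a single jump under the tilted law.\<close>
  define xb where "xb = ?m / L"
  define v where "v = ?M2 / L - xb\<^sup>2"
  note int = integrable_tilted[OF \<theta>]
  have i0: "integrable ?\<mu> (\<lambda>x. exp (\<theta> * x))" "(\<integral>x. exp (\<theta> * x) \<partial>?\<mu>) = L / lam"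
    using I[of "\<lambda>x. exp (\<theta> * x)"] int[of 0] by (auto simp: L_def mom_def lam_def)
  have i1: "integrable ?\<mu> (\<lambda>x. x * exp (\<theta> * x))" "(\<integral>x. x * exp (\<theta> * x) \<partial>?\<mu>) = ?m / lam"
    using I[of "\<lambda>x. x * exp (\<theta> * x)"] int[of 1] by (auto simp: mom_def lam_def)
  have i2: "integrable ?\<mu> (\<lambda>x. x\<^sup>2 * exp (\<theta> * x))" "(\<integral>x. x\<^sup>2 * exp (\<theta> * x) \<partial>?\<mu>) = ?M2 / lam"
    using I[of "\<lambda>x. x\<^sup>2 * exp (\<theta> * x)"] int[of 2] by (auto simp: mom_def lam_def)
  have e1: "(x - xb) * exp (\<theta> * x) = x * exp (\<theta> * x) - xb * exp (\<theta> * x)" for x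
    by (simp add: algebra_simps)
  have c1: "integrable ?\<mu> (\<lambda>x. (x - xb) * exp (\<theta> * x))" "(\<integral>x. (x - xb) * exp (\<theta> * x) \<partial>?\<mu>) = 0"
    unfolding e1 using i0 i1 L by (auto simp: xb_def)
  have e2: "(x - xb)\<^sup>2 * exp (\<theta> * x) = x\<^sup>2 * exp (\<theta> * x) - 2 * xb * (x * exp (\<theta> * x)) + xb\<^sup>2 * exp (\<theta> * x)" for x
    by (simp add: power2_eq_square algebra_simps)
  have c2: "integrable ?\<mu> (\<lambda>x. (x - xb)\<^sup>2 * exp (\<theta> * x))"
    unfolding e2 using i0 i1 i2 by (intro Bochner_Integration.integrable_add Bochner_Integration.integrable_diff integrable_mult_right) auto
  have "(\<integral>x. (x - xb)\<^sup>2 * exp (\<theta> * x) \<partial>?\<mu>) = ?M2 / lam - 2 * xb * (?m / lam) + xb\<^sup>2 * (L / lam)"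
    unfolding e2 using i0 i1 i2
    by (subst Bochner_Integration.integral_add Bochner_Integration.integral_diff; simp)+
  also have "\<dots> = v * (L / lam)"
  proof -
    have nz: "L \<noteq> 0" "lam \<noteq> 0"
      using L lam_pos by auto
    have "v * (L / lam) = (?M2 - ?m\<^sup>2 / L) / lam"
      using nz by (simp add: v_def xb_def power2_eq_square field_simps)
    moreover have "?M2 / lam - 2 * xb * (?m / lam) + xb\<^sup>2 * (L / lam) = (?M2 - ?m\<^sup>2 / L) / lam"
      using nz by (simp add: xb_def power2_eq_square diff_divide_distrib)
    ultimately show ?thesis
      by (simp only:)
  qed
  finally have c3: "(\<integral>x. (x - xb)\<^sup>2 * exp (\<theta> * x) \<partial>?\<mu>) = v * (L / lam)" .
  have "0 \<le> (\<integral>x. (x - xb)\<^sup>2 * exp (\<theta> * x) \<partial>?\<mu>)"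
    by simp
  then have v0: "0 \<le> v"
    unfolding c3 using L lam_pos by (metis divide_pos_pos less_le_trans mult_neg_pos not_le zero_less_one)
  have xb0: "0 \<le> xb"
    using mom_nonneg L by (simp add: xb_def)
  have M2pos: "0 < ?M2"
  proof -
    have "L \<le> ?m"
      unfolding L_def mom_def using b_ge by (intro integral_mono int) (auto split: split_indicator)
    then have "0 < ?m"
      using L by simp
    then have "0 < xb"
      using L by (simp add: xb_def)
    then have "0 < ?M2 / L"
      using v0 by (simp add: v_def) (smt (verit) zero_less_power2)
    then show ?thesis
      using L by (simp add: zero_less_divide_iff)
  qed
  have xb_le: "xb \<le> sqrt ?M2"
  proof (rule real_le_rsqrt)
    have "xb\<^sup>2 \<le> ?M2 / L"
      using v0 by (simp add: v_def)
    also have "\<dots> \<le> ?M2"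
      using L mom_nonneg[of 2 \<theta>] mult_left_mono[of 1 L ?M2] by (simp add: divide_le_eq)
    finally show "xb\<^sup>2 \<le> ?M2" .
  qed
  have n: "real n \<le> L" "L < real n + 1" "1 \<le> n"
  proof -
    have f: "1 \<le> \<lfloor>L\<rfloor>"
      using L by simp
    then have "real n = of_int \<lfloor>L\<rfloor>"
      by (simp add: n_def)
    then show "real n \<le> L" "L < real n + 1"
      by linarith+
    show "1 \<le> n"
      using f by (simp add: n_def le_nat_iff)
  qed
  have nv: "real n * v \<le> ?M2"
  proof -
    have "real n * v \<le> L * (?M2 / L)"
      using n v0 L by (intro mult_mono) (auto simp: v_def)
    then show ?thesis
      using L by simp
  qed
  \<comment> \<open>Two standard deviations: the sum of \<open>n\<close> tilted jumps has variance
    at most \<open>mom 2 \<theta>\<close>, so at most a quarter of the mass is lost and half surely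
    stays.\<close>
  define z where "z = 2 * sqrt ?M2"
  have z: "0 < z" "z\<^sup>2 = 4 * ?M2"
    using M2pos by (auto simp: z_def power_mult_distrib)
  let ?T = "convpow ?\<mu> (return borel 0) n"
  interpret R: poisson_jumps lam ?\<mu> "return borel 0"
    by (intro poisson_jumps.intro J.l_pos J.mu real_distribution_return)
  have "real n * v / z\<^sup>2 \<le> 1 / 4"
    using nv M2pos unfolding z(2) by (simp add: field_simps)
  then have "1 / 2 \<le> 1 - real n * v / z\<^sup>2"
    by linarith
  then have "(L / lam) ^ n * (1 / 2) \<le> (L / lam) ^ n * (1 - real n * v / z\<^sup>2)"
    using L lam_pos by (intro mult_left_mono) simp_all
  then have T: "ennreal ((L / lam) ^ n * (1 / 2)) \<le> (\<integral>\<^sup>+s. ennreal (exp (\<theta> * s)) * indicator {real n * xb - z..real n * xb + z} s \<partial>?T)"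
    using tilted_chebyshev[OF J.mu i0(1) c1(1) c2 i0(2) c1(2) c3 z(1), of n] by (rule order.trans[OF ennreal_leI])
  have A0: "0 \<le> A"
    using R0 mom_nonneg[of 2 \<theta>] by (simp add: A_def)
  have N: "2 * A \<le> real N" "real N \<le> 2 * A + 1"
    using A0 unfolding N_def by linarith+
  have nxb: "real n * xb \<le> ?m" "?m - xb \<le> real n * xb"
  proof -
    have "real n * xb \<le> L * xb" "L * xb \<le> (real n + 1) * xb"
      using n xb0 by (auto intro!: mult_right_mono)
    moreover have "L * xb = ?m"
      using L by (simp add: xb_def)
    ultimately show "real n * xb \<le> ?m" "?m - xb \<le> real n * xb"
      by (auto simp: distrib_right)
  qed
  \<comment> \<open>Rounding \<open>L\<close> down to \<open>n\<close> loses at most one mean jump,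
    and \<open>xb \<le> sqrt (mom 2 \<theta>)\<close>. Together with \<open>z\<close> this explains
    the three standard deviations in \<open>A\<close>.\<close>
  have sub: "{real n * xb - z + - R..real n * xb + z + R} \<subseteq> {u - real (Suc N)<..u}"
    using nxb xb_le N mom_nonneg[of 2 \<theta>] by (auto simp: u_def A_def z_def)
  have mass: "ennreal ((L / lam) ^ n * (1 / 2) * (e / 2)) \<le> (\<integral>\<^sup>+s. ennreal (exp (\<theta> * s)) * indicator {u - real (Suc N)<..u} s \<partial>convpow ?\<mu> \<eta> n)"
    unfolding J.convpow_eq_convolution using L lam_pos e
    by (intro tilted_mass_convolution[OF R.real_distribution_convpow J.eta T _ R _ _ sub]) auto
  define c where "c = (L / lam) ^ n * (1 / 2) * (e / 2)"
  have c0: "0 \<le> c"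
    using L lam_pos e by (simp add: c_def)
  obtain i where i: "i \<le> N" "exp (- \<theta> * (u - real i)) * (c / real (Suc N)) \<le> measure (convpow ?\<mu> \<eta> n) {u - real (Suc i)<..}"
    using mgf_window[OF J.real_distribution_convpow \<theta> mass[folded c_def] c0] by blast
  have Wpos: "0 < W"
    using W b_ge by simp
  have q: "(2 * A + 2) / W \<le> real q" "1 \<le> q"
  proof -
    have "0 < (2 * A + 2) / W"
      using A0 Wpos by simp
    then have "1 \<le> \<lceil>(2 * A + 2) / W\<rceil>"
      by (simp add: le_ceiling_iff)
    then show "(2 * A + 2) / W \<le> real q" "1 \<le> q"
      by (auto simp: q_def le_nat_iff)
  qed
  \<comment> \<open>Each of the \<open>q\<close> additional jumps has to exceed \<open>x\<close>. It
    is kept above \<open>b\<close>, where the tail formula holds, and below \<open>W\<close>, where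
    \<open>H x \<le> \<theta> * x\<close>.\<close>
  define x where "x = max (real (Suc i) / real q) b"
  have "real (Suc i) \<le> 2 * A + 2"
    using i N by simp
  also have "\<dots> \<le> real q * W"
    using q Wpos by (simp add: field_simps)
  finally have iW: "real (Suc i) / real q \<le> W"
    using q by (simp add: field_simps)
  have x: "b \<le> x" "x \<le> W" "real (Suc i) \<le> real q * x" "x \<le> real (Suc i) / real q + b"
    using iW W q b_ge by (auto simp: x_def max_def field_simps)
  have mux: "K / lam * exp (- \<theta> * x) \<le> measure ?\<mu> {x<..}"
  proof -
    have "measure ?\<mu> {x<..} = measure \<rho> ({b<..} \<inter> {x<..}) / lam"
      unfolding lam_def using fin pos by (subst measure_uniform_measure) auto
    also have "{b<..} \<inter> {x<..} = {x<..}"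
      using x by auto
    also have "measure \<rho> {x<..} = K * exp (- H x)"
      using x by (intro tail)
    finally have "measure ?\<mu> {x<..} = K / lam * exp (- H x)"
      by simp
    moreover have "H x \<le> \<theta> * x"
      using x b_ge by (intro W(2)) auto
    ultimately show ?thesis
      using K_pos lam_pos by (simp add: mult_left_mono divide_right_mono)
  qed
  have kx: "exp (- \<theta> * (real (Suc i) + real q * b)) \<le> exp (- \<theta> * x) ^ q"
  proof -
    have "real q * x \<le> real q * (real (Suc i) / real q + b)"
      using x by (intro mult_left_mono) auto
    also have "\<dots> = real (Suc i) + real q * b"
      using q by (simp add: field_simps)
    finally have "\<theta> * (real q * x) \<le> \<theta> * (real (Suc i) + real q * b)"
      using \<theta> by (intro mult_left_mono)
    then show ?thesis
      by (simp add: exp_of_nat_mult[symmetric] algebra_simps)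
  qed
  have "measure (P 1) {u<..} \<ge> J.pois (n + q) * measure (convpow ?\<mu> \<eta> (n + q)) {u<..}"
    unfolding PJ by (rule J.measure_compound_poisson_ge) simp
  moreover have "measure (convpow ?\<mu> \<eta> (n + q)) {u<..} \<ge> measure (convpow ?\<mu> \<eta> n) {u - real (Suc i)<..} * measure ?\<mu> {x<..} ^ q"
  proof -
    interpret Q: real_distribution "convpow ?\<mu> \<eta> (n + q)" by (rule J.real_distribution_convpow)
    have "measure (convpow ?\<mu> \<eta> n) {u - real (Suc i)<..} * measure ?\<mu> {x<..} ^ q \<le>
        measure (convpow ?\<mu> \<eta> (n + q)) {u - real (Suc i) + real q * x<..}"
      by (rule J.measure_convpow_add_ge)
    also have "\<dots> \<le> measure (convpow ?\<mu> \<eta> (n + q)) {u<..}"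
      using x by (intro Q.finite_measure_mono) auto
    finally show ?thesis .
  qed
  moreover have "measure (convpow ?\<mu> \<eta> n) {u - real (Suc i)<..} * measure ?\<mu> {x<..} ^ q \<ge>
      (exp (- \<theta> * (u - real i)) * (c / real (Suc N))) * ((K / lam) ^ q * exp (- \<theta> * (real (Suc i) + real q * b)))"
  proof (intro mult_mono i)
    have "(K / lam) ^ q * exp (- \<theta> * (real (Suc i) + real q * b)) \<le> (K / lam) ^ q * exp (- \<theta> * x) ^ q"
      using kx K_pos lam_pos by (intro mult_left_mono) auto
    also have "\<dots> = (K / lam * exp (- \<theta> * x)) ^ q"
      by (rule power_mult_distrib[symmetric])
    also have "\<dots> \<le> measure ?\<mu> {x<..} ^ q"
      using mux K_pos lam_pos by (intro power_mono) auto
    finally show "(K / lam) ^ q * exp (- \<theta> * (real (Suc i) + real q * b)) \<le> measure ?\<mu> {x<..} ^ q" .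
  qed (use K_pos lam_pos in auto)
  ultimately have main: "J.pois (n + q) * ((exp (- \<theta> * (u - real i)) * (c / real (Suc N))) * ((K / lam) ^ q * exp (- \<theta> * (real (Suc i) + real q * b))))
      \<le> measure (P 1) {u<..}"
    using J.l_pos by (smt (verit, best) mult_left_mono divide_nonneg_nonneg exp_ge_zero fact_ge_zero mult_nonneg_nonneg zero_le_power)
  have Ee: "E \<theta> = e * exp (L - lam)"
  proof -
    have "mgf (P 1) \<theta> = mgf \<eta> \<theta> * ennreal (exp (lam * (L / lam - 1)))"
      unfolding PJ L_def using mom_nonneg lam_pos by (intro J.mgf_compound_poisson mgf_jump \<theta>) auto
    also have "lam * (L / lam - 1) = L - lam"
      using lam_pos by (simp add: field_simps)
    finally show ?thesis
      using e by (simp add: E_def flip: ennreal_mult)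
  qed
  \<comment> \<open>Prescribing \<open>n + q\<close> jumps instead of summing over all is cheap: at
    \<open>n = nat \<lfloor>L\<rfloor>\<close> the ratio \<open>L ^ n / fact n\<close> is of size
    \<open>exp L\<close> up to a polynomial factor, and the further \<open>q\<close> jumps cost a
    power of \<open>n + q\<close>.\<close>
  have fact: "fact (n + q) \<le> exp 2 * L * (real n + real q) ^ q * L ^ n * exp (- L)"
  proof -
    have "fact (n + q) \<le> (fact n * (real n + real q) ^ q :: real)"
    proof (induction q)
      case (Suc q)
      have "fact (n + Suc q) = (real n + real (Suc q)) * fact (n + q)"
        by (simp add: algebra_simps)
      also have "\<dots> \<le> (real n + real (Suc q)) * (fact n * (real n + real (Suc q)) ^ q)"
        by (intro mult_left_mono order.trans[OF Suc.IH] power_mono) auto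
      finally show ?case
        by (simp add: algebra_simps)
    qed simp
    also have "fact n \<le> exp 1 * real n * (real n / exp 1) ^ n"
      using n by (intro fact_le_exp)
    also have "\<dots> \<le> exp 1 * L * (L ^ n * exp (1 - L))"
    proof (intro mult_mono)
      have "(real n / exp 1) ^ n = real n ^ n * exp (- real n)"
        by (simp add: power_divide exp_minus exp_of_nat_mult[symmetric] field_simps)
      also have "\<dots> \<le> L ^ n * exp (1 - L)"
        using n by (intro mult_mono power_mono) auto
      finally show "(real n / exp 1) ^ n \<le> L ^ n * exp (1 - L)" .
    qed (use n L in auto)
    finally have "fact (n + q) \<le> exp 1 * L * (L ^ n * exp (1 - L)) * (real n + real q) ^ q"
      by (simp add: mult_right_mono)
    also have "\<dots> = (exp 1 * exp 1) * L * (real n + real q) ^ q * L ^ n * exp (- L)"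
      by (simp add: exp_diff exp_minus divide_inverse)
    also have "exp 1 * exp 1 = exp (2::real)"
      by (simp flip: exp_add)
    finally show ?thesis .
  qed
  have "exp (- \<theta> * u) * E \<theta> * (K ^ q * exp (- \<theta> * (1 + real q * b)) / (exp 2 * L * (real n + real q) ^ q * (4 * (real N + 1)))) =
      exp (- \<theta> * u) * e * exp (- lam) * K ^ q * exp (- \<theta> * (1 + real q * b)) / (4 * (real N + 1)) * (L ^ n / (exp 2 * L * (real n + real q) ^ q * L ^ n * exp (- L)))"
    using L by (simp add: Ee exp_diff exp_minus field_simps)
  also have "\<dots> \<le> exp (- \<theta> * u) * e * exp (- lam) * K ^ q * exp (- \<theta> * (1 + real q * b)) / (4 * (real N + 1)) * (L ^ n / fact (n + q))"
    using fact L K_pos e n by (intro mult_left_mono divide_left_mono mult_pos_pos) auto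
  also have "\<dots> = J.pois (n + q) * ((exp (- \<theta> * (u - real i)) * (c / real (Suc N))) * ((K / lam) ^ q * exp (- \<theta> * (real (Suc i) + real q * b))))"
  proof -
    define d where "d = 4 * (real N + 1)"
    \<comment> \<open>The gain \<open>exp (\<theta> * i)\<close> from the window below
      \<open>u\<close> cancels the cost of bridging the gap, up to
      \<open>exp (- \<theta> * (1 + q * b))\<close>.\<close>
    have "exp (- \<theta> * u) * exp (- \<theta> * (1 + real q * b)) = exp (- \<theta> * (u - real i)) * exp (- \<theta> * (real (Suc i) + real q * b))"
      by (simp add: algebra_simps flip: exp_add)
    moreover have "lam ^ (n + q) * ((L / lam) ^ n * (K / lam) ^ q) = L ^ n * K ^ q"
      using lam_pos by (simp add: power_add power_divide)
    moreover have "c / real (Suc N) = (L / lam) ^ n * e / d"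
      by (simp add: c_def d_def add.commute)
    ultimately show ?thesis
      unfolding d_def[symmetric] by (simp add: ac_simps)
  qed
  also note main
  finally show ?thesis .
qed


text \<open>The mean of the jumps above \<open>b\<close> under the tilted law, plus three of their standard deviations, plus a margin
  that dominates the tilted remainder.\<close>

definition U :: "real \<Rightarrow> real" where
  "U \<theta> = mom 1 \<theta> + 3 * sqrt (mom 2 \<theta>) + exp ((b + 2) * \<theta>)"

lemma mom_0_at_top: "filterlim (mom 0) at_top at_top"
  by (rule filterlim_at_top_mono[OF _ mom_0_superexponential[of 1]]) real_asymp

text \<open>The factor lost in \<open>tail_lower_bound_at\<close> is an exponential of order
  \<open>sqrt L * ln L\<close>: the number \<open>q\<close> is of order \<open>sqrt L\<close>, and
  \<open>\<theta>\<close>, \<open>ln (n + q)\<close> and \<open>ln N\<close> are of order at most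
  \<open>ln L\<close>. The exponent \<open>3 / 4\<close> lies between \<open>1 / 2\<close> and the
  \<open>7 / 8\<close> of the early crossings.\<close>

lemma tail_lower_bound:
  "\<forall>\<^sub>F \<theta> in at_top. exp (- \<theta> * U \<theta>) * E \<theta> * exp (- (mom 0 \<theta> powr (3 / 4))) \<le> measure (P 1) {U \<theta><..}"
proof -
  obtain \<eta> C where \<eta>: "real_distribution \<eta>" "poisson_jumps (1 * lam) (uniform_measure \<rho> {b<..}) \<eta>"
      "P 1 = compound_poisson (1 * lam) (uniform_measure \<rho> {b<..}) \<eta>"
      "\<And>\<theta>. 0 \<le> \<theta> \<Longrightarrow> mgf \<eta> \<theta> \<le> ennreal (exp (C * exp ((b + 1) * \<theta>)))"
    using decomposition[of "{b<..}" 1] lam_pos unfolding lam_def by auto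
  obtain c where c: "0 \<le> c" "1 / 2 \<le> measure \<eta> {- c..}"
    using real_distribution_atLeast_half[OF \<eta>(1)] by blast
  obtain C2 where C2: "0 < C2" and ev_W: "\<forall>\<^sub>F \<theta> in at_top. \<exists>W\<ge>b + 1. (\<forall>x\<in>{0..W}. H x \<le> \<theta> * x) \<and>
      W \<le> C2 * mom 0 \<theta> \<and> mom 2 \<theta> \<le> C2 * W\<^sup>2 * mom 0 \<theta>"
    using second_moment_bound by blast
  define D where "D = \<bar>C\<bar> * exp (b + 1)"
  define a1 where "a1 = 3 * sqrt C2 + 1"
  define C3 where "C3 = 2 * a1 + 3"
  define C4 where "C4 = 2 * a1 * C2 + 2"
  have a1: "1 \<le> a1"
    using C2 by (simp add: a1_def)
  have C34: "0 < C3" "0 < C4"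
    using a1 C2 by (auto simp: C3_def C4_def add_pos_pos)
  define lK where "lK = \<bar>ln K\<bar>"
  have b0: "0 < b"
    using b_ge by simp
  have "\<forall>\<^sub>F L in at_top. 2 + ln L + C3 * sqrt L * ln ((C3 + 1) * L) + C3 * sqrt L * lK + ln (4 * (C4 * L\<^sup>2)) +
      ln L * (1 + C3 * sqrt L * b) \<le> L powr (3 / 4)"
    using C34 b0 by real_asymp
  then have ev_G: "\<forall>\<^sub>F \<theta> in at_top. 2 + ln (mom 0 \<theta>) + C3 * sqrt (mom 0 \<theta>) * ln ((C3 + 1) * mom 0 \<theta>) +
      C3 * sqrt (mom 0 \<theta>) * lK + ln (4 * (C4 * (mom 0 \<theta>)\<^sup>2)) + ln (mom 0 \<theta>) * (1 + C3 * sqrt (mom 0 \<theta>) * b) \<le> mom 0 \<theta> powr (3 / 4)"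
    using mom_0_at_top by (rule eventually_compose_filterlim)
  have c1: "0 < c + 1"
    using c by simp
  \<comment> \<open>\<open>D * exp ((b + 1) * \<theta>)\<close> bounds the logarithm of the
    remainder's moment at \<open>\<theta> + 1\<close>. The margin
    \<open>exp ((b + 2) * \<theta>)\<close> exceeds it by at least \<open>exp \<theta> - D\<close>,
    which outgrows every multiple of \<open>\<theta>\<close>.\<close>
  have ev_R: "\<forall>\<^sub>F \<theta>::real in at_top. D \<le> exp \<theta> \<and> exp (- (exp \<theta> - D)) + exp (- exp \<theta>) \<le> exp (- \<theta> * (c + 1)) / 4"
  proof (intro eventually_conj)
    show "\<forall>\<^sub>F \<theta> in at_top. D \<le> exp \<theta>"
      by real_asymp
    have "\<forall>\<^sub>F \<theta> in at_top. \<bar>D\<bar> - exp \<theta> \<le> - \<theta> * (c + 1) - 3"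
      using c1 by real_asymp
    then show "\<forall>\<^sub>F \<theta> in at_top. exp (- (exp \<theta> - D)) + exp (- exp \<theta>) \<le> exp (- \<theta> * (c + 1)) / 4"
    proof eventually_elim
      case (elim \<theta>)
      have "exp 1 ^ 3 \<ge> (2::real) ^ 3"
        using exp_ge_add_one_self[of 1] by (intro power_mono) auto
      then have 3: "exp (-3) \<le> (1 / 8 :: real)"
        by (simp add: exp_minus field_simps flip: exp_of_nat_mult)
      have "exp y \<le> exp (- \<theta> * (c + 1)) / 8" if "y \<le> \<bar>D\<bar> - exp \<theta>" for y
      proof -
        have "exp y \<le> exp (- \<theta> * (c + 1) + -3)"
          using that elim by simp
        also have "\<dots> = exp (- \<theta> * (c + 1)) * exp (-3)"
          by (rule exp_add)
        also have "\<dots> \<le> exp (- \<theta> * (c + 1)) * (1 / 8)"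
          by (rule mult_left_mono[OF 3]) simp
        finally show ?thesis
          by simp
      qed
      from this[of "- (exp \<theta> - D)"] this[of "- exp \<theta>"] show ?case
        by (simp add: D_def)
    qed
  qed
  show ?thesis
    using ev_W ev_G ev_R mom_0_superexponential[of "2 * (b + 2)"] eventually_ge_at_top[of 1]
  proof eventually_elim
    case (elim \<theta>)
    define L where "L = mom 0 \<theta>"
    define R where "R = exp ((b + 2) * \<theta>)"
    have \<theta>: "0 \<le> \<theta>" "1 \<le> \<theta>"
      using elim by auto
    from elim(1) obtain W where W: "b + 1 \<le> W" "\<And>x. 0 \<le> x \<Longrightarrow> x \<le> W \<Longrightarrow> H x \<le> \<theta> * x"
        "W \<le> C2 * L" "mom 2 \<theta> \<le> C2 * W\<^sup>2 * L"
      by (auto simp: L_def)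
    have W1: "1 \<le> W"
      using W b_ge by simp
    \<comment> \<open>From \<open>mom 0\<close> exceeding
      \<open>exp (2 * (b + 2) * \<theta>)\<close>: the margin for the remainder is no larger than
      the scale \<open>sqrt L\<close> of the jump count.\<close>
    have RL: "R \<le> sqrt L"
    proof (rule real_le_rsqrt)
      have "R\<^sup>2 = exp (2 * ((b + 2) * \<theta>))"
        unfolding R_def by (rule exp_double[symmetric])
      then show "R\<^sup>2 \<le> L"
        using elim(4) by (simp only: L_def mult.assoc)
    qed
    have R1: "exp \<theta> \<le> R" "1 \<le> R"
      using \<theta> b_ge by (auto simp: R_def algebra_simps)
    have sL: "1 \<le> sqrt L"
      using RL R1 by linarith
    then have L1: "1 \<le> L"
      by (simp add: real_le_rsqrt real_sqrt_ge_1_iff)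
    have sLL: "sqrt L \<le> L"
      using mult_left_mono[OF sL, of "sqrt L"] L1 by simp
    have "exp \<theta> \<le> L"
      using R1 RL sLL by linarith
    then have \<theta>L: "\<theta> \<le> ln L"
      using L1 by (simp add: ln_ge_iff)
    have "mgf \<eta> \<theta> \<noteq> \<top>"
      using \<eta>(4)[OF \<theta>(1)] by (auto simp: top_unique)
    then obtain e where e: "mgf \<eta> \<theta> = ennreal e" "0 \<le> e"
      by (cases "mgf \<eta> \<theta>" rule: ennreal_cases) auto
    have e_ge: "exp (- \<theta> * c) * (1 / 2) \<le> e"
      using mgf_ge[OF \<eta>(1) c(2) \<theta>(1)] e by simp
    have R: "ennreal (e / 2) \<le> (\<integral>\<^sup>+y. ennreal (exp (\<theta> * y)) * indicator {- R..R} y \<partial>\<eta>)"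
    proof (rule tilted_center_mass[OF \<eta>(1) \<theta>(1) e])
      have "C * exp ((b + 1) * (\<theta> + 1)) \<le> D * exp ((b + 1) * \<theta>)"
      proof -
        have "exp ((b + 1) * (\<theta> + 1)) = exp (b + 1) * exp ((b + 1) * \<theta>)"
          by (simp add: algebra_simps flip: exp_add)
        then show ?thesis
          unfolding D_def by (simp add: mult_right_mono mult.assoc)
      qed
      then have "ennreal (exp (C * exp ((b + 1) * (\<theta> + 1)))) \<le> ennreal (exp (D * exp ((b + 1) * \<theta>)))"
        by (intro ennreal_leI) simp
      then show "mgf \<eta> (\<theta> + 1) \<le> ennreal (exp (D * exp ((b + 1) * \<theta>)))"
        using \<eta>(4)[of "\<theta> + 1"] \<theta> by (meson add_nonneg_nonneg order.trans zero_le_one)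
      have "(exp \<theta> - D) * 1 \<le> (exp \<theta> - D) * exp ((b + 1) * \<theta>)"
        using elim(3) b_ge \<theta> by (intro mult_left_mono) auto
      also have "\<dots> = R - D * exp ((b + 1) * \<theta>)"
        by (simp add: R_def algebra_simps flip: exp_add)
      finally have 1: "exp (- R + D * exp ((b + 1) * \<theta>)) \<le> exp (- (exp \<theta> - D))"
        by simp
      have "exp \<theta> \<le> \<theta> * R"
        using R1 \<theta> mult_mono[of 1 \<theta> "exp \<theta>" R] by simp
      then have 2: "exp (- \<theta> * R) \<le> exp (- exp \<theta>)"
        by simp
      have "exp (- R) * exp (D * exp ((b + 1) * \<theta>)) + exp (- \<theta> * R) \<le> exp (- \<theta> * (c + 1)) / 4"
        using 1 2 elim(3) unfolding exp_add[symmetric] by linarith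
      also have "\<dots> \<le> exp (- \<theta> * c) / 4"
        using \<theta> by (intro divide_right_mono) (auto simp: algebra_simps)
      also have "\<dots> \<le> e / 2"
        using e_ge by simp
      finally show "exp (- R) * exp (D * exp ((b + 1) * \<theta>)) + exp (- \<theta> * R) \<le> e / 2" .
    qed simp
    define A where "A = 3 * sqrt (mom 2 \<theta>) + R"
    define N where "N = nat \<lceil>2 * A\<rceil>"
    define q where "q = nat \<lceil>(2 * A + 2) / W\<rceil>"
    define n where "n = nat \<lfloor>L\<rfloor>"
    have "U \<theta> = mom 1 \<theta> + A"
      by (simp add: U_def A_def R_def)
    then have main: "exp (- \<theta> * U \<theta>) * E \<theta> * (K ^ q * exp (- \<theta> * (1 + real q * b)) / (exp 2 * L * (real n + real q) ^ q * (4 * (real N + 1))))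
        \<le> measure (P 1) {U \<theta><..}"
      using tail_lower_bound_at[OF \<theta>(1) _ _ _ _ e R, of W] \<eta>(2,3) L1 R1 W b_ge
      by (simp add: L_def A_def N_def q_def n_def)
    have A: "0 \<le> A" "A \<le> a1 * W * sqrt L"
    proof -
      show "0 \<le> A"
        using mom_nonneg R1 by (simp add: A_def)
      have "sqrt (mom 2 \<theta>) \<le> sqrt (C2 * W\<^sup>2 * L)"
        using W by simp
      also have "\<dots> = sqrt C2 * W * sqrt L"
        using W1 by (simp add: real_sqrt_mult)
      finally have "sqrt (mom 2 \<theta>) \<le> sqrt C2 * W * sqrt L" .
      moreover have "R \<le> 1 * W * sqrt L"
        using RL sL W1 mult_mono[of 1 W R "sqrt L"] R1 by simp
      ultimately show "A \<le> a1 * W * sqrt L"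
        by (simp add: A_def a1_def algebra_simps)
    qed
    \<comment> \<open>The distance \<open>A\<close> is at most of order \<open>W * sqrt L\<close>,
      so about \<open>sqrt L\<close> jumps of length \<open>W\<close> bridge it.\<close>
    have q: "real q \<le> C3 * sqrt L" "1 \<le> q"
    proof -
      have pos: "0 < (2 * A + 2) / W"
        using A W1 by simp
      then have "1 \<le> \<lceil>(2 * A + 2) / W\<rceil>"
        by (simp add: le_ceiling_iff)
      then show "1 \<le> q"
        by (simp add: q_def le_nat_iff)
      have "real q \<le> (2 * A + 2) / W + 1"
        using pos unfolding q_def by linarith
      also have "(2 * A + 2) / W \<le> 2 * a1 * sqrt L + 2"
      proof -
        have "2 * A + 2 \<le> 2 * (a1 * W * sqrt L) + 2 * W"
          using A W1 by simp
        also have "\<dots> = (2 * a1 * sqrt L + 2) * W"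
          by (simp add: algebra_simps)
        finally show ?thesis
          using W1 by (simp add: divide_le_eq)
      qed
      also have "2 * a1 * sqrt L + 2 + 1 \<le> C3 * sqrt L"
        using sL by (simp add: C3_def algebra_simps)
      finally show "real q \<le> C3 * sqrt L"
        by simp
    qed
    have nq: "0 < real n + real q" "real n + real q \<le> (C3 + 1) * L"
    proof -
      show "0 < real n + real q"
        using q by simp
      have "real n \<le> L"
        using L1 by (simp add: n_def)
      moreover have "C3 * sqrt L \<le> C3 * L"
        using C34 sLL by (intro mult_left_mono) auto
      ultimately show "real n + real q \<le> (C3 + 1) * L"
        using q by (simp add: algebra_simps)
    qed
    have N: "real N + 1 \<le> C4 * L\<^sup>2"
    proof -
      have "real N + 1 \<le> 2 * A + 2"
        using A unfolding N_def by linarith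
      also have "\<dots> \<le> 2 * (a1 * (C2 * L) * L) + 2 * L\<^sup>2"
      proof (intro add_mono mult_left_mono)
        have "A \<le> a1 * W * sqrt L"
          by (rule A)
        also have "\<dots> \<le> a1 * (C2 * L) * L"
          using a1 W C2 L1 sLL W1 by (intro mult_mono) auto
        finally show "A \<le> a1 * (C2 * L) * L" .
        show "2 \<le> 2 * L\<^sup>2"
          using L1 by simp
      qed simp
      also have "\<dots> = C4 * L\<^sup>2"
        by (simp add: C4_def power2_eq_square algebra_simps)
      finally show ?thesis .
    qed
    define G where "G = K ^ q * exp (- \<theta> * (1 + real q * b)) / (exp 2 * L * (real n + real q) ^ q * (4 * (real N + 1)))"
    have Gpos: "0 < G"
      unfolding G_def using K_pos L1 nq by simp
    have "ln G = real q * ln K - \<theta> * (1 + real q * b) - (2 + ln L + real q * ln (real n + real q) + ln (4 * (real N + 1)))"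
      unfolding G_def using K_pos L1 nq
      by (simp add: ln_div ln_mult ln_realpow)
    moreover have "- (real q * ln K) \<le> C3 * sqrt L * lK"
    proof -
      have "real q * (- ln K) \<le> real q * lK"
        by (intro mult_left_mono) (auto simp: lK_def)
      also have "\<dots> \<le> C3 * sqrt L * lK"
        by (rule mult_right_mono[OF q(1)]) (simp add: lK_def)
      finally show ?thesis
        by simp
    qed
    moreover have "\<theta> * (1 + real q * b) \<le> ln L * (1 + C3 * sqrt L * b)"
      using \<theta>L \<theta> q b_ge by (intro mult_mono add_mono mult_right_mono) auto
    moreover have "real q * ln (real n + real q) \<le> C3 * sqrt L * ln ((C3 + 1) * L)"
      using q nq L1 C34 by (intro mult_mono) auto
    moreover have "ln (4 * (real N + 1)) \<le> ln (4 * (C4 * L\<^sup>2))"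
      using N by simp
    ultimately have "- (L powr (3 / 4)) \<le> ln G"
      using elim(2) unfolding L_def[symmetric] by linarith
    then have "exp (- (L powr (3 / 4))) \<le> G"
      using Gpos by (simp add: ln_ge_iff)
    then have "exp (- \<theta> * U \<theta>) * E \<theta> * exp (- (L powr (3 / 4))) \<le> exp (- \<theta> * U \<theta>) * E \<theta> * G"
      using E_nonneg by (intro mult_left_mono) auto
    also have "\<dots> \<le> measure (P 1) {U \<theta><..}"
      using main by (simp only: G_def)
    finally show ?case
      by (simp only: L_def)
  qed
qed

text \<open>Multiplying by the mass of \<open>S\<close> undoes the normalisation, so that the added
  jump is integrated against \<open>\<rho>\<close>, whose density can be shifted.\<close>

lemma nn_integral_add_jump:
  assumes S: "S \<in> sets borel" "S \<subseteq> {b<..}" "0 < measure \<rho> S" and B: "B \<in> sets borel"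
  shows "ennreal (measure \<rho> S * measure (uniform_measure \<rho> S \<star> P 1) B) =
    (\<integral>\<^sup>+x. (\<integral>\<^sup>+y. indicator B (x + y) \<partial>P 1) * indicator S x \<partial>\<rho>)"
proof -
  interpret P: real_distribution "P 1" by (rule P) simp
  have fin: "emeasure \<rho> S \<noteq> \<infinity>"
    by (rule emeasure_S_finite[OF S(1,2)])
  have pos: "emeasure \<rho> S \<noteq> 0"
    using S(3) by (auto simp: measure_def)
  have \<mu>: "real_distribution (uniform_measure \<rho> S)"
    by (rule char_uniform_measure[OF levy S(1) fin pos])
  interpret \<mu>: real_distribution "uniform_measure \<rho> S" by (rule \<mu>)
  interpret C: real_distribution "uniform_measure \<rho> S \<star> P 1"
    by (intro real_distribution_convolution \<mu> P.real_distribution_axioms)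
  note [measurable] = S(1) B
  have "emeasure (uniform_measure \<rho> S \<star> P 1) B = (\<integral>\<^sup>+x. \<integral>\<^sup>+y. indicator B (x + y) \<partial>P 1 \<partial>uniform_measure \<rho> S)"
    by (rule convolution_emeasure') (auto simp: P.finite_measure_axioms \<mu>.finite_measure_axioms)
  also have "\<dots> = (\<integral>\<^sup>+x. (\<integral>\<^sup>+y. indicator B (x + y) \<partial>P 1) * indicator S x \<partial>\<rho>) / emeasure \<rho> S"
    by (rule nn_integral_uniform_measure) (auto intro!: P.borel_measurable_nn_integral)
  finally have "emeasure \<rho> S * emeasure (uniform_measure \<rho> S \<star> P 1) B =
      (\<integral>\<^sup>+x. (\<integral>\<^sup>+y. indicator B (x + y) \<partial>P 1) * indicator S x \<partial>\<rho>)"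
    using mult_divide_eq_ennreal[OF pos fin[unfolded infinity_ennreal_def]]
    by (simp only: ennreal_times_divide mult.commute[of "emeasure \<rho> S"])
  then show ?thesis
    using fin by (simp add: C.emeasure_eq_measure emeasure_eq_ennreal_measure ennreal_mult)
qed

text \<open>Lengthening a jump \<open>x \<le> V\<close> by \<open>s\<close> raises \<open>H\<close>
  by at most \<open>s * h (V + 1)\<close>, hence by at most 1, by convexity. The prefactor
  \<open>h\<close> in the density only grows, so the density drops by at most a factor
  \<open>exp 1\<close>.\<close>

lemma jump_shift:
  assumes V: "b \<le> V" and s: "0 \<le> s" "s \<le> 1" "s * h (V + 1) \<le> 1" and B: "B \<in> sets borel"
    and pos: "0 < measure \<rho> {b<..V}"
  shows "measure \<rho> {b<..V} * measure (uniform_measure \<rho> {b<..V} \<star> P 1) {x. x + s \<in> B} \<le>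
    exp 1 * (measure \<rho> {b<..V + 1} * measure (uniform_measure \<rho> {b<..V + 1} \<star> P 1) B)"
proof -
  interpret P: real_distribution "P 1" by (rule P) simp
  note [measurable] = B
  have B': "{x. x + s \<in> B} \<in> sets borel"
    by measurable
  have pos': "0 < measure \<rho> {b<..V + 1}"
  proof -
    have "measure \<rho> {b<..V} \<le> measure \<rho> {b<..V + 1}"
    proof (rule measure_mono_fmeasurable)
      have "emeasure \<rho> {b<..V + 1} \<noteq> \<infinity>"
        by (rule emeasure_S_finite) auto
      then show "{b<..V + 1} \<in> fmeasurable \<rho>"
        by (simp add: fmeasurable_def less_top)
    qed auto
    then show ?thesis
      using pos by simp
  qed
  define g where "g x = (\<integral>\<^sup>+y. indicator B (x + y) \<partial>P 1)" for x
  have g [measurable]: "g \<in> borel_measurable borel"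
    unfolding g_def by (rule P.borel_measurable_nn_integral) simp
  have "ennreal (measure \<rho> {b<..V} * measure (uniform_measure \<rho> {b<..V} \<star> P 1) {x. x + s \<in> B}) =
      (\<integral>\<^sup>+x. g (x + s) * indicator {b<..V} x \<partial>\<rho>)"
  proof -
    have "{b<..V} \<subseteq> {b<..}"
      by auto
    from nn_integral_add_jump[OF _ this pos B'] show ?thesis
      by (simp add: g_def indicator_def ac_simps)
  qed
  also have "\<dots> = (\<integral>\<^sup>+x. g (x + s) * ennreal (dens x) * indicator {b<..V} x \<partial>lborel)"
    by (rule nn_integral_rho) auto
  also have "\<dots> \<le> (\<integral>\<^sup>+x. ennreal (exp 1) * (g (s + 1 * x) * ennreal (dens (s + 1 * x)) * indicator {b<..V + 1} (s + 1 * x)) \<partial>lborel)"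
  proof (intro nn_integral_mono)
    fix x
    show "g (x + s) * ennreal (dens x) * indicator {b<..V} x \<le>
        ennreal (exp 1) * (g (s + 1 * x) * ennreal (dens (s + 1 * x)) * indicator {b<..V + 1} (s + 1 * x))"
    proof (cases "x \<in> {b<..V}")
      case True
      have "s * h (x + s) \<le> s * h (V + 1)"
        using True s by (intro mult_left_mono monoD[OF h_mono]) auto
      then have "H (x + s) \<le> H x + 1"
        using H_tangent[of "x + s" x] s by (simp add: algebra_simps)
      then have "exp (- H x) \<le> exp 1 * exp (- H (x + s))"
        by (simp flip: exp_add)
      then have "K * h x * exp (- H x) \<le> K * h (x + s) * (exp 1 * exp (- H (x + s)))"
        using K_pos h_pos[of x] h_pos[of "x + s"] s by (intro mult_mono monoD[OF h_mono]) auto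
      then have "dens x \<le> exp 1 * dens (x + s)"
        by (simp add: dens_def ac_simps)
      then have "ennreal (dens x) \<le> ennreal (exp 1) * ennreal (dens (x + s))"
        using dens_pos[of "x + s"] by (simp add: ennreal_leI flip: ennreal_mult)
      from mult_left_mono[OF this, of "g (x + s)"] show ?thesis
        using True s by (simp add: ac_simps)
    qed simp
  qed
  also have "\<dots> = ennreal (exp 1) * (\<integral>\<^sup>+x. g (s + 1 * x) * ennreal (dens (s + 1 * x)) * indicator {b<..V + 1} (s + 1 * x) \<partial>lborel)"
    by (rule nn_integral_cmult) measurable
  also have "(\<integral>\<^sup>+x. g (s + 1 * x) * ennreal (dens (s + 1 * x)) * indicator {b<..V + 1} (s + 1 * x) \<partial>lborel) =
      (\<integral>\<^sup>+x. g x * ennreal (dens x) * indicator {b<..V + 1} x \<partial>lborel)"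
    by (subst nn_integral_real_affine[where c=1 and t=s and f="\<lambda>x. g x * ennreal (dens x) * indicator {b<..V + 1} x"]) auto
  also have "\<dots> = (\<integral>\<^sup>+x. g x * indicator {b<..V + 1} x \<partial>\<rho>)"
    by (rule nn_integral_rho[symmetric]) auto
  also have "\<dots> = ennreal (measure \<rho> {b<..V + 1} * measure (uniform_measure \<rho> {b<..V + 1} \<star> P 1) B)"
    unfolding g_def by (rule nn_integral_add_jump[symmetric, OF _ _ pos' B]) auto
  finally show ?thesis
    by (simp flip: ennreal_mult')
qed

end

section \<open>Crossing times\<close>

context superexponential_levy
begin

definition sup_event :: "real \<Rightarrow> 'a set" where
  "sup_event u = {\<omega>\<in>space M. u < (SUP t\<in>{0..1}. X t \<omega>)}"

text \<open>Paths are bounded on \<open>{0..1}\<close>, so a supremum above \<open>u\<close> means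
  that some value is above \<open>u\<close>.\<close>

lemma sup_event_eq: "sup_event u = {\<omega>\<in>space M. \<exists>t\<in>{0..1}. u < X t \<omega>}"
proof -
  have "u < (SUP t\<in>{0..1}. X t \<omega>) \<longleftrightarrow> (\<exists>t\<in>{0..1}. u < X t \<omega>)" if "\<omega> \<in> space M" for \<omega>
    using process that by (intro less_cSUP_iff cadlag_bdd_above) (auto simp: levy_process_def)
  then show ?thesis
    by (auto simp: sup_event_def)
qed

lemma P_eq_prob: "0 \<le> t \<Longrightarrow> measure (P t) {u<..} = measure M {\<omega>\<in>space M. u < X t \<omega>}"
proof -
  assume t: "0 \<le> t"
  have "X t \<in> borel_measurable M"
    using process t by (simp add: levy_process_def)
  then show ?thesis
    unfolding P_def by (subst measure_distr) (auto intro!: arg_cong[where f="measure M"])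
qed

text \<open>Lengthening one jump of size at most \<open>V\<close> by \<open>j d\<close>, for any \<open>j \<le> J\<close>, costs at most a factor \<open>e\<close> but moves
  \<open>X 1\<close> from \<open>(u - d, u]\<close> to the \<open>j\<close>-th of \<open>J\<close> disjoint intervals above \<open>u\<close>.\<close>

lemma prob_just_below_level:
  "\<forall>\<^sub>F \<theta> in at_top. measure (P 1) {U \<theta> - exp (- \<theta>)<..U \<theta>} \<le>
    (16 * exp 1 / (exp (\<theta> / 4) - 1) + (8 * exp 1 / (exp (\<theta> / 4) - 1) + mom 0 \<theta>) * exp (mom 0 \<theta> powr (3 / 4) - mom 0 \<theta> / 16)) *
    measure (P 1) {U \<theta><..}"
  using tail_lower_bound upper_jump_bound mom_0_superexponential[of 1] eventually_ge_at_top[of 4]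
proof eventually_elim
  case (elim \<theta>)
  define L where "L = mom 0 \<theta>"
  define u where "u = U \<theta>"
  define d where "d = exp (- \<theta>)"
  \<comment> \<open>The longest shift is \<open>J * d \<le> exp (- 3 * \<theta> / 4)\<close>, and
    \<open>h (V + 1) \<le> exp (\<theta> / 2)\<close>, so \<open>jump_shift\<close> applies to all
    shifts, while \<open>J\<close> tends to infinity.\<close>
  define J where "J = nat \<lfloor>exp (\<theta> / 4)\<rfloor>"
  define p where "p = measure (P 1) {u<..}"
  interpret P: real_distribution "P 1" by (rule P) simp
  have \<theta>: "0 \<le> \<theta>" "4 \<le> \<theta>"
    using elim by auto
  have L1: "exp \<theta> \<le> L"
    using elim by (simp add: L_def)
  have L0: "0 < L"
    using L1 exp_gt_zero[of \<theta>] by linarith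
  have low: "exp (- \<theta> * u) * E \<theta> \<le> p * exp (L powr (3 / 4))"
  proof -
    have "exp (- \<theta> * u) * E \<theta> = exp (- \<theta> * u) * E \<theta> * exp (- (L powr (3 / 4))) * exp (L powr (3 / 4))"
      by (simp add: exp_minus)
    also have "\<dots> \<le> p * exp (L powr (3 / 4))"
      using elim(1) by (intro mult_right_mono) (auto simp: p_def u_def L_def)
    finally show ?thesis .
  qed
  from elim(2) obtain V where V: "b \<le> V" "h (V + 1) \<le> exp (\<theta> / 2)"
      "(\<integral>\<^sup>+x. ennreal (exp (\<theta> * x)) * indicator {V<..} x \<partial>\<rho>) \<le> ennreal (L / 2)"
    by (auto simp: L_def)
  \<comment> \<open>The mean number of jumps in \<open>{b<..W}\<close> under tilting. The choice of
    \<open>V\<close> makes it at least \<open>L / 2\<close> for \<open>W = V\<close>.\<close>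
  define I where "I W = (\<integral>\<^sup>+x. ennreal (exp (\<theta> * x)) * indicator {b<..W} x \<partial>\<rho>)" for W
  have I_le: "I W \<le> ennreal L" for W
    unfolding I_def L_def mom_0_nn_integral[OF \<theta>(1), symmetric]
    by (intro nn_integral_mono) (auto split: split_indicator)
  define l where "l W = enn2real (I W)" for W
  have Il: "I W = ennreal (l W)" for W
    unfolding l_def using I_le[of W] by (simp add: le_less_trans[OF _ ennreal_less_top])
  have l_le: "l W \<le> L" for W
    using I_le[of W] L0 unfolding Il by simp
  have lV: "L / 2 \<le> l V"
  proof -
    have "ennreal L = (\<integral>\<^sup>+x. ennreal (exp (\<theta> * x)) * indicator {b<..V} x + ennreal (exp (\<theta> * x)) * indicator {V<..} x \<partial>\<rho>)"
      unfolding L_def mom_0_nn_integral[OF \<theta>(1), symmetric] using V(1)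
      by (intro nn_integral_cong) (auto split: split_indicator)
    also have "\<dots> = I V + (\<integral>\<^sup>+x. ennreal (exp (\<theta> * x)) * indicator {V<..} x \<partial>\<rho>)"
      unfolding I_def by (intro nn_integral_add) auto
    also have "\<dots> \<le> ennreal (l V) + ennreal (L / 2)"
      using V(3) by (intro add_mono) (auto simp: Il)
    finally show ?thesis
      using L0 by (simp add: l_def flip: ennreal_plus)
  qed
  have l_mono: "l V \<le> l (V + 1)"
  proof -
    have "I V \<le> I (V + 1)"
      unfolding I_def by (intro nn_integral_mono) (auto split: split_indicator)
    then show ?thesis
      unfolding Il by (simp add: l_def)
  qed
  \<comment> \<open>Only the jumps up to \<open>W\<close> are singled out; larger ones stay in the
    remainder. The whole law, and hence \<open>E \<theta>\<close>, is the same for every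
    \<open>W\<close>.\<close>
  have jumps: "\<exists>\<eta>. poisson_jumps (measure \<rho> {b<..W}) (uniform_measure \<rho> {b<..W}) \<eta> \<and>
      P 1 = compound_poisson (measure \<rho> {b<..W}) (uniform_measure \<rho> {b<..W}) \<eta> \<and>
      mgf (uniform_measure \<rho> {b<..W}) \<theta> = ennreal (l W / measure \<rho> {b<..W}) \<and> 0 < measure \<rho> {b<..W}"
    if W: "0 < l W" for W
  proof -
    have S: "{b<..W} \<in> sets borel" "{b<..W} \<subseteq> {b<..}"
      by auto
    have fin: "emeasure \<rho> {b<..W} \<noteq> \<infinity>"
      by (rule emeasure_S_finite) auto
    have pos: "emeasure \<rho> {b<..W} \<noteq> 0"
    proof
      assume "emeasure \<rho> {b<..W} = 0"
      then have "AE x in \<rho>. x \<notin> {b<..W}"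
        by (intro AE_I'[of "{b<..W}"]) (auto simp: null_sets_def)
      then have "I W = 0"
        unfolding I_def by (subst nn_integral_0_iff_AE) auto
      then show False
        using W by (simp add: l_def)
    qed
    have mpos: "0 < measure \<rho> {b<..W}"
      using pos fin by (metis emeasure_eq_ennreal_measure ennreal_0 infinity_ennreal_def measure_nonneg order_le_less)
    from decomposition[OF S mpos, of 1] obtain \<eta> where
      "poisson_jumps (measure \<rho> {b<..W}) (uniform_measure \<rho> {b<..W}) \<eta>"
      "P 1 = compound_poisson (measure \<rho> {b<..W}) (uniform_measure \<rho> {b<..W}) \<eta>"
      by auto
    moreover have "mgf (uniform_measure \<rho> {b<..W}) \<theta> = ennreal (l W / measure \<rho> {b<..W})"
      using W by (intro mgf_uniform_measure[OF levy _ fin pos] Il[unfolded I_def]) auto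
    ultimately show ?thesis
      using mpos by blast
  qed
  have l0: "0 < l V" "0 < l (V + 1)"
    using lV L0 l_mono by linarith+
  define Q where "Q W B = measure \<rho> {b<..W} * measure (uniform_measure \<rho> {b<..W} \<star> P 1) B" for W B
  have mV: "0 < measure \<rho> {b<..V}"
    using jumps[OF l0(1)] by blast
  have d: "0 < d" "d \<le> 1"
    using \<theta> by (auto simp: d_def)
  have J: "real J \<le> exp (\<theta> / 4)" "exp (\<theta> / 4) - 1 \<le> real J"
  proof -
    have "real J = of_int \<lfloor>exp (\<theta> / 4)\<rfloor>"
      by (simp add: J_def)
    then show "real J \<le> exp (\<theta> / 4)" "exp (\<theta> / 4) - 1 \<le> real J"
      by linarith+
  qed
  have e1: "1 < exp (\<theta> / 4)"
    using \<theta> by simp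
  then have J0: "0 < real J"
    using J by linarith
  have Jd: "real J * d \<le> 1"
  proof -
    have "real J * d \<le> exp (\<theta> / 4) * exp (- \<theta>)"
      using J by (simp add: d_def)
    also have "\<dots> \<le> 1"
      using \<theta> by (simp flip: exp_add)
    finally show ?thesis .
  qed
  have Jdh: "real J * d * h (V + 1) \<le> 1"
  proof -
    have "real J * d * h (V + 1) \<le> exp (\<theta> / 4) * exp (- \<theta>) * exp (\<theta> / 2)"
      using J V h_pos[of "V + 1"] by (intro mult_mono) (auto simp: d_def)
    also have "\<dots> \<le> 1"
      using \<theta> by (simp flip: exp_add)
    finally show ?thesis .
  qed
  \<comment> \<open>\<open>Ij 0\<close> is the interval just below the level; the intervals with
    \<open>1 \<le> j\<close> are disjoint and lie above \<open>u\<close>.\<close>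
  define Ij where "Ij j = {u + (real j - 1) * d<..u + real j * d}" for j :: nat
  have Ij_meas [measurable]: "Ij j \<in> sets borel" for j
    by (simp add: Ij_def)
  have shift: "Q V (Ij 0) \<le> exp 1 * Q (V + 1) (Ij j)" if j: "j \<le> J" for j
  proof -
    have jd: "real j * d \<le> real J * d"
      using j d by (intro mult_right_mono) auto
    then have 1: "real j * d \<le> 1"
      using Jd by linarith
    have "real j * d * h (V + 1) \<le> real J * d * h (V + 1)"
      by (rule mult_right_mono[OF jd]) (simp add: h_pos less_imp_le)
    then have 2: "real j * d * h (V + 1) \<le> 1"
      using Jdh by linarith
    have "{x. x + real j * d \<in> Ij j} = Ij 0"
      by (auto simp: Ij_def algebra_simps)
    then show ?thesis
      using jump_shift[OF V(1) _ 1 2 Ij_meas[of j] mV] d by (simp add: Q_def)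
  qed
  have sumQ: "(\<Sum>j\<in>{1..J}. Q (V + 1) (Ij j)) \<le> Q (V + 1) {u<..}"
  proof -
    from jumps[OF l0(2)] obtain \<eta> where "poisson_jumps (measure \<rho> {b<..V + 1}) (uniform_measure \<rho> {b<..V + 1}) \<eta>"
      by blast
    then interpret N: poisson_jumps "measure \<rho> {b<..V + 1}" "uniform_measure \<rho> {b<..V + 1}" \<eta> .
    interpret C: real_distribution "uniform_measure \<rho> {b<..V + 1} \<star> P 1"
      by (intro real_distribution_convolution N.mu P.real_distribution_axioms)
    have "disjoint_family_on Ij {1..J}"
      unfolding disjoint_family_on_def
    proof (intro ballI impI)
      fix i j :: nat assume "i \<noteq> j"
      have *: "Ij i \<inter> Ij j = {}" if "i < j" for i j
      proof -
        have "real i * d \<le> (real j - 1) * d"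
          using that d by (intro mult_right_mono) auto
        then show ?thesis
          by (auto simp: Ij_def)
      qed
      show "Ij i \<inter> Ij j = {}"
        using \<open>i \<noteq> j\<close> *[of i j] *[of j i] by (cases i j rule: linorder_cases) auto
    qed
    then have "(\<Sum>j\<in>{1..J}. measure (uniform_measure \<rho> {b<..V + 1} \<star> P 1) (Ij j)) =
        measure (uniform_measure \<rho> {b<..V + 1} \<star> P 1) (\<Union>j\<in>{1..J}. Ij j)"
      by (intro C.finite_measure_finite_Union[symmetric]) auto
    also have "\<dots> \<le> measure (uniform_measure \<rho> {b<..V + 1} \<star> P 1) {u<..}"
    proof (rule C.finite_measure_mono)
      show "(\<Union>j\<in>{1..J}. Ij j) \<subseteq> {u<..}"
      proof
        fix x assume "x \<in> (\<Union>j\<in>{1..J}. Ij j)"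
        then obtain j where j: "1 \<le> j" "x \<in> Ij j"
          by auto
        have "0 \<le> (real j - 1) * d"
          using j d by simp
        then show "x \<in> {u<..}"
          using j by (simp add: Ij_def)
      qed
    qed simp
    finally show ?thesis
      unfolding Q_def sum_distrib_left[symmetric] by (intro mult_left_mono) auto
  qed
  have "real J * Q V (Ij 0) = (\<Sum>j\<in>{1..J}. Q V (Ij 0))"
    by simp
  also have "\<dots> \<le> (\<Sum>j\<in>{1..J}. exp 1 * Q (V + 1) (Ij j))"
    by (intro sum_mono shift) simp
  also have "\<dots> \<le> exp 1 * Q (V + 1) {u<..}"
    using sumQ by (simp add: sum_distrib_left[symmetric])
  finally have "real J * Q V (Ij 0) \<le> exp 1 * Q (V + 1) {u<..}" .
  then have 1: "Q V (Ij 0) \<le> exp 1 * Q (V + 1) {u<..} / real J"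
    using J0 by (simp add: pos_le_divide_eq mult.commute)
  have 2: "Q (V + 1) {u<..} \<le> 4 * l (V + 1) * p + exp (- \<theta> * u) * E \<theta> * (2 * l (V + 1) * exp (- l (V + 1) / 8))"
  proof -
    from jumps[OF l0(2)] obtain \<eta> where \<eta>: "poisson_jumps (measure \<rho> {b<..V + 1}) (uniform_measure \<rho> {b<..V + 1}) \<eta>"
        "P 1 = compound_poisson (measure \<rho> {b<..V + 1}) (uniform_measure \<rho> {b<..V + 1}) \<eta>"
        "mgf (uniform_measure \<rho> {b<..V + 1}) \<theta> = ennreal (l (V + 1) / measure \<rho> {b<..V + 1})"
      by blast
    have m: "mgf (compound_poisson (measure \<rho> {b<..V + 1}) (uniform_measure \<rho> {b<..V + 1}) \<eta>) \<theta> = ennreal (E \<theta>)"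
      using mgf_P[OF \<theta>(1)] \<eta>(2) by simp
    have "{u<..} \<subseteq> {u..}"
      by auto
    from poisson_jumps.jump_count_bounds(2)[OF \<eta>(1) \<theta>(1) l0(2) \<eta>(3) m E_nonneg _ this]
    show ?thesis
      unfolding \<eta>(2)[symmetric] by (simp add: Q_def p_def)
  qed
  \<comment> \<open>The interval begins below \<open>u\<close>, so Chernoff's bound is taken at
    \<open>u - 1\<close>. The extra factor \<open>exp \<theta>\<close> is later absorbed in
    \<open>L\<close>.\<close>
  have 3: "measure (P 1) (Ij 0) \<le> 2 / l V * Q V (Ij 0) + exp (- \<theta> * (u - 1)) * E \<theta> * exp (- l V / 8)"
  proof -
    from jumps[OF l0(1)] obtain \<eta> where \<eta>: "poisson_jumps (measure \<rho> {b<..V}) (uniform_measure \<rho> {b<..V}) \<eta>"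
        "P 1 = compound_poisson (measure \<rho> {b<..V}) (uniform_measure \<rho> {b<..V}) \<eta>"
        "mgf (uniform_measure \<rho> {b<..V}) \<theta> = ennreal (l V / measure \<rho> {b<..V})"
      by blast
    have m: "mgf (compound_poisson (measure \<rho> {b<..V}) (uniform_measure \<rho> {b<..V}) \<eta>) \<theta> = ennreal (E \<theta>)"
      using mgf_P[OF \<theta>(1)] \<eta>(2) by simp
    have "Ij 0 \<subseteq> {u - 1..}"
      using d by (auto simp: Ij_def)
    then show ?thesis
      using poisson_jumps.jump_count_bounds(1)[OF \<eta>(1) \<theta>(1) l0(1) \<eta>(3) m E_nonneg, of "Ij 0" "u - 1"]
      unfolding \<eta>(2)[symmetric] by (simp add: Q_def)
  qed
  define j where "j = exp (\<theta> / 4) - 1"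
  \<comment> \<open>Chernoff's bound exceeds \<open>p\<close> by at most
    \<open>exp (L powr (3 / 4))\<close>, and an atypical jump count saves
    \<open>exp (- l W / 8)\<close>, where \<open>l W \<ge> L / 2\<close>.\<close>
  define X where "X = exp (L powr (3 / 4) - L / 16)"
  have j: "0 < j" "j \<le> real J"
    using e1 J by (auto simp: j_def)
  have p0: "0 \<le> p"
    by (simp add: p_def)
  have X_ge: "exp (- \<theta> * u) * E \<theta> * exp (- l W / 8) \<le> p * X" if "L / 2 \<le> l W" for W
  proof -
    have "exp (- \<theta> * u) * E \<theta> * exp (- l W / 8) \<le> p * exp (L powr (3 / 4)) * exp (- L / 16)"
      using that p0 E_nonneg[of \<theta>] by (intro mult_mono low) auto
    also have "\<dots> = p * X"
      by (simp add: X_def mult.assoc flip: exp_add)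
    finally show ?thesis .
  qed
  have 4: "Q (V + 1) {u<..} \<le> L * (4 * p + 2 * (p * X))"
  proof -
    have "Q (V + 1) {u<..} \<le> l (V + 1) * (4 * p + 2 * (exp (- \<theta> * u) * E \<theta> * exp (- l (V + 1) / 8)))"
      using 2 by (simp add: algebra_simps)
    also have "\<dots> \<le> L * (4 * p + 2 * (p * X))"
    proof (rule mult_mono)
      show "4 * p + 2 * (exp (- \<theta> * u) * E \<theta> * exp (- l (V + 1) / 8)) \<le> 4 * p + 2 * (p * X)"
        using X_ge[of "V + 1"] lV l_mono by linarith
    qed (use l_le L0 p0 E_nonneg[of \<theta>] in auto)
    finally show ?thesis .
  qed
  have "2 / l V * Q V (Ij 0) \<le> 4 / L * (exp 1 * (L * (4 * p + 2 * (p * X))) / j)"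
  proof (intro mult_mono)
    show "2 / l V \<le> 4 / L"
      using lV L0 l0 by (simp add: field_simps)
    have "Q V (Ij 0) \<le> exp 1 * (L * (4 * p + 2 * (p * X))) / real J"
      using 1 4 J0 by (meson divide_right_mono exp_ge_zero less_imp_le mult_left_mono order_trans)
    also have "\<dots> \<le> exp 1 * (L * (4 * p + 2 * (p * X))) / j"
      using j L0 p0 by (intro divide_left_mono) (auto simp: X_def)
    finally show "Q V (Ij 0) \<le> exp 1 * (L * (4 * p + 2 * (p * X))) / j" .
  qed (use L0 in \<open>auto simp: Q_def\<close>)
  also have "\<dots> = (16 * exp 1 / j + 8 * exp 1 / j * X) * p"
    using L0 j by (simp add: field_simps)
  finally have 5: "2 / l V * Q V (Ij 0) \<le> (16 * exp 1 / j + 8 * exp 1 / j * X) * p" .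
  have "exp (- \<theta> * (u - 1)) * E \<theta> * exp (- l V / 8) = exp \<theta> * (exp (- \<theta> * u) * E \<theta> * exp (- l V / 8))"
  proof -
    have "- \<theta> * (u - 1) = \<theta> + - \<theta> * u"
      by (simp add: algebra_simps)
    then have "exp (- \<theta> * (u - 1)) = exp \<theta> * exp (- \<theta> * u)"
      by (simp only: exp_add)
    then show ?thesis
      by (simp only: mult.assoc)
  qed
  also have "\<dots> \<le> L * (p * X)"
    using L0 E_nonneg[of \<theta>] by (intro mult_mono[OF L1 X_ge[OF lV]]) auto
  finally have "measure (P 1) (Ij 0) \<le> (16 * exp 1 / j + (8 * exp 1 / j + L) * X) * p"
    using 3 5 by (simp add: algebra_simps)
  then show ?case
    by (simp add: Ij_def u_def d_def j_def L_def p_def X_def)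
qed

section \<open>Early and late crossings of the level\<close>

lemma sup_tail_bound:
  "\<exists>F. (F \<longlongrightarrow> 1) at_top \<and> (\<forall>\<^sub>F \<theta> in at_top. 0 < measure M {\<omega>\<in>space M. U \<theta> < X 1 \<omega>} \<and>
    measure M (sup_event (U \<theta>)) \<le> F \<theta> * measure M {\<omega>\<in>space M. U \<theta> < X 1 \<omega>})"
proof -
  interpret prob_space M
    using process by (simp add: levy_process_def)
  obtain C where C: "0 \<le> C" "\<And>t d. 0 \<le> t \<Longrightarrow> 0 < d \<Longrightarrow> d \<le> 1 \<Longrightarrow> 1 - C * t / d\<^sup>2 \<le> measure (P t) {- d<..}"
    using small_time by blast
  obtain c p where p: "0 < p" "\<And>r. r \<in> {0..1} \<Longrightarrow> p \<le> measure (P r) {- c..}"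
    using lower_bound_unit_interval by blast
  obtain e0 where e0: "0 < e0" "\<And>e \<theta>. 0 < e \<Longrightarrow> e \<le> e0 \<Longrightarrow> 0 \<le> \<theta> \<Longrightarrow>
      ennreal (exp (- \<theta>) / 2 * exp (e * (mom 0 \<theta> - lam))) \<le> mgf (P e) \<theta>"
    using mgf_small_time by blast
  \<comment> \<open>Relative to the tail of \<open>X 1\<close>, \<open>f\<close> bounds the mass
    just below the level and \<open>g\<close> the crossings before \<open>1 - e\<close>. The
    denominator in \<open>F\<close> is the Ottaviani constant for the time that remains.\<close>
  define f where "f \<theta> = 16 * exp 1 / (exp (\<theta> / 4) - 1) +
      (8 * exp 1 / (exp (\<theta> / 4) - 1) + mom 0 \<theta>) * exp (mom 0 \<theta> powr (3 / 4) - mom 0 \<theta> / 16)" for \<theta>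
  define g where "g \<theta> = 2 / p * exp ((\<bar>c\<bar> + 1) * ln (mom 0 \<theta>) + lam + mom 0 \<theta> powr (3 / 4) - mom 0 \<theta> powr (7 / 8))" for \<theta>
  define F where "F \<theta> = g \<theta> + (1 + f \<theta>) / (1 - C * exp (- \<theta>))" for \<theta>
  have "((\<lambda>\<theta>. F \<theta>) \<longlongrightarrow> 0 + (1 + 0) / (1 - C * 0)) at_top"
    unfolding F_def
  proof (intro tendsto_intros)
    have "((\<lambda>L. 2 / p * exp ((\<bar>c\<bar> + 1) * ln L + lam + L powr (3 / 4) - L powr (7 / 8))) \<longlongrightarrow> 0) at_top"
      by real_asymp
    then show "(g \<longlongrightarrow> 0) at_top"
      unfolding g_def using mom_0_at_top by (rule filterlim_compose)
    show "((\<lambda>\<theta>::real. exp (- \<theta>)) \<longlongrightarrow> 0) at_top"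
      by real_asymp
    have 1: "((\<lambda>\<theta>::real. 16 * exp 1 / (exp (\<theta> / 4) - 1)) \<longlongrightarrow> 0) at_top" "((\<lambda>\<theta>::real. 8 * exp 1 / (exp (\<theta> / 4) - 1)) \<longlongrightarrow> 0) at_top"
      by real_asymp+
    have "((\<lambda>L::real. exp (L powr (3 / 4) - L / 16)) \<longlongrightarrow> 0) at_top" "((\<lambda>L::real. L * exp (L powr (3 / 4) - L / 16)) \<longlongrightarrow> 0) at_top"
      by real_asymp+
    from this[THEN filterlim_compose, OF mom_0_at_top]
    have "((\<lambda>\<theta>. 16 * exp 1 / (exp (\<theta> / 4) - 1) + (8 * exp 1 / (exp (\<theta> / 4) - 1) * exp (mom 0 \<theta> powr (3 / 4) - mom 0 \<theta> / 16) +
        mom 0 \<theta> * exp (mom 0 \<theta> powr (3 / 4) - mom 0 \<theta> / 16))) \<longlongrightarrow> 0 + (0 * 0 + 0)) at_top"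
      using 1 by (intro tendsto_add tendsto_mult)
    then show "(f \<longlongrightarrow> 0) at_top"
      unfolding f_def by (simp add: distrib_right)
  qed simp
  then have F: "(F \<longlongrightarrow> 1) at_top"
    by simp
  have ev1: "\<forall>\<^sub>F \<theta>::real in at_top. exp (- (3 * \<theta>)) \<le> e0 \<and> C * exp (- \<theta>) < 1 / 2"
  proof (intro eventually_conj)
    show "\<forall>\<^sub>F \<theta>::real in at_top. exp (- (3 * \<theta>)) \<le> e0"
      using e0(1) by real_asymp
    show "\<forall>\<^sub>F \<theta>::real in at_top. C * exp (- \<theta>) < 1 / 2"
      by real_asymp
  qed
  have "\<forall>\<^sub>F \<theta> in at_top. 0 < measure M {\<omega>\<in>space M. U \<theta> < X 1 \<omega>} \<and>
    measure M (sup_event (U \<theta>)) \<le> F \<theta> * measure M {\<omega>\<in>space M. U \<theta> < X 1 \<omega>}"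
    \<comment> \<open>The constant 24 is 3 times 8: from \<open>exp (24 * \<theta>) \<le> L\<close>
      follows \<open>e \<ge> L powr (- 1 / 8)\<close>, that is
      \<open>e * L \<ge> L powr (7 / 8)\<close>.\<close>
    using tail_lower_bound prob_just_below_level ev1 mom_0_superexponential[of 24] eventually_ge_at_top[of 1]
  proof eventually_elim
    case (elim \<theta>)
    define L where "L = mom 0 \<theta>"
    define u where "u = U \<theta>"
    define e where "e = exp (- (3 * \<theta>))"
    define d where "d = exp (- \<theta>)"
    define r where "r = measure (P 1) {u<..}"
    interpret P: real_distribution "P 1" by (rule P) simp
    have \<theta>: "0 \<le> \<theta>" "1 \<le> \<theta>"
      using elim by auto
    have e: "0 < e" "e < 1" "e \<le> e0"
      using elim \<theta> by (auto simp: e_def)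
    have d: "0 < d" "d \<le> 1"
      using \<theta> by (auto simp: d_def)
    have Lge: "exp (24 * \<theta>) \<le> L"
      using elim by (simp add: L_def)
    then have L0: "0 < L"
      using exp_gt_zero[of "24 * \<theta>"] by linarith
    have lnL: "24 * \<theta> \<le> ln L"
      using Lge L0 by (simp add: ln_ge_iff)
    have Epos: "0 < E \<theta>"
    proof -
      obtain c1 where "1 / 2 \<le> measure (P 1) {- c1..}"
        using real_distribution_atLeast_half[OF P.real_distribution_axioms] by blast
      from mgf_ge[OF P.real_distribution_axioms this \<theta>(1)]
      have "exp (- \<theta> * c1) * (1 / 2) \<le> E \<theta>"
        using E_nonneg by (simp add: mgf_P[OF \<theta>(1)])
      then show ?thesis
        using exp_gt_zero[of "- \<theta> * c1"] by linarith
    qed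
    have low: "exp (- \<theta> * u) * E \<theta> * exp (- (L powr (3 / 4))) \<le> r"
      using elim(1) by (simp add: u_def L_def r_def)
    have "0 < exp (- \<theta> * u) * E \<theta> * exp (- (L powr (3 / 4)))"
      using Epos by simp
    then have r0: "0 < r"
      using low by linarith
    have low': "exp (- \<theta> * u) * E \<theta> \<le> r * exp (L powr (3 / 4))"
    proof -
      have "exp (- \<theta> * u) * E \<theta> = exp (- \<theta> * u) * E \<theta> * exp (- (L powr (3 / 4))) * exp (L powr (3 / 4))"
        by (simp add: exp_minus)
      also have "\<dots> \<le> r * exp (L powr (3 / 4))"
        by (intro mult_right_mono low) auto
      finally show ?thesis .
    qed

    \<comment> \<open>A drop by a fixed \<open>c\<close> is harmless here: it costs
      \<open>exp (\<theta> * c)\<close>, at most a power of \<open>L\<close> since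
      \<open>\<theta> \<le> ln L\<close>, and the saving \<open>exp (- (L powr (7 / 8)))\<close>
      dwarfs that.\<close>
    have early: "measure M {\<omega>\<in>space M. \<exists>t\<in>{0..1 - e}. u < X t \<omega>} \<le> g \<theta> * r"
    proof -
      define m where "m = exp (- \<theta>) / 2 * exp (e * (L - lam))"
      have m0: "0 < m"
        by (simp add: m_def)
      have "p * measure M {\<omega>\<in>space M. \<exists>t\<in>{0..1 - e}. u < X t \<omega>} \<le> measure M {\<omega>\<in>space M. u - c < X (1 - e) \<omega>}"
        using e p(2) by (intro levy_process_sup_le[OF process]) (auto simp: P_def[symmetric])
      also have "\<dots> = measure (P (1 - e)) {u - c<..}"
        using e by (simp add: P_eq_prob)
      also have "\<dots> \<le> exp (- \<theta> * (u - c)) * (E \<theta> / m)"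
      proof -
        interpret Pe: real_distribution "P (1 - e)" using e by (intro P) simp
        \<comment> \<open>Exponential moments multiply over the two time intervals, so the lower
          bound at time \<open>e\<close> becomes an upper bound at time
          \<open>1 - e\<close>.\<close>
        have "P 1 = (P (1 - e) \<star> P e)"
          using P_add[of "1 - e" e] e by simp
        then have "mgf (P (1 - e)) \<theta> * mgf (P e) \<theta> = ennreal (E \<theta>)"
          using e by (simp add: mgf_P[OF \<theta>(1), symmetric] mgf_convolution[OF P P])
        moreover have "ennreal m \<le> mgf (P e) \<theta>"
          using e0(2)[OF e(1,3) \<theta>(1)] by (simp add: m_def L_def)
        ultimately have le: "mgf (P (1 - e)) \<theta> * ennreal m \<le> ennreal (E \<theta>)"
          by (metis mult_left_mono zero_le)
        have "mgf (P (1 - e)) \<theta> \<noteq> \<top>"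
          using le m0 by (auto simp: ennreal_top_mult top_unique)
        then obtain y where y: "mgf (P (1 - e)) \<theta> = ennreal y" "0 \<le> y"
          by (cases "mgf (P (1 - e)) \<theta>" rule: ennreal_cases) auto
        have "y * m \<le> E \<theta>"
          using le y m0 E_nonneg[of \<theta>] by (simp flip: ennreal_mult)
        then have y2: "y \<le> E \<theta> / m"
          using m0 by (simp add: pos_le_divide_eq)
        have "ennreal (measure (P (1 - e)) {u - c<..}) \<le> emeasure (P (1 - e)) {u - c..}"
          unfolding Pe.emeasure_eq_measure[symmetric] by (intro emeasure_mono) auto
        also have "\<dots> \<le> ennreal (exp (- \<theta> * (u - c))) * mgf (P (1 - e)) \<theta>"
          using \<theta> by (intro emeasure_tail_le_mgf Pe.real_distribution_axioms)
        also have "\<dots> = ennreal (exp (- \<theta> * (u - c)) * y)"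
          using y by (simp flip: ennreal_mult)
        finally have "measure (P (1 - e)) {u - c<..} \<le> exp (- \<theta> * (u - c)) * y"
          using y by simp
        also have "\<dots> \<le> exp (- \<theta> * (u - c)) * (E \<theta> / m)"
          by (intro mult_left_mono y2) simp
        finally show ?thesis .
      qed
      also have "\<dots> = 2 * exp (\<theta> * (c + 1) - e * (L - lam)) * (exp (- \<theta> * u) * E \<theta>)"
      proof -
        have "exp (- \<theta>) * exp (e * (L - lam)) * exp (\<theta> - e * (L - lam)) = 1"
          unfolding exp_add[symmetric] by simp
        then have "2 * exp (\<theta> - e * (L - lam)) * m = 1"
          by (simp add: m_def ac_simps)
        then have "1 / m = 2 * exp (\<theta> - e * (L - lam))"
          using m0 by (simp add: divide_eq_eq)
        then have "exp (- \<theta> * (u - c)) * (E \<theta> / m) = 2 * (exp (- \<theta> * (u - c)) * exp (\<theta> - e * (L - lam))) * E \<theta>"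
          by (simp add: divide_inverse)
        also have "exp (- \<theta> * (u - c)) * exp (\<theta> - e * (L - lam)) = exp (\<theta> * (c + 1) - e * (L - lam)) * exp (- \<theta> * u)"
          unfolding exp_add[symmetric] by (simp add: algebra_simps)
        finally show ?thesis
          by simp
      qed
      also have "\<dots> \<le> 2 * exp ((\<bar>c\<bar> + 1) * ln L + lam - L powr (7 / 8)) * (r * exp (L powr (3 / 4)))"
      proof (rule mult_mono[OF _ low'])
        have "\<theta> * (c + 1) \<le> ln L * (\<bar>c\<bar> + 1)"
        proof -
          have "\<theta> * (c + 1) \<le> \<theta> * (\<bar>c\<bar> + 1)"
            using \<theta> by (intro mult_left_mono) auto
          also have "\<dots> \<le> ln L * (\<bar>c\<bar> + 1)"
            using lnL \<theta> by (intro mult_right_mono) auto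
          finally show ?thesis .
        qed
        moreover have "e * lam \<le> 1 * lam"
          using e lam_pos by (intro mult_right_mono) auto
        moreover have "L powr (7 / 8) \<le> e * L"
        proof -
          have "L powr (7 / 8) = exp (- (ln L / 8)) * L"
          proof -
            have "exp (- (ln L / 8)) * L = exp (- (ln L / 8)) * exp (ln L)"
              using L0 by simp
            also have "\<dots> = exp (7 / 8 * ln L)"
              unfolding exp_add[symmetric] by simp
            finally show ?thesis
              using L0 by (simp add: powr_def)
          qed
          also have "\<dots> \<le> e * L"
            using lnL L0 by (simp add: e_def)
          finally show ?thesis .
        qed
        ultimately show "2 * exp (\<theta> * (c + 1) - e * (L - lam)) \<le> 2 * exp ((\<bar>c\<bar> + 1) * ln L + lam - L powr (7 / 8))"
          by (simp add: algebra_simps)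
      qed (use E_nonneg in auto)
      also have "\<dots> = p * (g \<theta> * r)"
        using p(1) by (simp add: g_def L_def exp_add exp_diff)
      finally show ?thesis
        using p(1) by simp
    qed

    \<comment> \<open>Now the permitted drop is \<open>d\<close>. Within time \<open>e\<close> it is
      exceeded with probability at most
      \<open>C * e / d\<^sup>2 = C * exp (- \<theta>)\<close>.\<close>
    have late: "measure M {\<omega>\<in>space M. \<exists>t\<in>{1 - e..1}. u < X t \<omega>} \<le> (1 + f \<theta>) / (1 - C * exp (- \<theta>)) * r"
    proof -
      define s where "s = 1 - C * exp (- \<theta>)"
      have s: "0 < s"
        using elim(3) by (simp add: s_def)
      have ed: "e / d\<^sup>2 = exp (- \<theta>)"
        by (simp add: e_def d_def power2_eq_square flip: exp_add exp_diff)
      have "s \<le> measure (P q) {- d..}" if q: "0 \<le> q" "q \<le> e" for q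
      proof -
        interpret Pq: real_distribution "P q" using q by (intro P)
        have "C * q / d\<^sup>2 \<le> C * e / d\<^sup>2"
          using q C(1) by (intro divide_right_mono mult_left_mono) auto
        also have "C * e / d\<^sup>2 = C * exp (- \<theta>)"
          unfolding ed[symmetric] by simp
        finally have "s \<le> 1 - C * q / d\<^sup>2"
          by (simp add: s_def)
        also have "\<dots> \<le> measure (P q) {- d<..}"
          using q d by (intro C(2)) auto
        also have "\<dots> \<le> measure (P q) {- d..}"
          by (intro Pq.finite_measure_mono) auto
        finally show ?thesis .
      qed
      then have "s * measure M {\<omega>\<in>space M. \<exists>t\<in>{1 - e..1}. u < X t \<omega>} \<le> measure M {\<omega>\<in>space M. u - d < X 1 \<omega>}"
        using e by (intro levy_process_sup_le[OF process]) (auto simp: P_def[symmetric])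
      also have "\<dots> = measure (P 1) {u - d<..}"
        by (simp add: P_eq_prob)
      also have "\<dots> = measure (P 1) ({u - d<..u} \<union> {u<..})"
        using d by (intro arg_cong[where f="measure (P 1)"]) auto
      also have "\<dots> \<le> measure (P 1) {u - d<..u} + r"
        unfolding r_def by (intro measure_Un_le) auto
      also have "\<dots> \<le> f \<theta> * r + r"
        using elim(2) by (simp add: f_def u_def d_def r_def)
      finally show ?thesis
        using s by (simp add: s_def[symmetric] pos_le_divide_eq algebra_simps)
    qed

    have meas: "{\<omega>\<in>space M. \<exists>t\<in>{0..1 - e}. u < X t \<omega>} \<in> sets M" "{\<omega>\<in>space M. \<exists>t\<in>{1 - e..1}. u < X t \<omega>} \<in> sets M"
      using e by (intro levy_process_sup_le(1)[OF process, of _ _ 0]; simp)+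
    have "sup_event u = {\<omega>\<in>space M. \<exists>t\<in>{0..1 - e}. u < X t \<omega>} \<union> {\<omega>\<in>space M. \<exists>t\<in>{1 - e..1}. u < X t \<omega>}"
    proof -
      have "{0..1} = {0..1 - e} \<union> {1 - e..1}"
        using e by auto
      then show ?thesis
        unfolding sup_event_eq by blast
    qed
    then have "measure M (sup_event u) \<le> measure M {\<omega>\<in>space M. \<exists>t\<in>{0..1 - e}. u < X t \<omega>} +
        measure M {\<omega>\<in>space M. \<exists>t\<in>{1 - e..1}. u < X t \<omega>}"
      using measure_Un_le[OF meas] by (simp only:)
    also have "\<dots> \<le> g \<theta> * r + (1 + f \<theta>) / (1 - C * exp (- \<theta>)) * r"
      by (rule add_mono[OF early late])
    also have "\<dots> = F \<theta> * r"
      by (simp add: F_def distrib_right)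
    finally show ?case
      using r0 by (simp add: r_def u_def P_eq_prob)
  qed
  with F show ?thesis
    by blast
qed

section \<open>From the levels \<open>U \<theta>\<close> to all levels\<close>

lemma U_cont: "continuous_on {0..} U"
  unfolding U_def by (intro continuous_intros mom_cont)

lemma U_at_top: "filterlim U at_top at_top"
proof (rule filterlim_at_top_mono)
  show "filterlim (\<lambda>\<theta>. exp ((b + 2) * \<theta>)) at_top at_top"
    using b_ge by real_asymp
  show "\<forall>\<^sub>F \<theta> in at_top. exp ((b + 2) * \<theta>) \<le> U \<theta>"
    by (intro always_eventually allI) (simp add: U_def mom_nonneg)
qed

text \<open>The ratio is at least 1 because time 1 is among the times considered. For the upper
  bound, \<open>U\<close> is continuous and unbounded, so the intermediate value theorem finds a
  large \<open>\<theta>\<close> with \<open>U \<theta> = u\<close> for every large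
  \<open>u\<close>.\<close>

lemma sup_tail_ratio:
  "((\<lambda>u. measure M (sup_event u) / measure M {\<omega>\<in>space M. u < X 1 \<omega>}) \<longlongrightarrow> 1) at_top"
proof -
  interpret prob_space M
    using process by (simp add: levy_process_def)
  have sup_meas: "sup_event u \<in> sets M" for u
    unfolding sup_event_eq by (rule levy_process_sup_le(1)[OF process, of _ _ 0]) auto
  obtain F where F: "(F \<longlongrightarrow> 1) at_top" "\<forall>\<^sub>F \<theta> in at_top. 0 < measure M {\<omega>\<in>space M. U \<theta> < X 1 \<omega>} \<and>
      measure M (sup_event (U \<theta>)) \<le> F \<theta> * measure M {\<omega>\<in>space M. U \<theta> < X 1 \<omega>}"
    using sup_tail_bound by blast
  show ?thesis
  proof (rule order_tendstoI)
    fix a :: real assume a: "1 < a"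
    have "\<forall>\<^sub>F \<theta> in at_top. F \<theta> < a \<and> 0 \<le> \<theta> \<and> (0 < measure M {\<omega>\<in>space M. U \<theta> < X 1 \<omega>} \<and>
      measure M (sup_event (U \<theta>)) \<le> F \<theta> * measure M {\<omega>\<in>space M. U \<theta> < X 1 \<omega>})"
      using order_tendstoD(2)[OF F(1) a] F(2) eventually_ge_at_top[of 0] by eventually_elim blast
    then obtain \<theta>0 where \<theta>0: "\<And>\<theta>. \<theta>0 \<le> \<theta> \<Longrightarrow> F \<theta> < a \<and> 0 \<le> \<theta> \<and> (0 < measure M {\<omega>\<in>space M. U \<theta> < X 1 \<omega>} \<and>
      measure M (sup_event (U \<theta>)) \<le> F \<theta> * measure M {\<omega>\<in>space M. U \<theta> < X 1 \<omega>})"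
      unfolding eventually_at_top_linorder by blast
    show "\<forall>\<^sub>F u in at_top. measure M (sup_event u) / measure M {\<omega>\<in>space M. u < X 1 \<omega>} < a"
      using eventually_ge_at_top[of "U \<theta>0"]
    proof eventually_elim
      case (elim u)
      have "\<forall>\<^sub>F \<theta> in at_top. u \<le> U \<theta> \<and> \<theta>0 \<le> \<theta>"
        using U_at_top unfolding filterlim_at_top by (intro eventually_conj eventually_ge_at_top) blast
      then obtain \<theta>1 where \<theta>1: "u \<le> U \<theta>1" "\<theta>0 \<le> \<theta>1"
        using eventually_happens'[OF trivial_limit_at_top_linorder] by blast
      have "continuous_on {\<theta>0..\<theta>1} U"
        using \<theta>0 by (intro continuous_on_subset[OF U_cont]) auto
      from IVT'[OF elim \<theta>1 this] obtain \<theta> where \<theta>: "\<theta>0 \<le> \<theta>" "U \<theta> = u"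
        by auto
      from \<theta>0[OF \<theta>(1)] have "0 < measure M {\<omega>\<in>space M. u < X 1 \<omega>}"
          "measure M (sup_event u) \<le> F \<theta> * measure M {\<omega>\<in>space M. u < X 1 \<omega>}" "F \<theta> < a"
        by (auto simp: \<theta>(2))
      then show ?case
        by (simp add: divide_less_eq) (meson le_less_trans mult_strict_right_mono)
    qed
  next
    fix a :: real assume a: "a < 1"
    have "\<forall>\<^sub>F \<theta> in at_top. 0 \<le> \<theta> \<and> 0 < measure M {\<omega>\<in>space M. U \<theta> < X 1 \<omega>}"
      using F(2) eventually_ge_at_top[of 0] by eventually_elim blast
    then obtain \<theta>0 where \<theta>0: "\<And>\<theta>. \<theta>0 \<le> \<theta> \<Longrightarrow> 0 \<le> \<theta> \<and> 0 < measure M {\<omega>\<in>space M. U \<theta> < X 1 \<omega>}"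
      unfolding eventually_at_top_linorder by blast
    show "\<forall>\<^sub>F u in at_top. a < measure M (sup_event u) / measure M {\<omega>\<in>space M. u < X 1 \<omega>}"
      using eventually_ge_at_top[of "U \<theta>0"]
    proof eventually_elim
      case (elim u)
      have "\<forall>\<^sub>F \<theta> in at_top. u \<le> U \<theta> \<and> \<theta>0 \<le> \<theta>"
        using U_at_top unfolding filterlim_at_top by (intro eventually_conj eventually_ge_at_top) blast
      then obtain \<theta>1 where \<theta>1: "u \<le> U \<theta>1" "\<theta>0 \<le> \<theta>1"
        using eventually_happens'[OF trivial_limit_at_top_linorder] by blast
      have X1: "X 1 \<in> borel_measurable M"
        using process by (simp add: levy_process_def)
      then have m: "{\<omega>\<in>space M. U \<theta>1 < X 1 \<omega>} \<in> sets M" "{\<omega>\<in>space M. u < X 1 \<omega>} \<in> sets M"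
        by measurable
      have "0 < measure M {\<omega>\<in>space M. U \<theta>1 < X 1 \<omega>}"
        using \<theta>0[OF \<theta>1(2)] by blast
      also have "\<dots> \<le> measure M {\<omega>\<in>space M. u < X 1 \<omega>}"
        using \<theta>1 m by (intro finite_measure_mono) auto
      finally have pos: "0 < measure M {\<omega>\<in>space M. u < X 1 \<omega>}" .
      have "measure M {\<omega>\<in>space M. u < X 1 \<omega>} \<le> measure M (sup_event u)"
        by (intro finite_measure_mono sup_meas) (auto simp: sup_event_eq)
      then have "1 \<le> measure M (sup_event u) / measure M {\<omega>\<in>space M. u < X 1 \<omega>}"
        using pos by simp
      then show ?case
        using a by simp
    qed
  qed
qed

end

theorem theorem2:
  fixes M :: "'a measure" and X :: "real \<Rightarrow> 'a \<Rightarrow> real"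
    and \<gamma> :: real and \<rho> :: "real measure" and a u\<^sub>0 :: real and h :: "real \<Rightarrow> real"
  assumes levy: "levy_process M X"
    and rho: "levy_measure \<rho>"
    and chf: "\<forall>t\<ge>0. \<forall>s. char (distr M borel (X t)) s = exp (complex_of_real t * levy_exponent \<gamma> \<rho> s)"
    and pos_right: "emeasure \<rho> {0<..} > 0"
    and fin_left: "emeasure \<rho> {..<0} < \<infinity>"
    and a_pos: "a > 0"
    and a_mass: "emeasure \<rho> {a<..} > 0"
    and u0: "u\<^sub>0 \<ge> 0"
    and tail: "\<forall>u>u\<^sub>0. measure \<rho> ({u<..} \<inter> {a<..}) / measure \<rho> {a<..} = exp (- integral {0..u} h)"
    and h_pos: "\<forall>v\<ge>0. h v > 0"
    and h_cont: "continuous_on {0..} h"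
    and h_mono: "strict_mono_on {0..} h"
    and h_lim: "filterlim h at_top at_top"
    and h_growth: "\<forall>c>0. \<exists>v\<^sub>c. \<forall>v\<ge>v\<^sub>c. h (v + c) \<le> exp (c * h v / 8)"
  shows "((\<lambda>u. prob_space.prob M {\<omega>\<in>space M. (SUP t\<in>{0..1}. X t \<omega>) > u}
               / prob_space.prob M {\<omega>\<in>space M. X 1 \<omega> > u}) \<longlongrightarrow> 1) at_top"
proof -
  \<comment> \<open>Constant extension to the left of 0, so that \<open>h'\<close> is positive,
    continuous and monotone on the whole line.\<close>
  define h' where "h' v = h (max 0 v)" for v
  \<comment> \<open>The oriented integral keeps \<open>H\<close> differentiable at and below 0; on
    the nonnegative axis it is the integral in the hypothesis.\<close>
  define H where "H x = (LBINT y=0..ereal x. h' y)" for x :: real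
  define K where "K = measure \<rho> {a<..}"
  \<comment> \<open>The bound 1 keeps jumps above \<open>b\<close> uncompensated, \<open>a\<close>
    makes the intersection in the tail hypothesis trivial, and \<open>u\<^sub>0 + 1\<close> gives
    the strict inequality that this hypothesis asks for.\<close>
  define b where "b = max 1 (max a (u\<^sub>0 + 1))"
  have h'_cont: "continuous_on UNIV h'"
    unfolding h'_def by (rule continuous_on_compose2[OF h_cont]) (auto intro!: continuous_intros)
  have H_deriv: "(H has_real_derivative h' x) (at x)" for x
  proof -
    define B where "B = \<bar>x\<bar> + 1"
    have "(H has_vector_derivative h' x) (at x within {-B..B})"
      unfolding H_def zero_ereal_def using h'_cont
      by (intro interval_integral_FTC2 continuous_on_subset[OF h'_cont]) (auto simp: B_def)
    moreover have "x \<in> interior {-B..B}"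
      by (auto simp: B_def)
    ultimately show ?thesis
      unfolding has_real_derivative_iff_has_vector_derivative by (simp only: at_within_interior)
  qed
  have H_eq: "H x = integral {0..x} h" if "0 \<le> x" for x
  proof -
    have "set_integrable lborel {0..x} h'"
      by (intro borel_integrable_atLeastAtMost' continuous_on_subset[OF h'_cont]) auto
    then have "H x = integral {0..x} h'"
      unfolding H_def zero_ereal_def using that by (intro interval_integral_eq_integral) auto
    also have "\<dots> = integral {0..x} h"
      by (rule integral_cong) (simp add: h'_def)
    finally show ?thesis .
  qed
  have K: "0 < K"
  proof -
    have "emeasure \<rho> {a<..} < \<infinity>"
      using a_pos by (intro levy_measure_finite[OF rho, of _ a]) auto
    then show ?thesis
      using a_mass unfolding K_def
      by (metis emeasure_eq_ennreal_measure ennreal_0 infinity_ennreal_def less_irrefl measure_nonneg order_le_less)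
  qed
  interpret superexponential_levy \<rho> h' H b K M X \<gamma>
  proof
    show "measure \<rho> {x<..} = K * exp (- H x)" if "b \<le> x" for x
    proof -
      have x: "a \<le> x" "u\<^sub>0 < x" "0 \<le> x"
        using that by (auto simp: b_def)
      have "{x<..} \<inter> {a<..} = {x<..}"
        using x by auto
      then show ?thesis
        using tail[rule_format, OF x(2)] K x by (simp add: K_def[symmetric] H_eq field_simps)
    qed
    show "mono h'"
      unfolding h'_def mono_def
      using strict_mono_on_leD[OF h_mono] by auto
    show "filterlim h' at_top at_top"
    proof (rule filterlim_cong[THEN iffD1, OF refl refl _ h_lim])
      show "\<forall>\<^sub>F v in at_top. h v = h' v"
        using eventually_ge_at_top[of 0] by eventually_elim (simp add: h'_def)
    qed
    obtain v where v: "\<And>x. v \<le> x \<Longrightarrow> h (x + 2) \<le> exp (2 * h x / 8)"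
      using h_growth[rule_format, of 2] by auto
    show "\<forall>\<^sub>F v in at_top. h' (v + 2) \<le> exp (h' v / 4)"
      using eventually_ge_at_top[of "max 0 v"]
    proof eventually_elim
      case (elim x)
      then show ?case
        using v[of x] by (simp add: h'_def)
    qed
    show "H 0 = 0"
      by (simp add: H_def zero_ereal_def)
  qed (use levy rho chf K h_pos h'_cont H_deriv in \<open>auto simp: b_def h'_def\<close>)
  show ?thesis
    using sup_tail_ratio unfolding sup_event_def .
qed

end
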